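(* Let $t\ge 1$ be a fixed integer. For $q$ a power of $2$, consider the quantity $$Q(q,t)=\prod_{i \geq 1} \left(1-\frac{1}{q^{2i-1}}\right) \ \prod_{1\le j \leq t/2}\ \prod_{i \geq 1} \left( 1+\frac{(-1)^i}{q^{ij}} \right)^{N^*(q;2j)} \ \prod_{1\le j \leq t}\ \prod_{i \geq 1} \left( 1-\frac{1}{q^{ij}} \right)^{M^*(q;j)}.$$ (1) For $t$ and even $q$ fixed, the limiting proportion as $n\to\infty$ of elements of $\operatorname{Sp}_{2n}(q)$ whose characteristic polynomial has no (irreducible) factors of degree at most $t$ is equal to $Q(q,t)$. (2) The quantity $Q(q,t)$ is uniformly bounded away from $1$. (3) The quantity $Q(q,t)$ is uniformly bounded away from $0$.
   Context: For a polynomial $\phi\in\mathbf{F}_q[z]$ of degree $n$ with non-zero constant term, the conjugate is $\phi^*(z):=\phi(0)^{-1}z^n\phi(z^{-1})$. $N^*(q;j)$ is the number of monic irreducible polynomials $\phi\ne z$ of degree $j$ over $\mathbf{F}_q$ with $\phi=\phi^*$, and $M^*(q;j)$ is the number of unordered pairs $\{\phi,\phi^*\}$ of monic irreducible polynomials, different from $z$, of degree $j$ over $\mathbf{F}_q$ with $\phi\neq\phi^*$. Factors are over $\mathbf{F}_q$. In (2) and (3), "uniformly" means uniformly over all even prime powers $q$, with $t$ fixed. *)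

theory Defs
  imports
    "HOL-Analysis.Infinite_Products"
    "HOL-Library.Z2"
    "HOL-Algebra.Algebraic_Closure_Type"
    "Jordan_Normal_Form.Char_Poly"
begin

hide_const (open) UnivPoly.coeff UnivPoly.monom Module.smult

section \<open>The finite fields of characteristic two\<close>

text \<open>
  Uniformity in \<open>q\<close> requires quantifying over all fields \<open>F\<^sub>q\<close> inside a single formula, so they are
  realised as subsets of one type, the algebraic closure of the field with two elements:
  for \<open>q = 2 ^ k\<close> with \<open>k \<ge> 1\<close>, \<open>GF q\<close> is its unique subfield with \<open>q\<close> elements.
\<close>

definition GF :: "nat \<Rightarrow> bit alg_closure set" where
  "GF q = {x. x ^ q = x}"

lemma CHAR_bit: "CHAR(bit) = 2"
proof (rule CHAR_eq_posI)
  show "of_nat 2 = (0 :: bit)" by simp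
next
  fix x :: nat assume "x > 0" "x < 2"
  hence "x = 1" by simp
  thus "of_nat x \<noteq> (0 :: bit)" by simp
qed simp

lemma CHAR_bit_alg_closure: "CHAR(bit alg_closure) = 2"
  by (simp add: CHAR_bit)

lemma GF_closed:
  assumes "k \<ge> 1"
  shows "0 \<in> GF (2 ^ k)" "1 \<in> GF (2 ^ k)"
    and "x \<in> GF (2 ^ k) \<Longrightarrow> y \<in> GF (2 ^ k) \<Longrightarrow> x + y \<in> GF (2 ^ k)"
    and "x \<in> GF (2 ^ k) \<Longrightarrow> - x \<in> GF (2 ^ k)"
    and "x \<in> GF (2 ^ k) \<Longrightarrow> y \<in> GF (2 ^ k) \<Longrightarrow> x * y \<in> GF (2 ^ k)"
    and "x \<in> GF (2 ^ k) \<Longrightarrow> inverse x \<in> GF (2 ^ k)"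
proof -
  have char: "Factorial_Ring.prime CHAR(bit alg_closure)"
    by (simp add: CHAR_bit)
  show "x \<in> GF (2 ^ k) \<Longrightarrow> y \<in> GF (2 ^ k) \<Longrightarrow> x + y \<in> GF (2 ^ k)"
    using freshmans_dream'[OF char, of "2 ^ k" k x y]
    by (simp add: GF_def CHAR_bit)
  show "x \<in> GF (2 ^ k) \<Longrightarrow> - x \<in> GF (2 ^ k)"
    by (simp only: uminus_CHAR_2[OF CHAR_bit_alg_closure])
qed (use assms in \<open>auto simp: GF_def power_mult_distrib power_inverse power_0_left\<close>)

lemma card_GF:
  assumes "k \<ge> 1"
  shows "finite (GF (2 ^ k))" "card (GF (2 ^ k)) = 2 ^ k"
proof -
  define q :: nat where "q = 2 ^ k"
  have q: "q > 1" "even q"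
    using assms one_less_power[of "2::nat" k] by (auto simp: q_def)
  define p :: "bit alg_closure poly" where "p = Polynomial.monom 1 q - Polynomial.monom 1 1"
  have deg: "Polynomial.degree p = q"
    unfolding p_def using q
    by (subst diff_conv_add_uminus, subst degree_add_eq_left) (auto simp: degree_monom_eq)
  have nz: "p \<noteq> 0"
    using deg q by auto
  have q0: "of_nat q = (0 :: bit alg_closure)"
    using q by (simp add: of_nat_eq_0_iff_char_dvd CHAR_bit)
  have pd: "pderiv p = - 1"
    by (simp add: p_def pderiv_diff pderiv_monom q0)
  have roots: "GF q = {x. poly p x = 0}"
    by (auto simp: GF_def p_def poly_monom)
  have fin: "finite (GF q)"
    unfolding roots by (rule poly_roots_finite[OF nz])
  obtain A where A: "size A = Polynomial.degree p"
    "p = Polynomial.smult (lead_coeff p) (\<Prod>x\<in>#A. [:- x, 1:])"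
    using alg_closed_imp_factorization[OF nz] by blast
  have lc: "lead_coeff p \<noteq> 0"
    using nz by simp
  have setA: "set_mset A = GF q"
  proof -
    have "poly p x = lead_coeff p * (\<Prod>y\<in>#A. x - y)" for x
      by (subst A(2)) (simp add: poly_prod_mset image_mset.compositionality o_def)
    hence "poly p x = 0 \<longleftrightarrow> x \<in># A" for x
      using lc by (auto simp: prod_mset_zero_iff)
    thus ?thesis by (auto simp: roots)
  qed
  have "count A x \<le> 1" for x
  proof (rule ccontr)
    assume "\<not> count A x \<le> 1"
    hence "x \<in># A" and "count (A - {#x#}) x > 0"
      by (auto simp: count_greater_zero_iff[symmetric] simp del: count_greater_zero_iff)
    then obtain A' B where "A = add_mset x A'" "A' = add_mset x B"
      by (metis add_mset_remove_trivial count_greater_zero_iff mset_add)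
    hence B: "A = add_mset x (add_mset x B)" by simp
    define r where "r = Polynomial.smult (lead_coeff p) (\<Prod>y\<in>#B. [:- y, 1:])"
    have "p = [:- x, 1:] * ([:- x, 1:] * r)"
      by (subst A(2)) (simp add: B r_def mult_ac)
    hence "poly (pderiv p) x = 0"
      by (simp only: pderiv_mult) simp
    thus False by (simp add: pd)
  qed
  hence "count A x = (if x \<in> set_mset A then 1 else 0)" for x
    using count_greater_eq_one_iff[of A x] by (auto simp: not_in_iff le_antisym)
  hence "A = mset_set (set_mset A)"
    by (intro multiset_eqI) (simp add: count_mset_set')
  hence "size A = card (GF q)"
    by (metis setA size_mset_set)
  thus "card (GF (2 ^ k)) = 2 ^ k" "finite (GF (2 ^ k))"
    using A(1) deg fin by (simp_all add: q_def)
qed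

section \<open>Polynomials over a subfield\<close>

text \<open>Throughout, \<open>F\<close> is (the carrier of) a subfield of the ambient field.\<close>

definition polys_over :: "'a::field set \<Rightarrow> 'a poly set" where
  "polys_over F = {p. \<forall>i. Polynomial.coeff p i \<in> F}"

text \<open>Irreducibility and divisibility are those of the ring \<open>F[z]\<close>, whose units are the nonzero
  constants; they are not those of the polynomial ring over the ambient field.\<close>

definition irreducible_over :: "'a::field set \<Rightarrow> 'a poly \<Rightarrow> bool" where
  "irreducible_over F p \<longleftrightarrow> p \<in> polys_over F \<and> Polynomial.degree p > 0 \<and>
     (\<forall>g \<in> polys_over F. \<forall>h \<in> polys_over F.
        p = g * h \<longrightarrow> Polynomial.degree g = 0 \<or> Polynomial.degree h = 0)"

definition factor_over :: "'a::field set \<Rightarrow> 'a poly \<Rightarrow> 'a poly \<Rightarrow> bool" where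
  "factor_over F g p \<longleftrightarrow> g \<in> polys_over F \<and> (\<exists>h \<in> polys_over F. p = g * h)"

text \<open>\<open>reflect_poly \<phi>\<close> is the polynomial \<open>z\<^sup>n \<phi>(1/z)\<close> where \<open>n\<close> is the degree of \<open>\<phi>\<close>
  (see \<open>poly_reflect_poly_nz\<close>). Only used for \<open>\<phi>(0) \<noteq> 0\<close>.\<close>

definition conjugate_poly :: "'a::field poly \<Rightarrow> 'a poly" where
  "conjugate_poly \<phi> = Polynomial.smult (inverse (poly \<phi> 0)) (reflect_poly \<phi>)"

definition monic_irreds :: "'a::field set \<Rightarrow> nat \<Rightarrow> 'a poly set" where
  "monic_irreds F j = {\<phi>. irreducible_over F \<phi> \<and> lead_coeff \<phi> = 1 \<and>
     Polynomial.degree \<phi> = j \<and> \<phi> \<noteq> [:0, 1:]}"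

definition Nstar :: "nat \<Rightarrow> nat \<Rightarrow> nat" where
  "Nstar q j = card {\<phi> \<in> monic_irreds (GF q) j. \<phi> = conjugate_poly \<phi>}"

definition Mstar :: "nat \<Rightarrow> nat \<Rightarrow> nat" where
  "Mstar q j = card {{\<phi>, conjugate_poly \<phi>} | \<phi>.
     {\<phi>, conjugate_poly \<phi>} \<subseteq> monic_irreds (GF q) j \<and> \<phi> \<noteq> conjugate_poly \<phi>}"

section \<open>The symplectic group and the quantity $Q(q,t)$\<close>

definition symplectic_form :: "nat \<Rightarrow> 'a::field mat" where
  "symplectic_form n = four_block_mat (0\<^sub>m n n) (1\<^sub>m n) (- 1\<^sub>m n) (0\<^sub>m n n)"

definition Sp :: "nat \<Rightarrow> 'a::field set \<Rightarrow> 'a mat set" where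
  "Sp n F = {A \<in> carrier_mat (2 * n) (2 * n). elements_mat A \<subseteq> F \<and>
     transpose_mat A * symplectic_form n * A = symplectic_form n}"

definition no_small_factor :: "'a::field set \<Rightarrow> nat \<Rightarrow> 'a poly \<Rightarrow> bool" where
  "no_small_factor F t p \<longleftrightarrow>
     \<not> (\<exists>\<phi>. irreducible_over F \<phi> \<and> factor_over F \<phi> p \<and> Polynomial.degree \<phi> \<le> t)"

definition Sp_proportion :: "nat \<Rightarrow> nat \<Rightarrow> nat \<Rightarrow> real" where
  "Sp_proportion q t n =
     real (card {A \<in> Sp n (GF q). no_small_factor (GF q) t (char_poly A)}) /
     real (card (Sp n (GF q)))"

text \<open>Library infinite products start at \<open>0\<close>, so the index \<open>i \<ge> 1\<close> becomes \<open>Suc i\<close>;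
  in the first product \<open>2 * Suc i - 1 = 2 * i + 1\<close>.\<close>

definition Q_Sp :: "nat \<Rightarrow> nat \<Rightarrow> real" where
  "Q_Sp q t =
     (\<Prod>i. 1 - 1 / real q ^ (2 * Suc i - 1)) *
     (\<Prod>j \<in> {1..t div 2}. \<Prod>i. (1 + (-1) ^ Suc i / real q ^ (Suc i * j)) ^ Nstar q (2 * j)) *
     (\<Prod>j \<in> {1..t}. \<Prod>i. (1 - 1 / real q ^ (Suc i * j)) ^ Mstar q j)"

definition even_prime_power :: "nat \<Rightarrow> bool" where
  "even_prime_power q \<longleftrightarrow> (\<exists>k \<ge> 1. q = 2 ^ k)"

end

theory Submission
  imports Defs "HOL-Library.Function_Algebras"
begin

text \<open>
  Call vectors \<open>v\<^sub>i\<close> killed by \<open>\<phi>\<^sub>i(T)\<close> independent generators if they span a copy of \<open>\<Oplus> F[z]/(\<phi>\<^sub>i)\<close>.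
  The number of such tuples with \<open>k p\<close> indices \<open>i\<close> satisfying \<open>\<phi>\<^sub>i = p\<close> is the product over \<open>p\<close> and \<open>s < k p\<close>
  of \<open>|ker p(T)| - q\<^bsup>s deg p\<^esup>\<close>, so Moebius inversion over the subspaces of \<open>ker p(T)\<close> writes the
  indicator that no \<open>p(T)\<close> is singular as a combination of these numbers. By Witt's theorem their mean over the
  symplectic group is the number of alternating forms on \<open>\<Oplus> F[z]/(\<phi>\<^sub>i)\<close> invariant under
  multiplication by \<open>z\<close>, at least for large \<open>n\<close>, and is never larger. Such a form amounts to a family of linear recurrent
  sequences, so these forms can be counted. As \<open>p(T)\<close> and \<open>p\<^sup>*(T)\<close> are singular simultaneously, one polynomial from each
  conjugate pair suffices, and the proportion tends to a product of one series for each polynomial; Euler's partition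
  identities turn these series into the infinite products of \<open>Q(q,t)\<close>.

  For the uniform bounds, \<open>N\<^sup>*(q;2j)\<close> and \<open>M\<^sup>*(q;j)\<close> are at most \<open>q\<^sup>j\<close>, which keeps \<open>Q(q,t)\<close> away from \<open>0\<close>. It stays
  away from \<open>1\<close> because of the factor \<open>1 - 1/q\<close> if \<open>q = 2\<close>, and otherwise because \<open>M\<^sup>*(q;1) \<ge> (q - 2)/2\<close>.
\<close>

section \<open>Alternating spaces over a finite field and Witt's theorem\<close>

text \<open>The fields are subsets of one algebraically closed type, so everything is relative to a
  subfield \<open>F\<close>: \<open>V\<close> is a finite \<open>F\<close>-subspace of a space over
  the ambient field, group elements act on the whole ambient space, and spans and irreducibility are
  those over \<open>F\<close>. Moebius inversion over subspaces asks only for mean numbers of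
  independent tuples, so no conjugacy classes or centralisers have to be classified. The obstacle is
  the exchange of the limit in \<open>n\<close> with the infinite sum over multiplicities: the mean
  equals the number of forms only while the total degree is at most \<open>n\<close>. Beyond that
  the number of forms is still an upper bound, and absolute convergence of the local series makes
  the remainder vanish. Characteristic two shows on the diagonal of the forms: alternating is
  stronger than symmetric, which forces \<open>s 0 = 0\<close> on diagonal sequences. So
  \<open>z + 1\<close>, the only self-conjugate irreducible of odd degree, carries no nonzero form
  on a single copy.\<close>

locale finite_subfield =
  fixes F :: "'a::field set"
  assumes finite_F: "finite F" and F_0: "0 \<in> F" and F_1: "1 \<in> F"
    and F_add: "\<And>x y. x \<in> F \<Longrightarrow> y \<in> F \<Longrightarrow> x + y \<in> F"
    and F_uminus: "\<And>x. x \<in> F \<Longrightarrow> - x \<in> F"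
    and F_mult: "\<And>x y. x \<in> F \<Longrightarrow> y \<in> F \<Longrightarrow> x * y \<in> F"
    and F_inverse: "\<And>x. x \<in> F \<Longrightarrow> inverse x \<in> F"
begin

abbreviation "q \<equiv> card F"

lemma F_diff: "x \<in> F \<Longrightarrow> y \<in> F \<Longrightarrow> x - y \<in> F"
  using F_add[of x "- y"] F_uminus by simp

lemma F_sum: "(\<And>x. x \<in> J \<Longrightarrow> g x \<in> F) \<Longrightarrow> sum g J \<in> F"
  by (induction J rule: infinite_finite_induct) (auto simp: F_0 F_add)

lemma F_power: "x \<in> F \<Longrightarrow> x ^ n \<in> F"
  by (induction n) (auto simp: F_1 F_mult)

lemma q_ge_2: "q \<ge> 2"
proof -
  have "card {0::'a, 1} \<le> q"
    by (intro card_mono) (auto simp: finite_F F_0 F_1)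
  thus ?thesis by simp
qed

end

text \<open>A synonym of \<open>vector_space\<close> that carries \<open>pact\<close>. It is
  instantiated for the space containing \<open>V\<close> and, as \<open>fs\<close>, for functions
  with \<open>fscale\<close>, which covers both sequences and column vectors.\<close>

locale poly_action = vector_space scale for scale :: "'a::field \<Rightarrow> 'v::ab_group_add \<Rightarrow> 'v"

locale subfield_space = poly_action scale + finite_subfield F
  for scale :: "'a::field \<Rightarrow> 'v::ab_group_add \<Rightarrow> 'v" and F :: "'a set" +
  fixes V :: "'v set"
  assumes finite_V: "finite V" and V_0: "0 \<in> V"
    and V_add: "\<And>x y. x \<in> V \<Longrightarrow> y \<in> V \<Longrightarrow> x + y \<in> V"
    and V_scale: "\<And>c x. c \<in> F \<Longrightarrow> x \<in> V \<Longrightarrow> scale c x \<in> V"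
begin

lemma V_uminus: "x \<in> V \<Longrightarrow> - x \<in> V"
  using V_scale[of "- 1" x] F_uminus[OF F_1] by simp

lemma V_diff: "x \<in> V \<Longrightarrow> y \<in> V \<Longrightarrow> x - y \<in> V"
  using V_add[of x "- y"] V_uminus by simp

lemma V_sum: "(\<And>x. x \<in> J \<Longrightarrow> g x \<in> V) \<Longrightarrow> sum g J \<in> V"
  by (induction J rule: infinite_finite_induct) (auto simp: V_0 V_add)

text \<open>Coefficients are meant to range over \<open>F\<close> only, so the span and the
  independence built on this differ from those of \<open>vector_space\<close>. Indexed families are
  used because the vectors \<open>T^a v_i\<close> come with indices.\<close>

definition comb :: "'i set \<Rightarrow> ('i \<Rightarrow> 'v) \<Rightarrow> ('i \<Rightarrow> 'a) \<Rightarrow> 'v" where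
  "comb J f c = (\<Sum>x\<in>J. scale (c x) (f x))"

definition indep :: "'i set \<Rightarrow> ('i \<Rightarrow> 'v) \<Rightarrow> bool" where
  "indep J f \<longleftrightarrow> (\<forall>c \<in> J \<rightarrow> F. comb J f c = 0 \<longrightarrow> (\<forall>x\<in>J. c x = 0))"

text \<open>Extensional coefficient functions make \<open>comb\<close> injective for independent
  families, so spans can be counted.\<close>

definition fspan :: "'i set \<Rightarrow> ('i \<Rightarrow> 'v) \<Rightarrow> 'v set" where
  "fspan J f = comb J f ` (J \<rightarrow>\<^sub>E F)"

lemma comb_cong: "(\<And>x. x \<in> J \<Longrightarrow> c x = d x) \<Longrightarrow> (\<And>x. x \<in> J \<Longrightarrow> f x = g x) \<Longrightarrow> comb J f c = comb J g d"
  by (auto simp: comb_def intro!: sum.cong)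

lemma comb_in_V: "f \<in> J \<rightarrow> V \<Longrightarrow> c \<in> J \<rightarrow> F \<Longrightarrow> comb J f c \<in> V"
  unfolding comb_def by (intro V_sum V_scale) auto

lemma comb_in_fspan: "c \<in> J \<rightarrow> F \<Longrightarrow> comb J f c \<in> fspan J f"
proof -
  assume "c \<in> J \<rightarrow> F"
  moreover have "comb J f c = comb J f (restrict c J)" by (rule comb_cong) auto
  ultimately show ?thesis unfolding fspan_def by (auto intro!: image_eqI[of _ _ "restrict c J"])
qed

lemma fspanE:
  assumes "v \<in> fspan J f" obtains c where "c \<in> J \<rightarrow>\<^sub>E F" "v = comb J f c"
  using assms by (auto simp: fspan_def)

lemma fspan_subset: "f \<in> J \<rightarrow> V \<Longrightarrow> fspan J f \<subseteq> V"
  by (auto simp: fspan_def PiE_def intro!: comb_in_V)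

lemma comb_add: "comb J f (\<lambda>x. c x + d x) = comb J f c + comb J f d"
  by (simp add: comb_def scale_left_distrib sum.distrib)

lemma comb_diff: "comb J f (\<lambda>x. c x - d x) = comb J f c - comb J f d"
  by (simp add: comb_def scale_left_diff_distrib sum_subtractf)

lemma comb_scale: "comb J f (\<lambda>x. a * c x) = scale a (comb J f c)"
  by (simp add: comb_def scale_sum_right)

lemma comb_insert: "finite J \<Longrightarrow> x \<notin> J \<Longrightarrow> comb (insert x J) f c = scale (c x) (f x) + comb J f c"
  by (simp add: comb_def)

lemma indep_cong: "(\<And>x. x \<in> J \<Longrightarrow> f x = g x) \<Longrightarrow> indep J f \<longleftrightarrow> indep J g"
  unfolding indep_def using comb_cong[of J _ _ f g] by simp

lemma comb_inj:
  assumes "indep J f"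
  shows "inj_on (comb J f) (J \<rightarrow>\<^sub>E F)"
proof
  fix c d assume c: "c \<in> J \<rightarrow>\<^sub>E F" and d: "d \<in> J \<rightarrow>\<^sub>E F" and eq: "comb J f c = comb J f d"
  have "comb J f (\<lambda>x. c x - d x) = 0" using eq by (simp add: comb_diff)
  moreover have "(\<lambda>x. c x - d x) \<in> J \<rightarrow> F" using c d by (auto intro!: F_diff)
  ultimately have "\<forall>x\<in>J. c x - d x = 0" using assms by (auto simp: indep_def)
  thus "c = d" using c d by (intro PiE_ext[of c J "\<lambda>_. F" d]) auto
qed

lemma card_fspan:
  assumes "finite J" "indep J f"
  shows "card (fspan J f) = q ^ card J"
  unfolding fspan_def using assms by (simp add: card_image comb_inj card_PiE)

lemma indep_insert:
  assumes J: "finite J" "x \<notin> J" and f: "indep J f" and v: "v \<notin> fspan J f"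
  shows "indep (insert x J) (f(x := v))"
  unfolding indep_def
proof (intro ballI impI)
  fix c y assume c: "c \<in> insert x J \<rightarrow> F" and z: "comb (insert x J) (f(x := v)) c = 0"
    and y: "y \<in> insert x J"
  have eq: "scale (c x) v + comb J f c = 0"
  proof -
    have "comb J (f(x := v)) c = comb J f c" using J by (intro comb_cong) auto
    thus ?thesis using z J by (simp add: comb_insert)
  qed
  have cx: "c x = 0"
  proof (rule ccontr)
    assume nz: "c x \<noteq> 0"
    have "scale (inverse (c x)) (scale (c x) v + comb J f c) = 0" using eq by simp
    hence "v + scale (inverse (c x)) (comb J f c) = 0"
      using nz by (simp add: scale_right_distrib)
    hence "v = comb J f (\<lambda>y. - inverse (c x) * c y)"
      unfolding comb_scale by (simp add: eq_neg_iff_add_eq_0)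
    moreover have "(\<lambda>y. - inverse (c x) * c y) \<in> J \<rightarrow> F"
      using c by (auto intro!: F_mult F_uminus F_inverse simp del: mult_minus_left)
    ultimately show False using v comb_in_fspan by metis
  qed
  hence "comb J f c = 0" using eq by simp
  hence "\<forall>x\<in>J. c x = 0" using f c by (auto simp: indep_def)
  thus "c y = 0" using cx y by auto
qed

text \<open>The crude estimate \<open>k < 2^k \<le> q^k\<close> gives strictness, which makes
  \<open>card V - card J\<close> decrease in the inductions that enlarge a family.\<close>

lemma indep_card_bound:
  assumes "finite J" "indep J f" "f \<in> J \<rightarrow> V"
  shows "card J < card V"
proof -
  have "card J < 2 ^ card J" by (rule less_exp)
  also have "\<dots> \<le> q ^ card J" using q_ge_2 by (intro power_mono) auto
  also have "\<dots> \<le> card V"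
    using card_fspan[OF assms(1,2)] fspan_subset[OF assms(3)] finite_V card_mono by metis
  finally show ?thesis .
qed

text \<open>The infinite index type always supplies a fresh index for the next vector.\<close>

lemma extend_to_basis:
  fixes J :: "'i set"
  assumes inf: "infinite (UNIV :: 'i set)"
    and "finite J" "f \<in> J \<rightarrow> V" "indep J f"
  shows "\<exists>Y g. finite Y \<and> J \<subseteq> Y \<and> g \<in> Y \<rightarrow> V \<and> indep Y g \<and> fspan Y g = V \<and> (\<forall>x\<in>J. g x = f x)"
  using assms(2-)
proof (induction "card V - card J" arbitrary: J f rule: less_induct)
  case less
  show ?case
  proof (cases "fspan J f = V")
    case True
    thus ?thesis using less.prems by blast
  next
    case False
    then obtain v where v: "v \<in> V" "v \<notin> fspan J f" using fspan_subset less.prems by blast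
    obtain x where x: "x \<notin> J" using inf less.prems(1) ex_new_if_finite by blast
    let ?f = "f(x := v)"
    have ind: "indep (insert x J) ?f" using indep_insert[OF less.prems(1) x less.prems(3) v(2)] .
    have fV: "?f \<in> insert x J \<rightarrow> V" using less.prems v by auto
    have "card V - card (insert x J) < card V - card J"
      using indep_card_bound[OF less.prems(1,3,2)] x less.prems(1) by simp
    moreover have "finite (insert x J)" using less.prems(1) by simp
    ultimately obtain Y g where Y: "finite Y" "insert x J \<subseteq> Y" "g \<in> Y \<rightarrow> V" "indep Y g" "fspan Y g = V"
      "\<forall>y\<in>insert x J. g y = ?f y"
      using less.hyps[OF _ _ fV ind] by blast
    have "\<forall>y\<in>J. g y = f y"
    proof
      fix y assume "y \<in> J"
      hence "y \<noteq> x" "g y = ?f y" using x Y(6) by auto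
      thus "g y = f y" by simp
    qed
    thus ?thesis using Y by blast
  qed
qed

end

section \<open>Alternating forms and a counting proof of Witt's theorem\<close>

locale symplectic_space = subfield_space scale F V
  for scale :: "'a::field \<Rightarrow> 'v::ab_group_add \<Rightarrow> 'v" and F :: "'a set" and V :: "'v set" +
  fixes \<omega> :: "'v \<Rightarrow> 'v \<Rightarrow> 'a"
  assumes \<omega>_add_left: "\<And>x y z. \<omega> (x + y) z = \<omega> x z + \<omega> y z"
    and \<omega>_add_right: "\<And>x y z. \<omega> z (x + y) = \<omega> z x + \<omega> z y"
    and \<omega>_scale_left: "\<And>c x z. \<omega> (scale c x) z = c * \<omega> x z"
    and \<omega>_scale_right: "\<And>c x z. \<omega> z (scale c x) = c * \<omega> z x"
    and \<omega>_alternating: "\<And>x. \<omega> x x = 0"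
    and \<omega>_in_F: "\<And>x y. x \<in> V \<Longrightarrow> y \<in> V \<Longrightarrow> \<omega> x y \<in> F"
    and \<omega>_nondegenerate: "\<And>x. x \<in> V \<Longrightarrow> (\<And>y. y \<in> V \<Longrightarrow> \<omega> x y = 0) \<Longrightarrow> x = 0"
begin

lemma \<omega>_0_left [simp]: "\<omega> 0 z = 0"
  using \<omega>_scale_left[of 0 0 z] by simp

lemma \<omega>_0_right [simp]: "\<omega> z 0 = 0"
  using \<omega>_scale_right[of z 0 0] by simp

lemma \<omega>_minus_left: "\<omega> (- x) z = - \<omega> x z"
  using \<omega>_add_left[of x "- x" z] by (simp add: eq_neg_iff_add_eq_0 add.commute)

lemma \<omega>_diff_left: "\<omega> (x - y) z = \<omega> x z - \<omega> y z"
  using \<omega>_add_left[of x "- y" z] \<omega>_minus_left by simp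

lemma \<omega>_sum_left: "\<omega> (sum g J) z = (\<Sum>x\<in>J. \<omega> (g x) z)"
  by (induction J rule: infinite_finite_induct) (auto simp: \<omega>_add_left)

lemma \<omega>_sum_right: "\<omega> z (sum g J) = (\<Sum>x\<in>J. \<omega> z (g x))"
  by (induction J rule: infinite_finite_induct) (auto simp: \<omega>_add_right)

lemma \<omega>_antisym: "\<omega> x y = - \<omega> y x"
proof -
  have "\<omega> x y + \<omega> y x = 0"
    using \<omega>_alternating[of "x + y"]
    by (simp add: \<omega>_add_left \<omega>_add_right \<omega>_alternating[of x] \<omega>_alternating[of y] add.commute)
  thus ?thesis using eq_neg_iff_add_eq_0 by blast
qed

lemma \<omega>_comb_left: "\<omega> (comb J f c) z = (\<Sum>x\<in>J. c x * \<omega> (f x) z)"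
  by (simp add: comb_def \<omega>_sum_left \<omega>_scale_left)

lemma \<omega>_comb_right: "\<omega> z (comb J f c) = (\<Sum>x\<in>J. c x * \<omega> z (f x))"
  by (simp add: comb_def \<omega>_sum_right \<omega>_scale_right)

text \<open>Extend to a basis of \<open>V\<close>: by nondegeneracy a vector is determined by its
  products with the basis, and there are as many vectors as patterns of values, so every pattern
  occurs.\<close>

lemma dual_family_surj:
  fixes J :: "'i set"
  assumes inf: "infinite (UNIV :: 'i set)"
    and J: "finite J" "f \<in> J \<rightarrow> V" "indep J f" and r: "r \<in> J \<rightarrow> F"
  shows "\<exists>v\<in>V. \<forall>x\<in>J. \<omega> v (f x) = r x"
proof -
  obtain Y g where Y: "finite Y" "J \<subseteq> Y" "g \<in> Y \<rightarrow> V" "indep Y g" "fspan Y g = V" "\<forall>x\<in>J. g x = f x"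
    using extend_to_basis[OF inf J] by blast
  define \<Phi> where "\<Phi> v = (\<lambda>y\<in>Y. \<omega> v (g y))" for v
  have inj: "inj_on \<Phi> V"
  proof
    fix v w assume v: "v \<in> V" "w \<in> V" and eq: "\<Phi> v = \<Phi> w"
    have "v - w = 0"
    proof (rule \<omega>_nondegenerate)
      fix u assume "u \<in> V"
      then obtain c where "u = comb Y g c" using Y(5) fspanE by metis
      moreover have "\<omega> v (g y) = \<omega> w (g y)" if "y \<in> Y" for y
        using fun_cong[OF eq, of y] that by (simp add: \<Phi>_def)
      ultimately show "\<omega> (v - w) u = 0"
        by (auto simp: \<omega>_diff_left \<omega>_comb_right intro!: sum.cong)
    qed (use v V_diff in auto)
    thus "v = w" by simp
  qed
  have sub: "\<Phi> ` V \<subseteq> Y \<rightarrow>\<^sub>E F" using Y(3) by (auto simp: \<Phi>_def intro!: \<omega>_in_F)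
  have "card (\<Phi> ` V) = card (Y \<rightarrow>\<^sub>E F)"
    using card_image[OF inj] card_fspan[OF Y(1,4)] Y(5) Y(1) by (simp add: card_PiE)
  hence im: "\<Phi> ` V = Y \<rightarrow>\<^sub>E F"
    using sub by (intro card_subset_eq finite_PiE Y finite_F) auto
  define r' where "r' = (\<lambda>y\<in>Y. if y \<in> J then r y else 0)"
  have "r' \<in> Y \<rightarrow>\<^sub>E F" using r by (auto simp: r'_def F_0)
  then obtain v where v: "v \<in> V" "r' = \<Phi> v" using im by (metis imageE)
  have "\<omega> v (f x) = r x" if "x \<in> J" for x
    using fun_cong[OF v(2), of x] that Y(2,6) by (auto simp: r'_def \<Phi>_def)
  thus ?thesis using v by blast
qed

text \<open>Solution sets for different right-hand sides are carried into one another by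
  translations, and they partition \<open>V\<close>.\<close>

lemma card_solutions:
  fixes J :: "'i set"
  assumes inf: "infinite (UNIV :: 'i set)"
    and J: "finite J" "f \<in> J \<rightarrow> V" "indep J f" and r: "r \<in> J \<rightarrow> F"
  shows "card {v\<in>V. \<forall>x\<in>J. \<omega> v (f x) = r x} * q ^ card J = card V"
proof -
  define S where "S r = {v\<in>V. \<forall>x\<in>J. \<omega> v (f x) = r x}" for r
  have le: "card (S r) \<le> card (S s)" if r: "r \<in> J \<rightarrow> F" and s: "s \<in> J \<rightarrow> F" for r s
  proof -
    obtain v where v: "v \<in> V" "\<forall>x\<in>J. \<omega> v (f x) = s x - r x"
      using dual_family_surj[OF inf J, of "\<lambda>x. s x - r x"] r s F_diff by fastforce
    have "(\<lambda>w. w + v) ` S r \<subseteq> S s"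
      using v by (auto simp: S_def \<omega>_add_left intro: V_add)
    moreover have "finite (S s)" using finite_V by (auto simp: S_def)
    ultimately show ?thesis by (metis (no_types, lifting) add_right_cancel card_inj_on_le inj_onI)
  qed
  have "V = (\<Union>s\<in>J \<rightarrow>\<^sub>E F. S s)"
  proof (intro equalityI subsetI)
    fix v assume v: "v \<in> V"
    hence "(\<lambda>x\<in>J. \<omega> v (f x)) \<in> J \<rightarrow>\<^sub>E F" using J(2) \<omega>_in_F by auto
    moreover have "v \<in> S (\<lambda>x\<in>J. \<omega> v (f x))" using v by (auto simp: S_def)
    ultimately show "v \<in> (\<Union>s\<in>J \<rightarrow>\<^sub>E F. S s)" by blast
  qed (auto simp: S_def)
  hence "card V = card (\<Union>s\<in>J \<rightarrow>\<^sub>E F. S s)" by simp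
  also have "\<dots> = (\<Sum>s\<in>J \<rightarrow>\<^sub>E F. card (S s))"
  proof (rule card_UN_disjoint)
    show "\<forall>s\<in>J \<rightarrow>\<^sub>E F. \<forall>s'\<in>J \<rightarrow>\<^sub>E F. s \<noteq> s' \<longrightarrow> S s \<inter> S s' = {}"
    proof (intro ballI impI, rule ccontr)
      fix s s' assume s: "s \<in> J \<rightarrow>\<^sub>E F" "s' \<in> J \<rightarrow>\<^sub>E F" "s \<noteq> s'" "S s \<inter> S s' \<noteq> {}"
      then obtain v where "v \<in> S s" "v \<in> S s'" by blast
      hence "s x = s' x" if "x \<in> J" for x using that by (auto simp: S_def)
      thus False using s(1-3) PiE_ext by blast
    qed
  qed (use J finite_F finite_V in \<open>auto simp: S_def intro!: finite_PiE\<close>)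
  also have "\<dots> = (\<Sum>s\<in>J \<rightarrow>\<^sub>E F. card (S r))"
    by (intro sum.cong refl antisym le r) auto
  also have "\<dots> = card (S r) * q ^ card J"
    using J(1) by (simp add: card_PiE)
  finally show ?thesis by (simp add: S_def)
qed

lemma card_solutions_outside_span:
  fixes J :: "'i set"
  assumes inf: "infinite (UNIV :: 'i set)"
    and J: "finite J" "f \<in> J \<rightarrow> V" "indep J f" and r: "r \<in> J \<rightarrow> F"
  shows "card ({v\<in>V. \<forall>x\<in>J. \<omega> v (f x) = r x} - fspan J f) =
    card V div q ^ card J - card {c \<in> J \<rightarrow>\<^sub>E F. \<forall>y\<in>J. (\<Sum>x\<in>J. c x * \<omega> (f x) (f y)) = r y}"
proof -
  let ?A = "{v\<in>V. \<forall>x\<in>J. \<omega> v (f x) = r x}"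
  let ?C = "{c \<in> J \<rightarrow>\<^sub>E F. \<forall>y\<in>J. (\<Sum>x\<in>J. c x * \<omega> (f x) (f y)) = r y}"
  \<comment> \<open>On the span the conditions become linear equations for the coefficients, whose
    matrix is the Gram matrix.\<close>
  have "?A \<inter> fspan J f = comb J f ` ?C"
    using J(2) by (auto simp: fspan_def \<omega>_comb_left intro!: comb_in_V)
  moreover have "inj_on (comb J f) ?C"
    using comb_inj[OF J(3)] by (rule inj_on_subset) auto
  ultimately have "card (?A \<inter> fspan J f) = card ?C" by (simp add: card_image)
  moreover have "card ?A = card V div q ^ card J"
    using card_solutions[OF inf J r] q_ge_2 by (metis (no_types, lifting) div_mult_self_is_m not_numeral_le_zero power_eq_0_iff zero_less_iff_neq_zero)
  moreover have "card (?A - fspan J f) = card ?A - card (?A \<inter> fspan J f)"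
    using finite_V by (intro card_Diff_subset_Int) auto
  ultimately show ?thesis by simp
qed

text \<open>The number of vectors with prescribed products against a family, and the number of those inside
  the span of the family, depend only on the Gram matrix of the family; comparing the two finds a partner
  for any vector outside the span.\<close>

lemma isometric_extension_step:
  fixes J :: "'i set"
  assumes inf: "infinite (UNIV :: 'i set)" and J: "finite J"
    and f: "f \<in> J \<rightarrow> V" "indep J f" and g: "g \<in> J \<rightarrow> V" "indep J g"
    and gram: "\<And>x y. x \<in> J \<Longrightarrow> y \<in> J \<Longrightarrow> \<omega> (f x) (f y) = \<omega> (g x) (g y)"
    and v: "v \<in> V" "v \<notin> fspan J f"
  shows "\<exists>w\<in>V. w \<notin> fspan J g \<and> (\<forall>x\<in>J. \<omega> w (g x) = \<omega> v (f x))"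
proof -
  define r where "r x = \<omega> v (f x)" for x
  have r: "r \<in> J \<rightarrow> F" using v f(1) by (auto simp: r_def intro!: \<omega>_in_F)
  have "{c \<in> J \<rightarrow>\<^sub>E F. \<forall>y\<in>J. (\<Sum>x\<in>J. c x * \<omega> (f x) (f y)) = r y} =
    {c \<in> J \<rightarrow>\<^sub>E F. \<forall>y\<in>J. (\<Sum>x\<in>J. c x * \<omega> (g x) (g y)) = r y}"
    using gram by (auto cong: sum.cong)
  hence "card ({w\<in>V. \<forall>x\<in>J. \<omega> w (g x) = r x} - fspan J g) = card ({w\<in>V. \<forall>x\<in>J. \<omega> w (f x) = r x} - fspan J f)"
    by (simp add: card_solutions_outside_span[OF inf J f r] card_solutions_outside_span[OF inf J g r])
  moreover have "v \<in> {w\<in>V. \<forall>x\<in>J. \<omega> w (f x) = r x} - fspan J f"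
    using v by (auto simp: r_def)
  ultimately have "card ({w\<in>V. \<forall>x\<in>J. \<omega> w (g x) = r x} - fspan J g) > 0"
    using finite_V by (subst (asm) eq_commute) (auto simp: card_gt_0_iff)
  hence "{w\<in>V. \<forall>x\<in>J. \<omega> w (g x) = r x} - fspan J g \<noteq> {}"
    by (metis card.empty less_irrefl)
  thus ?thesis unfolding r_def by blast
qed

text \<open>Both families grow in step: a vector outside the span of the first receives a partner
  from \<open>isometric_extension_step\<close>. The new diagonal entry vanishes because the form
  alternates, and antisymmetry settles the transposed entries.\<close>

lemma isometric_extension_to_bases:
  fixes J :: "'i set"
  assumes inf: "infinite (UNIV :: 'i set)" and "finite J"
    and "f \<in> J \<rightarrow> V" "indep J f" and "g \<in> J \<rightarrow> V" "indep J g"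
    and "\<forall>x\<in>J. \<forall>y\<in>J. \<omega> (f x) (f y) = \<omega> (g x) (g y)"
  shows "\<exists>Y f' g'. finite Y \<and> J \<subseteq> Y \<and> f' \<in> Y \<rightarrow> V \<and> indep Y f' \<and> fspan Y f' = V \<and> (\<forall>x\<in>J. f' x = f x)
     \<and> g' \<in> Y \<rightarrow> V \<and> indep Y g' \<and> (\<forall>x\<in>J. g' x = g x) \<and> (\<forall>x\<in>Y. \<forall>y\<in>Y. \<omega> (f' x) (f' y) = \<omega> (g' x) (g' y))"
  using assms(2-)
proof (induction "card V - card J" arbitrary: J f g rule: less_induct)
  case less
  show ?case
  proof (cases "fspan J f = V")
    case True
    thus ?thesis using less.prems by blast
  next
    case False
    then obtain v where v: "v \<in> V" "v \<notin> fspan J f" using fspan_subset less.prems by blast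
    obtain w where w: "w \<in> V" "w \<notin> fspan J g" "\<forall>x\<in>J. \<omega> w (g x) = \<omega> v (f x)"
      using isometric_extension_step[OF inf less.prems(1-5) _ v] less.prems(6) by blast
    obtain x where x: "x \<notin> J" using inf less.prems(1) ex_new_if_finite by blast
    let ?f = "f(x := v)" and ?g = "g(x := w)"
    have ind: "indep (insert x J) ?f" "indep (insert x J) ?g" by (fact indep_insert[OF less.prems(1) x less.prems(3) v(2)], fact indep_insert[OF less.prems(1) x less.prems(5) w(2)])
    have fV: "?f \<in> insert x J \<rightarrow> V" "?g \<in> insert x J \<rightarrow> V" using less.prems v w by auto
    have gr: "\<forall>y\<in>insert x J. \<forall>z\<in>insert x J. \<omega> (?f y) (?f z) = \<omega> (?g y) (?g z)"
    proof (intro ballI)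
      fix y z assume yz: "y \<in> insert x J" "z \<in> insert x J"
      have "\<omega> (f y) v = \<omega> (g y) w" if "y \<in> J" for y
        using w(3) that \<omega>_antisym[of "f y" v] \<omega>_antisym[of "g y" w] by simp
      thus "\<omega> (?f y) (?f z) = \<omega> (?g y) (?g z)"
        using yz x less.prems(6) w(3) by (auto simp: \<omega>_alternating)
    qed
    have "card V - card (insert x J) < card V - card J"
      using indep_card_bound[OF less.prems(1,3,2)] x less.prems(1) by simp
    moreover have "finite (insert x J)" using less.prems(1) by simp
    ultimately obtain Y f' g' where Y: "finite Y" "insert x J \<subseteq> Y" "f' \<in> Y \<rightarrow> V" "indep Y f'" "fspan Y f' = V"
      "g' \<in> Y \<rightarrow> V" "indep Y g'"
      "\<forall>y\<in>insert x J. f' y = ?f y" "\<forall>y\<in>insert x J. g' y = ?g y"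
      "\<forall>x\<in>Y. \<forall>y\<in>Y. \<omega> (f' x) (f' y) = \<omega> (g' x) (g' y)"
      using less.hyps[OF _ _ fV(1) ind(1) fV(2) ind(2) gr] by blast
    have "\<forall>y\<in>J. f' y = f y \<and> g' y = g y"
    proof
      fix y assume "y \<in> J"
      hence "y \<noteq> x" "f' y = ?f y" "g' y = ?g y" using x Y(8,9) by auto
      thus "f' y = f y \<and> g' y = g y" by simp
    qed
    thus ?thesis using Y by blast
  qed
qed

text \<open>All conditions are confined to \<open>V\<close> and to scalars in \<open>F\<close>;
  values outside \<open>V\<close> are arbitrary, which is why \<open>S_full\<close> later asks for
  agreement on \<open>V\<close> only.\<close>

definition linear_isometry :: "('v \<Rightarrow> 'v) \<Rightarrow> bool" where
  "linear_isometry T \<longleftrightarrow> (\<forall>x\<in>V. T x \<in> V) \<and> (\<forall>x\<in>V. \<forall>y\<in>V. T (x + y) = T x + T y) \<and>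
     (\<forall>c\<in>F. \<forall>x\<in>V. T (scale c x) = scale c (T x)) \<and> (\<forall>x\<in>V. \<forall>y\<in>V. \<omega> (T x) (T y) = \<omega> x y)"

text \<open>A vector with coordinates \<open>c\<close> in the completed basis \<open>f'\<close> goes
  to the vector with the same coordinates in \<open>g'\<close>; equal Gram matrices make this an
  isometry. \<open>inv_into\<close> extracts the coordinates.\<close>

theorem Witt:
  fixes J :: "'i set"
  assumes inf: "infinite (UNIV :: 'i set)" and J: "finite J"
    and f: "f \<in> J \<rightarrow> V" "indep J f" and g: "g \<in> J \<rightarrow> V" "indep J g"
    and gram: "\<And>x y. x \<in> J \<Longrightarrow> y \<in> J \<Longrightarrow> \<omega> (f x) (f y) = \<omega> (g x) (g y)"
  shows "\<exists>T. linear_isometry T \<and> (\<forall>x\<in>J. T (f x) = g x)"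
proof -
  obtain Y f' g' where Y: "finite Y" "J \<subseteq> Y" "f' \<in> Y \<rightarrow> V" "indep Y f'" "fspan Y f' = V"
      "\<forall>x\<in>J. f' x = f x" "g' \<in> Y \<rightarrow> V" "indep Y g'" "\<forall>x\<in>J. g' x = g x"
      "\<forall>x\<in>Y. \<forall>y\<in>Y. \<omega> (f' x) (f' y) = \<omega> (g' x) (g' y)"
    using isometric_extension_to_bases[OF inf J f g] gram by blast
  define T where "T v = comb Y g' (inv_into (Y \<rightarrow>\<^sub>E F) (comb Y f') v)" for v
  have T: "T (comb Y f' c) = comb Y g' c" if "c \<in> Y \<rightarrow> F" for c
  proof -
    have c: "restrict c Y \<in> Y \<rightarrow>\<^sub>E F" using that by auto
    have "comb Y f' c = comb Y f' (restrict c Y)" by (rule comb_cong) auto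
    hence "T (comb Y f' c) = comb Y g' (restrict c Y)"
      unfolding T_def using inv_into_f_f[OF comb_inj[OF Y(4)] c] by simp
    also have "\<dots> = comb Y g' c" by (rule comb_cong) auto
    finally show ?thesis .
  qed
  have ex: "\<exists>c \<in> Y \<rightarrow> F. x = comb Y f' c" if "x \<in> V" for x
    using that Y(5) fspanE[of x Y f'] by (metis PiE_iff Pi_I)
  have "linear_isometry T"
    unfolding linear_isometry_def
  proof (intro conjI ballI)
    fix x y a assume "x \<in> V" "y \<in> V"
    then obtain c d where c: "c \<in> Y \<rightarrow> F" "x = comb Y f' c" and d: "d \<in> Y \<rightarrow> F" "y = comb Y f' d"
      using ex by blast
    show "T x \<in> V" using c Y(7) T by (simp add: comb_in_V)
    have "(\<lambda>x. c x + d x) \<in> Y \<rightarrow> F" using c d F_add by auto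
    from T[OF this] show "T (x + y) = T x + T y" using T c d by (simp add: comb_add)
    show "\<omega> (T x) (T y) = \<omega> x y"
      using Y(10) by (simp add: c d T \<omega>_comb_left \<omega>_comb_right cong: sum.cong)
    assume "a \<in> F"
    hence "(\<lambda>x. a * c x) \<in> Y \<rightarrow> F" using c F_mult by auto
    from T[OF this] show "T (scale a x) = scale a (T x)" using T c by (simp add: comb_scale)
  qed
  moreover have "T (f x) = g x" if "x \<in> J" for x
  proof -
    let ?c = "\<lambda>y. if y = x then 1 else 0"
    have x: "x \<in> Y" using that Y(2) by auto
    have "comb Y h ?c = h x" for h :: "'i \<Rightarrow> 'v"
    proof -
      have "comb Y h ?c = (\<Sum>y\<in>Y. if y = x then h y else 0)"
        unfolding comb_def by (intro sum.cong) auto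
      thus ?thesis using x Y(1) by simp
    qed
    moreover have "?c \<in> Y \<rightarrow> F" by (auto simp: F_0 F_1)
    ultimately show ?thesis using T[of ?c] Y(6,9) that by simp
  qed
  ultimately show ?thesis by blast
qed

end

section \<open>Polynomials over the finite field\<close>

context finite_subfield
begin

abbreviation "P \<equiv> polys_over F"

lemma P_coeff: "p \<in> P \<Longrightarrow> Polynomial.coeff p i \<in> F"
  by (simp add: polys_over_def)

lemma P_0: "0 \<in> P" and P_1: "1 \<in> P"
  by (auto simp: polys_over_def F_0 F_1 coeff_pCons one_pCons split: nat.splits)

lemma P_pCons: "c \<in> F \<Longrightarrow> p \<in> P \<Longrightarrow> pCons c p \<in> P"
  by (auto simp: polys_over_def F_0 coeff_pCons split: nat.splits)

lemma P_add: "p \<in> P \<Longrightarrow> r \<in> P \<Longrightarrow> p + r \<in> P"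
  by (auto simp: polys_over_def F_add)

lemma P_diff: "p \<in> P \<Longrightarrow> r \<in> P \<Longrightarrow> p - r \<in> P"
  by (auto simp: polys_over_def F_diff)

lemma P_smult: "c \<in> F \<Longrightarrow> p \<in> P \<Longrightarrow> Polynomial.smult c p \<in> P"
  by (auto simp: polys_over_def F_mult)

lemma P_mult: "p \<in> P \<Longrightarrow> r \<in> P \<Longrightarrow> p * r \<in> P"
  by (auto simp: polys_over_def coeff_mult intro!: F_sum F_mult)

lemma P_monom: "c \<in> F \<Longrightarrow> Polynomial.monom c n \<in> P"
  by (auto simp: polys_over_def F_0)

lemma P_reflect: "p \<in> P \<Longrightarrow> reflect_poly p \<in> P"
  by (auto simp: polys_over_def coeff_reflect_poly F_0)

lemma P_poly: "p \<in> P \<Longrightarrow> x \<in> F \<Longrightarrow> poly p x \<in> F"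
  by (auto simp: poly_altdef P_coeff intro!: F_sum F_mult F_power)

lemma P_division:
  assumes p: "p \<in> P" "p \<noteq> 0" and "g \<in> P"
  shows "\<exists>s\<in>P. \<exists>r\<in>P. g = s * p + r \<and> (r = 0 \<or> Polynomial.degree r < Polynomial.degree p)"
  using assms(3)
proof (induction "Polynomial.degree g" arbitrary: g rule: less_induct)
  case less
  show ?case
  proof (cases "g = 0 \<or> Polynomial.degree g < Polynomial.degree p")
    case True
    thus ?thesis using less.prems P_0 by force
  next
    case False
    define m where "m = Polynomial.monom (lead_coeff g / lead_coeff p) (Polynomial.degree g - Polynomial.degree p)"
    have m: "m \<in> P"
      unfolding m_def divide_inverse using p less.prems by (intro P_monom F_mult F_inverse P_coeff)
    define g' where "g' = g - m * p"
    have g': "g' \<in> P" using m p less.prems by (auto simp: g'_def intro: P_diff P_mult)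
    have "m \<noteq> 0" using False p by (auto simp: m_def)
    have degm: "Polynomial.degree (m * p) = Polynomial.degree g"
      using False p \<open>m \<noteq> 0\<close> by (simp add: degree_mult_eq m_def degree_monom_eq)
    have lead: "Polynomial.coeff (m * p) (Polynomial.degree g) = lead_coeff g"
      using False p lead_coeff_mult[of m p] unfolding degm by (simp add: m_def degree_monom_eq)
    have "g' = 0 \<or> Polynomial.degree g' < Polynomial.degree g"
    proof (rule ccontr)
      assume *: "\<not> (g' = 0 \<or> Polynomial.degree g' < Polynomial.degree g)"
      have "Polynomial.degree g' \<le> Polynomial.degree g"
        unfolding g'_def using degm by (intro degree_diff_le) auto
      hence "lead_coeff g' = 0" using * lead by (simp add: g'_def le_antisym not_less)
      thus False using * by simp
    qed
    hence "\<exists>s\<in>P. \<exists>r\<in>P. g' = s * p + r \<and> (r = 0 \<or> Polynomial.degree r < Polynomial.degree p)"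
    proof
      assume "g' = 0"
      thus ?thesis using P_0 by (intro bexI[of _ 0]) auto
    next
      assume "Polynomial.degree g' < Polynomial.degree g"
      thus ?thesis using less.hyps g' by blast
    qed
    then obtain s r where "s \<in> P" "r \<in> P" "g' = s * p + r" "r = 0 \<or> Polynomial.degree r < Polynomial.degree p"
      by blast
    hence "g = (s + m) * p + r" "s + m \<in> P"
      using m by (auto simp: g'_def algebra_simps intro: P_add)
    thus ?thesis using \<open>r \<in> P\<close> \<open>r = 0 \<or> _\<close> by blast
  qed
qed

text \<open>By uniqueness of division with remainder, \<open>div\<close> and \<open>mod\<close> of
  the ambient polynomial ring restrict to \<open>F[z]\<close>. Hence ambient divisibility can stand
  for divisibility in \<open>F[z]\<close>.\<close>

lemma P_div_mod:
  assumes "p \<in> P" "p \<noteq> 0" "g \<in> P"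
  shows "g div p \<in> P" "g mod p \<in> P"
proof -
  obtain s r where sr: "s \<in> P" "r \<in> P" "g = s * p + r" "r = 0 \<or> Polynomial.degree r < Polynomial.degree p"
    using P_division[OF assms] by blast
  hence "r mod p = r" using mod_poly_less by force
  hence m: "g mod p = r" by (simp add: sr(3))
  have "s * p + r = g div p * p + g mod p" by (simp add: sr(3)[symmetric])
  hence "s * p = g div p * p" using m by (metis add_right_cancel)
  hence "g div p = s" using assms by simp
  thus "g div p \<in> P" "g mod p \<in> P" using m sr by auto
qed

lemma factor_over_iff_dvd:
  assumes "p \<in> P" "p \<noteq> 0" "g \<in> P"
  shows "factor_over F p g \<longleftrightarrow> p dvd g"
proof
  assume "p dvd g"
  hence "g = p * (g div p)" by simp
  thus "factor_over F p g" unfolding factor_over_def using assms P_div_mod(1)[OF assms] by blast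
qed (auto simp: factor_over_def)

lemma irreducible_over_D:
  assumes "irreducible_over F p"
  shows "p \<in> P" "Polynomial.degree p > 0" "p \<noteq> 0"
  using assms by (auto simp: irreducible_over_def)

text \<open>An element \<open>h\<close> of least degree among the nonzero combinations of
  \<open>p\<close> and \<open>g\<close> over \<open>F[z]\<close> divides both. Irreducibility leaves
  a constant or an associate of \<open>p\<close>, and the latter would make \<open>p\<close> divide
  \<open>g\<close>.\<close>

lemma irreducible_over_bezout:
  assumes p: "irreducible_over F p" and g: "g \<in> P" and nd: "\<not> p dvd g"
  shows "\<exists>a\<in>P. \<exists>b\<in>P. a * p + b * g = 1"
proof -
  note pD = irreducible_over_D[OF p]
  let ?Q = "\<lambda>h. h \<noteq> 0 \<and> (\<exists>a\<in>P. \<exists>b\<in>P. h = a * p + b * g)"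
  have "?Q p" using pD P_0 P_1 by force
  then obtain h where h: "?Q h" and min: "\<And>h'. ?Q h' \<Longrightarrow> Polynomial.degree h \<le> Polynomial.degree h'"
    using ex_has_least_nat[of ?Q p Polynomial.degree] by blast
  obtain a b where ab: "a \<in> P" "b \<in> P" "h = a * p + b * g" using h by blast
  have hP: "h \<in> P" using ab pD g by (auto intro: P_add P_mult)
  have dvd: "h dvd r" if r: "c \<in> P" "d \<in> P" "r = c * p + d * g" for r c d
  proof -
    have rP: "r \<in> P" using r pD g by (auto intro: P_add P_mult)
    define e where "e = r div h"
    have e: "e \<in> P" unfolding e_def using P_div_mod hP h rP by blast
    have "r mod h = r - e * h" by (simp add: e_def minus_div_mult_eq_mod)
    also have "\<dots> = (c - e * a) * p + (d - e * b) * g"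
      by (simp add: r ab algebra_simps)
    finally have "r mod h = (c - e * a) * p + (d - e * b) * g" .
    moreover have "c - e * a \<in> P" "d - e * b \<in> P"
      using r ab e by (auto intro!: P_diff P_mult)
    ultimately have Q: "r mod h = 0 \<or> ?Q (r mod h)" by blast
    have deg: "r mod h = 0 \<or> Polynomial.degree (r mod h) < Polynomial.degree h"
      using h degree_mod_less by blast
    have "r mod h = 0"
    proof (rule ccontr)
      assume nz: "r mod h \<noteq> 0"
      hence "?Q (r mod h)" using Q by argo
      from min[OF this] show False using deg nz by simp
    qed
    thus ?thesis by auto
  qed
  have hp: "h dvd p" by (rule dvd[of 1 0]) (auto simp: P_0 P_1)
  have hg: "h dvd g" by (rule dvd[of 0 1]) (auto simp: P_0 P_1)
  have "p = h * (p div h)" using hp by simp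
  moreover have "p div h \<in> P" using P_div_mod hP h pD by blast
  ultimately have "Polynomial.degree h = 0 \<or> Polynomial.degree (p div h) = 0"
  proof -
    have "\<forall>g\<in>P. \<forall>h\<in>P. p = g * h \<longrightarrow> Polynomial.degree g = 0 \<or> Polynomial.degree h = 0"
      using p by (simp add: irreducible_over_def)
    thus ?thesis using \<open>p = h * (p div h)\<close> \<open>p div h \<in> P\<close> hP by metis
  qed
  moreover have "Polynomial.degree (p div h) \<noteq> 0"
  proof
    assume "Polynomial.degree (p div h) = 0"
    then obtain c where "p div h = [:c:]" by (rule degree_eq_zeroE)
    hence c: "p = Polynomial.smult c h" using \<open>p = h * (p div h)\<close> by simp
    hence "c \<noteq> 0" using pD by auto
    hence "p dvd g" using hg c by (simp add: smult_dvd_iff)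
    thus False using nd by blast
  qed
  ultimately obtain c where c: "h = [:c:]" "c \<noteq> 0" using h by (metis degree_eq_zeroE pCons_0_0)
  have cF: "c \<in> F" using P_coeff[OF hP, of 0] c by simp
  let ?a = "Polynomial.smult (inverse c) a" and ?b = "Polynomial.smult (inverse c) b"
  have "?a * p + ?b * g = Polynomial.smult (inverse c) h"
    by (simp add: ab smult_add_right)
  also have "\<dots> = 1" using c by (simp add: one_pCons)
  finally show ?thesis using ab cF by (blast intro: P_smult F_inverse)
qed

text \<open>A common root, even outside \<open>F\<close>, contradicts a Bezout identity. This is how
  information on eigenvalues in the ambient field becomes divisibility over
  \<open>F\<close>.\<close>

lemma irreducible_over_dvd_of_root:
  assumes p: "irreducible_over F p" and g: "g \<in> P" and r: "poly p x = 0" "poly g x = 0"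
  shows "p dvd g"
proof (rule ccontr)
  assume "\<not> p dvd g"
  then obtain a b where "a * p + b * g = 1" using irreducible_over_bezout[OF p g] by blast
  hence "poly (a * p + b * g) x = 1" by simp
  thus False using r by simp
qed

lemma irreducible_over_prime:
  assumes p: "irreducible_over F p" and g: "g \<in> P" and d: "p dvd g * h"
  shows "p dvd g \<or> p dvd h"
proof (rule ccontr)
  assume n: "\<not> (p dvd g \<or> p dvd h)"
  then obtain a b where ab: "a * p + b * g = 1" using irreducible_over_bezout[OF p g] by blast
  have "h = (a * p + b * g) * h" using ab by simp
  also have "\<dots> = a * h * p + b * (g * h)" by (simp add: algebra_simps)
  also have "p dvd \<dots>" by (rule dvd_add[OF dvd_triv_right dvd_mult[OF d]])
  finally show False using n by blast
qed

definition small_polys :: "nat \<Rightarrow> 'a poly set" where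
  "small_polys d = {r \<in> P. r = 0 \<or> Polynomial.degree r < d}"

lemma coeff_sum_monom: "Polynomial.coeff (\<Sum>a<d. Polynomial.monom (c a) a) i = (if i < d then c i else 0)"
  by (simp add: coeff_sum)

lemma sum_monom_in_P: "(\<And>a. a < d \<Longrightarrow> c a \<in> F) \<Longrightarrow> (\<Sum>a<d. Polynomial.monom (c a) a) \<in> P"
  unfolding polys_over_def by (auto simp: coeff_sum_monom F_0)

lemma small_polys_coeff_eq_0: "r \<in> small_polys d \<Longrightarrow> i \<ge> d \<Longrightarrow> Polynomial.coeff r i = 0"
  unfolding small_polys_def by (cases "r = 0") (auto intro: coeff_eq_0)

lemma small_polys_sum:
  assumes "r \<in> small_polys d"
  shows "r = (\<Sum>a<d. Polynomial.monom (Polynomial.coeff r a) a)"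
  by (rule poly_eqI) (use small_polys_coeff_eq_0[OF assms] in \<open>auto simp: coeff_sum_monom not_less\<close>)

lemma sum_monom_small:
  assumes "\<And>a. a < d \<Longrightarrow> c a \<in> F"
  shows "(\<Sum>a<d. Polynomial.monom (c a) a) \<in> small_polys d"
proof -
  let ?r = "\<Sum>a<d. Polynomial.monom (c a) a"
  have "Polynomial.degree ?r < d" if "?r \<noteq> 0"
  proof (rule ccontr)
    assume "\<not> Polynomial.degree ?r < d"
    hence "lead_coeff ?r = 0" unfolding coeff_sum_monom by simp
    thus False using that by simp
  qed
  thus ?thesis using sum_monom_in_P[of d c] assms by (auto simp: small_polys_def)
qed

lemma card_small_polys: "card (small_polys d) = q ^ d"
proof -
  have "bij_betw (\<lambda>r. \<lambda>a\<in>{..<d}. Polynomial.coeff r a) (small_polys d) ({..<d} \<rightarrow>\<^sub>E F)"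
  proof (rule bij_betwI[where g = "\<lambda>c. \<Sum>a<d. Polynomial.monom (c a) a"])
    show "(\<lambda>r. \<lambda>a\<in>{..<d}. Polynomial.coeff r a) \<in> small_polys d \<rightarrow> ({..<d} \<rightarrow>\<^sub>E F)"
      by (auto simp: small_polys_def PiE_iff extensional_def F_0 intro: P_coeff split: if_splits)
    show "(\<lambda>c. \<Sum>a<d. Polynomial.monom (c a) a) \<in> ({..<d} \<rightarrow>\<^sub>E F) \<rightarrow> small_polys d"
      by (rule Pi_I, rule sum_monom_small) auto
    show "(\<Sum>a<d. Polynomial.monom ((\<lambda>a\<in>{..<d}. Polynomial.coeff r a) a) a) = r" if "r \<in> small_polys d" for r
      using small_polys_sum[OF that] by simp
    show "(\<lambda>a\<in>{..<d}. Polynomial.coeff (\<Sum>a<d. Polynomial.monom (c a) a) a) = c" if "c \<in> {..<d} \<rightarrow>\<^sub>E F" for c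
      using that by (auto simp: coeff_sum_monom fun_eq_iff PiE_iff extensional_def)
  qed
  hence "card (small_polys d) = card ({..<d} \<rightarrow>\<^sub>E F)" by (rule bij_betw_same_card)
  thus ?thesis by (simp add: card_PiE)
qed

lemma small_dvd_imp_0: "r \<in> small_polys (Polynomial.degree p) \<Longrightarrow> p dvd r \<Longrightarrow> r = 0"
  by (auto simp: small_polys_def dest: dvd_imp_degree_le)

lemma mod_small: "p \<in> P \<Longrightarrow> p \<noteq> 0 \<Longrightarrow> r \<in> P \<Longrightarrow> r mod p \<in> small_polys (Polynomial.degree p)"
  using P_div_mod(2)[of p r] degree_mod_less[of p r] by (simp add: small_polys_def)

lemma finite_small_polys: "finite (small_polys d)"
proof (rule card_ge_0_finite)
  have "q ^ d > 0" using q_ge_2 by (intro zero_less_power) linarith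
  thus "card (small_polys d) > 0" by (simp only: card_small_polys)
qed

end

section \<open>The action of polynomials in an endomorphism\<close>

context poly_action
begin

text \<open>The vector \<open>p(T) x\<close>. For \<open>T = shift\<close> its vanishing is the
  linear recurrence with characteristic polynomial \<open>p\<close>.\<close>

definition pact :: "'a poly \<Rightarrow> ('v \<Rightarrow> 'v) \<Rightarrow> 'v \<Rightarrow> 'v" where
  "pact p T x = (\<Sum>k\<le>Polynomial.degree p. scale (Polynomial.coeff p k) ((T ^^ k) x))"

lemma pact_altdef:
  fixes p :: "'a poly"
  assumes "Polynomial.degree p \<le> n"
  shows "pact p T x = (\<Sum>k\<le>n. scale (Polynomial.coeff p k) ((T ^^ k) x))"
  unfolding pact_def using assms
  by (intro sum.mono_neutral_left) (auto simp: coeff_eq_0)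

lemma pact_0 [simp]: "pact 0 T x = 0"
  by (simp add: pact_def)

lemma pact_1 [simp]: "pact 1 T x = x"
  by (simp add: pact_def)

lemma pact_add: "pact (p + r) T x = pact p T x + pact r T x"
proof -
  let ?n = "max (Polynomial.degree p) (Polynomial.degree r)"
  have "Polynomial.degree (p + r) \<le> ?n" by (rule degree_add_le_max)
  thus ?thesis
    by (simp add: pact_altdef[of _ ?n] scale_left_distrib sum.distrib)
qed

lemma pact_smult: "pact (Polynomial.smult c p) T x = scale c (pact p T x)"
  for c :: 'a
  using pact_altdef[of "Polynomial.smult c p" "Polynomial.degree p"]
  by (simp add: degree_smult_le pact_def scale_sum_right)

lemma pact_diff: "pact (p - r) T x = pact p T x - pact r T x"
proof -
  have "pact ((p - r) + r) T x = pact (p - r) T x + pact r T x" by (rule pact_add)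
  thus ?thesis by (simp add: algebra_simps)
qed

lemma pact_sum: "pact (sum g J) T x = (\<Sum>j\<in>J. pact (g j) T x)"
  by (induction J rule: infinite_finite_induct) (auto simp: pact_add)

lemma pact_monom: "pact (Polynomial.monom c n) T x = scale c ((T ^^ n) x)"
  for c :: 'a
proof -
  have "pact (Polynomial.monom c n) T x = (\<Sum>k\<le>n. scale (Polynomial.coeff (Polynomial.monom c n) k) ((T ^^ k) x))"
    by (rule pact_altdef) (rule degree_monom_le)
  also have "\<dots> = (\<Sum>k\<le>n. if k = n then scale c ((T ^^ k) x) else 0)"
    by (intro sum.cong) auto
  finally show ?thesis by simp
qed

context
  fixes T assumes T: "module_hom scale scale T"
begin

lemma hom_funpow: "module_hom scale scale (T ^^ n)"
proof (induction n)
  case 0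
  show ?case by (simp add: module_hom_iff module_axioms id_def)
next
  case (Suc n)
  show ?case using module_hom_compose[OF Suc T] by (simp add: o_def)
qed

lemma pact_pCons: "pact (pCons a p) T x = scale a x + T (pact p T x)"
  for a :: 'a
proof -
  have "pact (pCons a p) T x = (\<Sum>k\<le>Suc (Polynomial.degree p). scale (Polynomial.coeff (pCons a p) k) ((T ^^ k) x))"
    by (rule pact_altdef) (rule degree_pCons_le)
  also have "\<dots> = scale a x + (\<Sum>k\<le>Polynomial.degree p. scale (Polynomial.coeff p k) ((T ^^ Suc k) x))"
    by (subst sum.atMost_Suc_shift) simp
  also have "(\<Sum>k\<le>Polynomial.degree p. scale (Polynomial.coeff p k) ((T ^^ Suc k) x)) = T (pact p T x)"
    by (simp add: pact_def module_hom.sum[OF T] module_hom.scale[OF T])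
  finally show ?thesis .
qed

lemma hom_pact: "module_hom scale scale (pact p T)"
proof (induction p)
  case 0
  show ?case by (simp add: module_hom_iff module_axioms)
next
  case (pCons a p)
  show ?case
    by (simp add: module_hom_iff module_axioms pact_pCons module_hom.add[OF T] module_hom.scale[OF T]
        module_hom.add[OF pCons(2)] module_hom.scale[OF pCons(2)] scale_right_distrib scale_left_commute algebra_simps)
qed

lemma pact_mult: "pact (p * r) T x = pact p T (pact r T x)"
  by (induction p) (simp_all add: pact_pCons pact_add pact_smult)

lemma pact_commute: "pact p T (pact r T x) = pact r T (pact p T x)"
  by (metis mult.commute pact_mult)

lemma pact_funpow: "pact p T ((T ^^ n) x) = (T ^^ n) (pact p T x)"
  using pact_commute[of p "Polynomial.monom 1 n" x] by (simp add: pact_monom)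

end

end

context subfield_space
begin

lemma pact_in_V:
  assumes "\<And>x. x \<in> V \<Longrightarrow> T x \<in> V" "p \<in> P" "x \<in> V"
  shows "pact p T x \<in> V"
proof -
  have "(T ^^ k) x \<in> V" for k using assms by (induction k) auto
  thus ?thesis unfolding pact_def using assms(2) by (auto intro!: V_sum V_scale P_coeff)
qed

end

section \<open>Linear recurrent sequences\<close>

definition fscale :: "'a::field \<Rightarrow> ('i \<Rightarrow> 'a) \<Rightarrow> 'i \<Rightarrow> 'a" where
  "fscale c s = (\<lambda>i. c * s i)"

lemma fscale_apply [simp]: "fscale c s i = c * s i"
  by (simp add: fscale_def)

interpretation fs: poly_action fscale
  by unfold_locales (auto simp: fscale_def fun_eq_iff algebra_simps)

lemma sum_fun_apply: "sum g J i = (\<Sum>j\<in>J. g j i)"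
  by (induction J rule: infinite_finite_induct) auto

text \<open>Sequences are two-sided because they will record the products of \<open>T^k x\<close>
  with \<open>y\<close> for an isometry \<open>T\<close>, where negative \<open>k\<close> makes
  sense too.\<close>

definition shift :: "(int \<Rightarrow> 'a) \<Rightarrow> int \<Rightarrow> 'a" where
  "shift s = (\<lambda>m. s (m + 1))"

lemma shift_funpow: "(shift ^^ n) s m = s (m + int n)"
  by (induction n arbitrary: m) (auto simp: shift_def algebra_simps)

lemma module_hom_shift: "module_hom fscale fscale (shift :: (int \<Rightarrow> 'a::field) \<Rightarrow> _)"
  by (simp add: module_hom_iff fs.module_axioms shift_def fun_eq_iff)

lemma pact_shift: "fs.pact p shift s m = (\<Sum>k\<le>Polynomial.degree p. Polynomial.coeff p k * s (m + int k))"
  by (simp add: fs.pact_def sum_fun_apply shift_funpow)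

text \<open>Reversing time reverses the coefficients, up to a translation by the degree; a nonzero
  constant term keeps the degree of the reflected polynomial.\<close>

lemma pact_shift_uminus:
  assumes "poly r 0 \<noteq> 0"
  shows "fs.pact r shift (s \<circ> uminus) = 0 \<longleftrightarrow> fs.pact (reflect_poly r) shift s = 0"
proof -
  let ?d = "Polynomial.degree r"
  have deg: "Polynomial.degree (reflect_poly r) = ?d"
    using assms by (simp add: poly_0_coeff_0)
  have "fs.pact r shift (s \<circ> uminus) m = fs.pact (reflect_poly r) shift s (- m - int ?d)" for m
  proof -
    have "fs.pact (reflect_poly r) shift s (- m - int ?d) = (\<Sum>k\<le>?d. Polynomial.coeff r (?d - k) * s (- m - int ?d + int k))"
      unfolding pact_shift deg by (intro sum.cong) (auto simp: coeff_reflect_poly)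
    also have "\<dots> = (\<Sum>k\<le>?d. Polynomial.coeff r k * s (- m - int k))"
      by (rule sum.reindex_bij_witness[of _ "\<lambda>k. ?d - k" "\<lambda>k. ?d - k"]) (auto simp: of_nat_diff algebra_simps)
    finally show ?thesis by (simp add: pact_shift algebra_simps)
  qed
  note eq = this
  show ?thesis
  proof
    assume L: "fs.pact r shift (s \<circ> uminus) = 0"
    have "fs.pact (reflect_poly r) shift s m = 0" for m
      using eq[of "- m - int ?d"] by (simp add: L)
    thus "fs.pact (reflect_poly r) shift s = 0" by (simp add: fun_eq_iff)
  next
    assume R: "fs.pact (reflect_poly r) shift s = 0"
    have "fs.pact r shift (s \<circ> uminus) m = 0" for m
      using eq[of m] by (simp add: R)
    thus "fs.pact r shift (s \<circ> uminus) = 0" by (simp add: fun_eq_iff)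
  qed
qed

text \<open>The leading coefficient propagates a window of zeros to the right, the constant
  coefficient to the left.\<close>

lemma recurrence_unique:
  fixes p :: "'a::field poly"
  assumes p0: "poly p 0 \<noteq> 0" and deg: "Polynomial.degree p > 0"
    and s: "fs.pact p shift s = 0"
    and w: "\<And>k. k < Polynomial.degree p \<Longrightarrow> s (m0 + int k) = 0"
  shows "s = 0"
proof -
  let ?d = "Polynomial.degree p"
  have rec: "(\<Sum>k\<le>?d. Polynomial.coeff p k * s (m + int k)) = 0" for m
    using fun_cong[OF s, of m] by (simp add: pact_shift)
  have lc: "lead_coeff p \<noteq> 0" using deg by auto
  have c0: "Polynomial.coeff p 0 \<noteq> 0" using p0 by (simp add: poly_0_coeff_0)
  define W where "W m \<longleftrightarrow> (\<forall>k<?d. s (m + int k) = 0)" for m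
  have up: "W (m + 1)" if "W m" for m
  proof -
    have "(\<Sum>k\<le>?d. Polynomial.coeff p k * s (m + int k)) = (\<Sum>k\<in>{?d}. Polynomial.coeff p k * s (m + int k))"
      using that by (intro sum.mono_neutral_right) (auto simp: W_def)
    hence top: "s (m + int ?d) = 0" using rec[of m] lc by simp
    show ?thesis unfolding W_def
    proof (intro allI impI)
      fix k assume "k < ?d"
      hence "s (m + int (Suc k)) = 0"
        using that[unfolded W_def, rule_format, of "Suc k"] top by (cases "Suc k = ?d") auto
      thus "s (m + 1 + int k) = 0" by (simp add: algebra_simps)
    qed
  qed
  have down: "W (m - 1)" if "W m" for m
  proof -
    have z: "s (m - 1 + int k) = 0" if k: "k \<le> ?d" "k \<noteq> 0" for k
      using \<open>W m\<close>[unfolded W_def, rule_format, of "k - 1"] k by (simp add: of_nat_diff algebra_simps)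
    hence "(\<Sum>k\<le>?d. Polynomial.coeff p k * s (m - 1 + int k)) = (\<Sum>k\<in>{0}. Polynomial.coeff p k * s (m - 1 + int k))"
      by (intro sum.mono_neutral_right) auto
    hence "s (m - 1) = 0" using rec[of "m - 1"] c0 by simp
    show ?thesis unfolding W_def
    proof (intro allI impI)
      fix k assume "k < ?d"
      thus "s (m - 1 + int k) = 0" using z[of k] \<open>s (m - 1) = 0\<close> by (cases "k = 0") auto
    qed
  qed
  have "W m0" using w by (simp add: W_def)
  hence "W m" for m
    using up down by (induction m rule: int_induct[where k = m0]) auto
  hence "s m = 0" for m using deg unfolding W_def by (metis add.right_neutral of_nat_0)
  thus ?thesis by (simp add: fun_eq_iff)
qed

context finite_subfield
begin

definition recs :: "'a poly \<Rightarrow> (int \<Rightarrow> 'a) set" where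
  "recs p = {s. (\<forall>m. s m \<in> F) \<and> fs.pact p shift s = 0}"

lemma recs_diff: "s \<in> recs p \<Longrightarrow> s' \<in> recs p \<Longrightarrow> s - s' \<in> recs p"
  using module_hom.diff[OF fs.hom_pact[OF module_hom_shift], of p s s']
  by (auto simp: recs_def intro: F_diff)

lemma recs_eqI:
  assumes "poly p 0 \<noteq> 0" "Polynomial.degree p > 0" "s \<in> recs p" "s' \<in> recs p"
    and "\<And>k. k < Polynomial.degree p \<Longrightarrow> s (m0 + int k) = s' (m0 + int k)"
  shows "s = s'"
proof -
  have "s - s' \<in> recs p" using recs_diff assms by blast
  hence "s - s' = 0"
    using assms recurrence_unique[of p "s - s'" m0] by (auto simp: recs_def)
  thus ?thesis by simp
qed

text \<open>The companion map \<open>C\<close> advances a window of \<open>d\<close> consecutive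
  terms. It is injective because \<open>p\<close> has nonzero constant term, hence a permutation of
  the finite set of windows; iterating it and its inverse on \<open>w\<close> gives the whole
  two-sided sequence.\<close>

lemma recs_exists_0:
  assumes p: "p \<in> P" "lead_coeff p = 1" and p0: "poly p 0 \<noteq> 0" and deg: "Polynomial.degree p > 0"
    and w: "w \<in> {..<Polynomial.degree p} \<rightarrow>\<^sub>E F"
  shows "\<exists>s\<in>recs p. \<forall>k<Polynomial.degree p. s (int k) = w k"
proof -
  define d where "d = Polynomial.degree p"
  define W where "W = {..<d} \<rightarrow>\<^sub>E F"
  define C where "C u = (\<lambda>k\<in>{..<d}. if Suc k < d then u (Suc k) else - (\<Sum>j<d. Polynomial.coeff p j * u j))" for u :: "nat \<Rightarrow> 'a"
  have d: "d > 0" using deg d_def by simp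
  have CW: "C u \<in> W" if "u \<in> W" for u
  proof -
    have "u k \<in> F" if "k < d" for k using \<open>u \<in> W\<close> that by (auto simp: W_def)
    moreover from this have "- (\<Sum>j<d. Polynomial.coeff p j * u j) \<in> F"
      by (intro F_uminus F_sum F_mult P_coeff p) auto
    ultimately show ?thesis by (simp add: C_def W_def)
  qed
  have "inj_on C W"
  proof
    fix u v assume u: "u \<in> W" and v: "v \<in> W" and eq: "C u = C v"
    have S: "u (Suc k) = v (Suc k)" if "Suc k < d" for k
      using fun_cong[OF eq, of k] that by (simp add: C_def)
    obtain d' where d': "d = Suc d'" using d by (cases d) auto
    have "- (\<Sum>j<d. Polynomial.coeff p j * u j) = - (\<Sum>j<d. Polynomial.coeff p j * v j)"
      using fun_cong[OF eq, of d'] by (simp add: C_def d' del: sum.lessThan_Suc)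
    hence "(\<Sum>j<d. Polynomial.coeff p j * u j) = (\<Sum>j<d. Polynomial.coeff p j * v j)"
      by (simp only: neg_equal_iff_equal)
    moreover have "(\<Sum>j<d'. Polynomial.coeff p (Suc j) * u (Suc j)) = (\<Sum>j<d'. Polynomial.coeff p (Suc j) * v (Suc j))"
      using S d' by (intro sum.cong) auto
    ultimately have "Polynomial.coeff p 0 * u 0 = Polynomial.coeff p 0 * v 0"
      unfolding d' sum.lessThan_Suc_shift by simp
    hence u0: "u 0 = v 0" using p0 by (simp add: poly_0_coeff_0)
    have "u k = v k" if "k < d" for k using S u0 that by (cases k) auto
    thus "u = v" using u v unfolding W_def by (intro PiE_ext[of u "{..<d}" "\<lambda>_. F" v]) auto
  qed
  moreover have finW: "finite W" unfolding W_def by (intro finite_PiE finite_F) auto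
  ultimately have bij: "bij_betw C W W"
    using CW by (metis bij_betw_def endo_inj_surj image_subsetI)
  define D where "D = inv_into W C"
  have D: "D u \<in> W" "C (D u) = u" if "u \<in> W" for u
    using that bij unfolding D_def by (auto simp: bij_betw_def inv_into_into f_inv_into_f)
  \<comment> \<open>\<open>S m\<close> is the window that starts at time \<open>m\<close>: powers of
    \<open>C\<close> serve \<open>m \<ge> 0\<close>, powers of its inverse \<open>D\<close> serve
    \<open>m < 0\<close>.\<close>
  define S where "S m = (if m \<ge> 0 then (C ^^ nat m) w else (D ^^ nat (- m)) w)" for m :: int
  have wW: "w \<in> W" using w by (simp add: W_def d_def)
  have CnW: "(C ^^ n) w \<in> W" for n by (induction n) (auto simp: wW CW)
  have DnW: "(D ^^ n) w \<in> W" for n by (induction n) (auto simp: wW D)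
  have SW: "S m \<in> W" for m by (simp add: S_def CnW DnW)
  have Sstep: "S (m + 1) = C (S m)" for m
  proof (cases "m \<ge> 0")
    case True
    thus ?thesis by (simp add: S_def nat_add_distrib)
  next
    case False
    define n where "n = nat (- m - 1)"
    have n: "nat (- m) = Suc n" using False by (simp add: n_def)
    have "C (S m) = (D ^^ n) w" using False n D DnW by (simp add: S_def)
    also have "\<dots> = S (m + 1)"
    proof (cases "m = - 1")
      case True
      thus ?thesis by (simp add: S_def n_def)
    next
      case m: False
      hence "nat (- (m + 1)) = n" by (simp add: n_def)
      thus ?thesis using m False by (simp add: S_def)
    qed
    finally show ?thesis by simp
  qed
  define s where "s m = S m 0" for m
  have sS: "s (m + int k) = S m k" if "k < d" for m k
    using that
  proof (induction k arbitrary: m)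
    case (Suc k)
    have "s (m + int (Suc k)) = s ((m + 1) + int k)" by (simp add: algebra_simps)
    also have "\<dots> = S (m + 1) k" using Suc by simp
    also have "\<dots> = S m (Suc k)" using Suc.prems unfolding Sstep by (simp add: C_def)
    finally show ?case .
  qed (simp add: s_def)
  have "fs.pact p shift s m = 0" for m
  proof -
    obtain d' where d': "d = Suc d'" using d by (cases d) auto
    have "s (m + int d) = s ((m + 1) + int d')" by (simp add: d' algebra_simps)
    also have "\<dots> = S (m + 1) d'" using d' by (intro sS) simp
    also have "\<dots> = - (\<Sum>j<d. Polynomial.coeff p j * S m j)"
      unfolding Sstep by (simp add: C_def d')
    also have "(\<Sum>j<d. Polynomial.coeff p j * S m j) = (\<Sum>j<d. Polynomial.coeff p j * s (m + int j))"
      by (intro sum.cong) (auto simp: sS)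
    finally have "(\<Sum>j<d. Polynomial.coeff p j * s (m + int j)) + s (m + int d) = 0" by simp
    moreover have "{..d} = insert d {..<d}" by auto
    ultimately show ?thesis
      using p(2) by (simp add: pact_shift d_def[symmetric] add.commute)
  qed
  moreover have "s m \<in> F" for m using SW[of m] d unfolding W_def s_def by auto
  moreover have "s (int k) = w k" if "k < d" for k
    using sS[of k 0] that by (simp add: S_def)
  ultimately show ?thesis unfolding recs_def d_def by (intro bexI[of _ s]) (auto simp: fun_eq_iff)
qed

lemma recs_translate:
  assumes "s \<in> recs p" shows "(\<lambda>m. s (m + c)) \<in> recs p"
proof -
  have "fs.pact p shift (\<lambda>m. s (m + c)) m = fs.pact p shift s (m + c)" for m
    by (simp add: pact_shift algebra_simps)
  thus ?thesis using assms by (auto simp: recs_def fun_eq_iff)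
qed

lemma recs_exists:
  assumes p: "p \<in> P" "lead_coeff p = 1" "poly p 0 \<noteq> 0" "Polynomial.degree p > 0"
    and w: "w \<in> {..<Polynomial.degree p} \<rightarrow> F"
  shows "\<exists>s\<in>recs p. \<forall>k<Polynomial.degree p. s (m0 + int k) = w k"
proof -
  have "restrict w {..<Polynomial.degree p} \<in> {..<Polynomial.degree p} \<rightarrow>\<^sub>E F" using w by auto
  from recs_exists_0[OF p this] obtain s where
    s: "s \<in> recs p" "\<forall>k<Polynomial.degree p. s (int k) = restrict w {..<Polynomial.degree p} k" by blast
  have "(\<lambda>m. s (m + - m0)) \<in> recs p" by (rule recs_translate[OF s(1)])
  thus ?thesis using s(2) by (intro bexI[of _ "\<lambda>m. s (m + - m0)"]) auto
qed

lemma card_recs: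
  assumes p: "p \<in> P" "lead_coeff p = 1" "poly p 0 \<noteq> 0" "Polynomial.degree p > 0"
  shows "card (recs p) = q ^ Polynomial.degree p"
proof -
  let ?d = "Polynomial.degree p"
  have "bij_betw (\<lambda>s. \<lambda>k\<in>{..<?d}. s (int k)) (recs p) ({..<?d} \<rightarrow>\<^sub>E F)"
  proof (rule bij_betw_imageI)
    show "inj_on (\<lambda>s. \<lambda>k\<in>{..<?d}. s (int k)) (recs p)"
    proof
      fix s s' assume s: "s \<in> recs p" "s' \<in> recs p" and eq: "(\<lambda>k\<in>{..<?d}. s (int k)) = (\<lambda>k\<in>{..<?d}. s' (int k))"
      have "s (0 + int k) = s' (0 + int k)" if "k < ?d" for k
        using fun_cong[OF eq, of k] that by simp
      thus "s = s'" using recs_eqI[OF p(3,4) s] by blast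
    qed
    show "(\<lambda>s. \<lambda>k\<in>{..<?d}. s (int k)) ` recs p = {..<?d} \<rightarrow>\<^sub>E F"
    proof (intro equalityI subsetI)
      fix w assume w: "w \<in> {..<?d} \<rightarrow>\<^sub>E F"
      then obtain s where s: "s \<in> recs p" "\<forall>k<?d. s (int k) = w k" using recs_exists_0[OF p] by blast
      have "w = (\<lambda>k\<in>{..<?d}. s (int k))" using s w by (auto simp: fun_eq_iff PiE_def extensional_def)
      thus "w \<in> (\<lambda>s. \<lambda>k\<in>{..<?d}. s (int k)) ` recs p" using s by blast
    qed (auto simp: recs_def PiE_iff extensional_def)
  qed
  thus ?thesis using bij_betw_same_card by (fastforce simp: card_PiE)
qed

end

section \<open>Symmetric recurrent sequences in characteristic two\<close>

locale finite_subfield_2 = finite_subfield F for F :: "'a::field set" +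
  assumes two_eq_0: "(1::'a) + 1 = 0"
begin

lemma add_self [simp]: "(x::'a) + x = 0"
  using two_eq_0 by (metis distrib_left mult.right_neutral mult_zero_right)

lemma uminus_eq [simp]: "- (x::'a) = x"
  using add_self[of x] by (simp only: neg_eq_iff_add_eq_0)

text \<open>Symmetry and \<open>s 0 = 0\<close> extend the values at \<open>1..j\<close> to the
  window from \<open>1 - j\<close> to \<open>j\<close>, which has the full length
  \<open>2 * j\<close>. Conversely, if that window is prescribed symmetrically, the recurrence at
  time \<open>- j\<close> yields the one missing equality \<open>s (- j) = s j\<close>, so the
  sequence and its reversal agree on a full window.\<close>

lemma card_symmetric_recs:
  assumes p: "p \<in> P" "lead_coeff p = 1" and pal: "reflect_poly p = p" and deg: "Polynomial.degree p = 2 * j" "j > 0"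
  shows "card {s \<in> recs p. s 0 = 0 \<and> s \<circ> uminus = s} = q ^ j"
proof -
  let ?S = "{s \<in> recs p. s 0 = 0 \<and> s \<circ> uminus = s}"
  have c0: "Polynomial.coeff p 0 = 1"
    using p(2) coeff_0_reflect_poly[of p] pal by simp
  hence p0: "poly p 0 \<noteq> 0" by (simp add: poly_0_coeff_0)
  have dpos: "Polynomial.degree p > 0" using deg by simp
  have palc: "Polynomial.coeff p (2 * j - k) = Polynomial.coeff p k" if "k \<le> 2 * j" for k
    using that deg arg_cong[OF pal, of "\<lambda>p. Polynomial.coeff p k"] by (simp add: coeff_reflect_poly)
  have "bij_betw (\<lambda>s. \<lambda>k\<in>{1..j}. s (int k)) ?S ({1..j} \<rightarrow>\<^sub>E F)"
  proof (rule bij_betw_imageI)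
    show "inj_on (\<lambda>s. \<lambda>k\<in>{1..j}. s (int k)) ?S"
    proof
      fix s s' assume s: "s \<in> ?S" "s' \<in> ?S" and eq: "(\<lambda>k\<in>{1..j}. s (int k)) = (\<lambda>k\<in>{1..j}. s' (int k))"
      have pos: "s (int k) = s' (int k)" if "k \<le> j" for k
        using fun_cong[OF eq, of k] that s by (cases "k = 0") auto
      have sym: "s (- m) = s m" "s' (- m) = s' m" for m
      proof -
        have "(s \<circ> uminus) m = s m" "(s' \<circ> uminus) m = s' m" using s by auto
        thus "s (- m) = s m" "s' (- m) = s' m" by auto
      qed
      show "s = s'"
      proof (rule recs_eqI[OF p0 dpos, of s s' "1 - int j"])
        fix k assume k: "k < Polynomial.degree p"
        define m where "m = 1 - int j + int k"
        have "nat \<bar>m\<bar> \<le> j" using k deg by (auto simp: m_def)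
        hence "s \<bar>m\<bar> = s' \<bar>m\<bar>" using pos[of "nat \<bar>m\<bar>"] by simp
        thus "s (1 - int j + int k) = s' (1 - int j + int k)"
          using sym[of m] unfolding m_def[symmetric] by (auto simp: abs_if split: if_splits)
      qed (use s in auto)
    qed
    show "(\<lambda>s. \<lambda>k\<in>{1..j}. s (int k)) ` ?S = {1..j} \<rightarrow>\<^sub>E F"
    proof (intro equalityI subsetI)
      fix w assume w: "w \<in> {1..j} \<rightarrow>\<^sub>E F"
      define W where "W m = (if m = 0 then 0 else w (nat \<bar>m\<bar>))" for m :: int
      have WF: "(\<lambda>k. W (1 - int j + int k)) \<in> {..<Polynomial.degree p} \<rightarrow> F"
      proof
        fix k assume "k \<in> {..<Polynomial.degree p}"
        hence "1 - int j + int k = 0 \<or> nat \<bar>1 - int j + int k\<bar> \<in> {1..j}"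
          using deg by auto
        thus "W (1 - int j + int k) \<in> F" using w by (auto simp: W_def F_0)
      qed
      obtain s where s: "s \<in> recs p" "\<forall>k<Polynomial.degree p. s ((1 - int j) + int k) = W (1 - int j + int k)"
        using recs_exists[OF p p0 dpos WF, of "1 - int j"] by blast
      have sW: "s m = W m" if "- int j < m" "m \<le> int j" for m
        using s(2)[rule_format, of "nat (m - 1 + int j)"] that deg by simp
      have Wsym: "W (- m) = W m" for m by (simp add: W_def)
      define f where "f k = Polynomial.coeff p k * s (- int j + int k)" for k
      have ps: "fs.pact p shift s = 0" using s(1) by (simp add: recs_def)
      have "(\<Sum>k\<le>2*j. f k) = 0"
        using fun_cong[OF ps, of "- int j"] deg by (simp add: pact_shift f_def)
      moreover have "{..2*j} = insert 0 (insert (2*j) (insert j ({1..<j} \<union> {j+1..<2*j})))"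
        using deg by auto
      hence "(\<Sum>k\<le>2*j. f k) = f 0 + (f (2*j) + (f j + (sum f {1..<j} + sum f {j+1..<2*j})))"
        using deg by (simp add: sum.union_disjoint)
      \<comment> \<open>Palindromic coefficients and symmetric values pair the terms at
        \<open>k\<close> and \<open>2*j - k\<close>, which cancel in characteristic two; the middle
        term contains \<open>s 0 = 0\<close>. Only the two extreme terms remain.\<close>
      moreover have "sum f {j+1..<2*j} = sum f {1..<j}"
      proof (rule sum.reindex_bij_witness[of _ "\<lambda>k. 2*j - k" "\<lambda>k. 2*j - k"])
        fix k assume k: "k \<in> {j+1..<2*j}"
        have "s (- int j + int (2*j - k)) = W (- (- int j + int k))"
          using k by (subst sW) (auto simp: of_nat_diff)
        also have "\<dots> = s (- int j + int k)" using k by (subst Wsym, subst sW) auto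
        finally show "f (2*j - k) = f k" using palc[of k] k by (simp add: f_def)
      qed auto
      moreover have "f j = 0" using sW[of 0] deg by (simp add: f_def W_def)
      ultimately have "f 0 + f (2*j) = 0" by simp
      hence "s (- int j) + s (int j) = 0"
        using c0 p(2) deg by (simp add: f_def)
      hence sj: "s (- int j) = s (int j)" using add_eq_0_iff[of "s (int j)" "s (- int j)"] by (simp add: add.commute)
      have sW': "s m = W m" if "- int j \<le> m" "m \<le> int j" for m
      proof (cases "m = - int j")
        case True
        thus ?thesis using sj sW[of "int j"] deg(2) Wsym[of "int j"] by simp
      qed (use sW that in auto)
      have "fs.pact p shift (s \<circ> uminus) = 0"
        using pact_shift_uminus[OF p0, of s] s(1) by (simp add: pal recs_def)
      hence s': "s \<circ> uminus \<in> recs p" using s(1) by (simp add: recs_def)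
      have "s \<circ> uminus = s"
      proof (rule recs_eqI[OF p0 dpos s' s(1), of "- int j"])
        fix k assume "k < Polynomial.degree p"
        thus "(s \<circ> uminus) (- int j + int k) = s (- int j + int k)"
          using deg sW'[of "- int j + int k"] sW'[of "- (- int j + int k)"] Wsym[of "- int j + int k"] by simp
      qed
      moreover have "s 0 = 0" using sW[of 0] deg by (simp add: W_def)
      moreover have "w = (\<lambda>k\<in>{1..j}. s (int k))"
        using w by (auto simp: fun_eq_iff PiE_def extensional_def sW W_def)
      ultimately show "w \<in> (\<lambda>s. \<lambda>k\<in>{1..j}. s (int k)) ` ?S" using s(1) by blast
    qed (auto simp: recs_def PiE_iff extensional_def)
  qed
  thus ?thesis using bij_betw_same_card by (fastforce simp: card_PiE)
qed

end

section \<open>Counting invariant alternating forms\<close>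

text \<open>The cardinality on the left numbers, from 0, the occurrences of the value at
  \<open>j\<close>. Grouping positions by value therefore makes this number run through an initial
  segment.\<close>

lemma prod_by_value:
  fixes m :: nat
  assumes "finite \<Phi>" "\<phi> ` {..<m} \<subseteq> \<Phi>"
  shows "(\<Prod>j<m. h (\<phi> j) (card {i. i < j \<and> \<phi> i = \<phi> j})) =
    (\<Prod>x\<in>\<Phi>. \<Prod>s<card {i. i < m \<and> \<phi> i = x}. h x s :: 'b::comm_monoid_mult)"
  using assms(2)
proof (induction m)
  case (Suc m)
  let ?c = "\<lambda>m x. card {i. i < m \<and> \<phi> i = x}"
  have mem: "\<phi> m \<in> \<Phi>" using Suc.prems by auto
  have c: "?c (Suc m) x = (if x = \<phi> m then Suc (?c m x) else ?c m x)" for x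
  proof -
    have "{i. i < Suc m \<and> \<phi> i = x} = (if x = \<phi> m then insert m {i. i < m \<and> \<phi> i = x} else {i. i < m \<and> \<phi> i = x})"
      by (auto simp: less_Suc_eq)
    thus ?thesis by simp
  qed
  have "(\<Prod>x\<in>\<Phi>. \<Prod>s<?c (Suc m) x. h x s) =
      (\<Prod>s<?c (Suc m) (\<phi> m). h (\<phi> m) s) * (\<Prod>x\<in>\<Phi> - {\<phi> m}. \<Prod>s<?c (Suc m) x. h x s)"
    by (rule prod.remove[OF assms(1) mem])
  also have "\<dots> = h (\<phi> m) (?c m (\<phi> m)) * ((\<Prod>s<?c m (\<phi> m). h (\<phi> m) s) * (\<Prod>x\<in>\<Phi> - {\<phi> m}. \<Prod>s<?c m x. h x s))"
  proof -
    have "(\<Prod>x\<in>\<Phi> - {\<phi> m}. \<Prod>s<?c (Suc m) x. h x s) = (\<Prod>x\<in>\<Phi> - {\<phi> m}. \<Prod>s<?c m x. h x s)"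
      by (intro prod.cong refl) (simp add: c)
    thus ?thesis unfolding c[of "\<phi> m"] by (simp add: mult_ac)
  qed
  also have "(\<Prod>s<?c m (\<phi> m). h (\<phi> m) s) * (\<Prod>x\<in>\<Phi> - {\<phi> m}. \<Prod>s<?c m x. h x s) = (\<Prod>x\<in>\<Phi>. \<Prod>s<?c m x. h x s)"
    by (rule prod.remove[OF assms(1) mem, symmetric])
  also have "(\<Prod>x\<in>\<Phi>. \<Prod>s<?c m x. h x s) = (\<Prod>j<m. h (\<phi> j) (card {i. i < j \<and> \<phi> i = \<phi> j}))"
  proof (rule Suc.IH[symmetric])
    show "\<phi> ` {..<m} \<subseteq> \<Phi>" using Suc.prems by auto
  qed
  finally show ?case by (simp add: mult_ac)
qed simp

context finite_subfield
begin

text \<open>Excluding \<open>z\<close> makes the constant term nonzero, so conjugates behave well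
  and recurrences can be run backwards.\<close>

definition mirr :: "'a poly \<Rightarrow> bool" where
  "mirr p \<longleftrightarrow> irreducible_over F p \<and> lead_coeff p = 1 \<and> p \<noteq> [:0, 1:]"

lemma monic_irreducible_root:
  assumes p: "irreducible_over F p" "lead_coeff p = 1" and c: "c \<in> F" "poly p c = 0"
  shows "p = [:- c, 1:]"
proof -
  note pD = irreducible_over_D[OF p(1)]
  have x: "[:- c, 1:] \<in> P" using c by (intro P_pCons F_uminus F_1 P_0)
  obtain h where h: "p = [:- c, 1:] * h" using c(2) by (auto simp: poly_eq_0_iff_dvd)
  have "h = p div [:- c, 1:]" unfolding h by (rule nonzero_mult_div_cancel_left[symmetric]) simp
  hence "h \<in> P" using P_div_mod(1)[OF x _ pD(1)] by simp
  have "\<forall>g\<in>P. \<forall>h\<in>P. p = g * h \<longrightarrow> Polynomial.degree g = 0 \<or> Polynomial.degree h = 0"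
    using p(1) by (simp add: irreducible_over_def)
  from this[rule_format, OF x \<open>h \<in> P\<close> h] have "Polynomial.degree h = 0" by simp
  then obtain a where a: "h = [:a:]" by (rule degree_eq_zeroE)
  have "lead_coeff p = a" using h a pD(3) by (cases "a = 0") simp_all
  thus ?thesis using h a p(2) by simp
qed

lemma mirr_D:
  assumes "mirr p"
  shows "irreducible_over F p" "p \<in> P" "lead_coeff p = 1" "Polynomial.degree p > 0" "p \<noteq> 0" "poly p 0 \<noteq> 0"
proof -
  show 1: "irreducible_over F p" "lead_coeff p = 1" using assms by (auto simp: mirr_def)
  show "p \<in> P" "Polynomial.degree p > 0" "p \<noteq> 0" using irreducible_over_D[OF 1(1)] by auto
  show "poly p 0 \<noteq> 0"
    using monic_irreducible_root[OF 1 F_0] assms by (auto simp: mirr_def)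
qed

lemma mirr_dvd_eq:
  assumes "mirr p" "mirr r" "p dvd r"
  shows "p = r"
proof -
  obtain h where h: "r = p * h" using assms(3) by blast
  have "h = r div p" using mirr_D[OF assms(1)] by (simp add: h)
  hence "h \<in> P" using P_div_mod(1) mirr_D assms by simp
  have "\<forall>g\<in>P. \<forall>h\<in>P. r = g * h \<longrightarrow> Polynomial.degree g = 0 \<or> Polynomial.degree h = 0"
    using assms(2) by (simp add: mirr_def irreducible_over_def)
  from this[rule_format, OF _ \<open>h \<in> P\<close> h] have "Polynomial.degree h = 0" using mirr_D(2,4)[OF assms(1)] by simp
  then obtain a where a: "h = [:a:]" by (rule degree_eq_zeroE)
  have "lead_coeff r = lead_coeff p * lead_coeff h" unfolding h by (rule lead_coeff_mult)
  hence "a = 1" using mirr_D(3)[OF assms(1)] mirr_D(3)[OF assms(2)] by (simp add: a)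
  thus ?thesis using a h by simp
qed

lemma conjugate_props:
  assumes "mirr p"
  shows "lead_coeff (conjugate_poly p) = 1" "Polynomial.degree (conjugate_poly p) = Polynomial.degree p"
    "poly (conjugate_poly p) 0 = inverse (poly p 0)" "conjugate_poly p \<in> P" "conjugate_poly (conjugate_poly p) = p"
proof -
  note D = mirr_D[OF assms]
  have i0: "inverse (poly p 0) \<noteq> 0" using D by simp
  have r0: "Polynomial.degree (reflect_poly p) = Polynomial.degree p"
    using D(6) by (simp add: poly_0_coeff_0)
  have lr: "lead_coeff (reflect_poly p) = poly p 0"
    using D(6) r0 by (simp add: poly_0_coeff_0 coeff_reflect_poly)
  show "lead_coeff (conjugate_poly p) = 1"
    using i0 lr D(6) unfolding conjugate_poly_def by (simp add: lead_coeff_smult)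
  show "Polynomial.degree (conjugate_poly p) = Polynomial.degree p"
    using i0 r0 unfolding conjugate_poly_def by simp
  show c: "poly (conjugate_poly p) 0 = inverse (poly p 0)"
    using D(3) by (simp add: conjugate_poly_def)
  show "conjugate_poly p \<in> P"
    unfolding conjugate_poly_def by (intro P_smult F_inverse P_poly P_reflect D F_0)
  show "conjugate_poly (conjugate_poly p) = p"
    unfolding conjugate_poly_def[of "conjugate_poly p"] c
    unfolding conjugate_poly_def using D(6) by (simp add: reflect_poly_smult poly_0_coeff_0)
qed

text \<open>Reflection turns a factorisation of the conjugate into one of \<open>p\<close>; both
  factors have nonzero constant term, so their degrees survive.\<close>

lemma mirr_conjugate:
  assumes "mirr p"
  shows "mirr (conjugate_poly p)"
proof -
  note D = mirr_D[OF assms] and C = conjugate_props[OF assms]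
  have "irreducible_over F (conjugate_poly p)"
    unfolding irreducible_over_def
  proof (intro conjI ballI impI)
    fix g h assume gh: "g \<in> P" "h \<in> P" "conjugate_poly p = g * h"
    have nz: "poly g 0 \<noteq> 0" "poly h 0 \<noteq> 0"
      using C(3) D(6) arg_cong[OF gh(3), of "\<lambda>p. poly p 0"] by auto
    let ?c = "inverse (poly (conjugate_poly p) 0)"
    have "p = Polynomial.smult ?c (reflect_poly (conjugate_poly p))"
      using C(5) unfolding conjugate_poly_def[of "conjugate_poly p"] by simp
    also have "\<dots> = Polynomial.smult ?c (reflect_poly g) * reflect_poly h"
      by (simp add: gh(3) reflect_poly_mult)
    finally have eq: "p = Polynomial.smult ?c (reflect_poly g) * reflect_poly h" .
    have all: "\<forall>g\<in>P. \<forall>h\<in>P. p = g * h \<longrightarrow> Polynomial.degree g = 0 \<or> Polynomial.degree h = 0"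
      using D(1) by (simp add: irreducible_over_def)
    have g': "Polynomial.smult ?c (reflect_poly g) \<in> P"
      by (intro P_smult F_inverse P_poly P_reflect C(4) F_0 gh(1))
    have "Polynomial.degree (Polynomial.smult ?c (reflect_poly g)) = 0 \<or> Polynomial.degree (reflect_poly h) = 0"
      by (rule mp[OF bspec[OF bspec[OF all g'] P_reflect[OF gh(2)]] eq])
    moreover have "?c \<noteq> 0" using C(3) D(6) by simp
    ultimately show "Polynomial.degree g = 0 \<or> Polynomial.degree h = 0"
      using nz by (simp add: poly_0_coeff_0)
  qed (use C D in auto)
  moreover have "conjugate_poly p \<noteq> [:0, 1:]" using C(3) D(6) by auto
  ultimately show ?thesis using C(1) by (simp add: mirr_def)
qed

lemma mirr_dvd_reflect:
  assumes "mirr p" "mirr r" "p dvd reflect_poly r"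
  shows "p = conjugate_poly r"
proof -
  have "p dvd conjugate_poly r" using assms(3) unfolding conjugate_poly_def by (rule dvd_smult)
  thus ?thesis using mirr_dvd_eq mirr_conjugate assms by blast
qed

lemma pact_conjugate_eq_0_iff:
  assumes "mirr r"
  shows "fs.pact (conjugate_poly r) shift s = 0 \<longleftrightarrow> fs.pact (reflect_poly r) shift s = 0"
  using mirr_D(6)[OF assms] unfolding conjugate_poly_def fs.pact_smult by (auto simp: fun_eq_iff)

text \<open>The candidates for \<open>k \<mapsto> \<omega>(T\<^sup>k x, y)\<close>, where \<open>T\<close> is an isometry, \<open>p(T) x = 0\<close> and \<open>r(T) y = 0\<close>;
  the flag \<open>c\<close> marks the case \<open>x = y\<close>.\<close>

definition seqs :: "'a poly \<Rightarrow> 'a poly \<Rightarrow> bool \<Rightarrow> (int \<Rightarrow> 'a) set" where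
  "seqs p r c = {s \<in> recs p. fs.pact r shift (s \<circ> uminus) = 0 \<and> (c \<longrightarrow> s 0 = 0 \<and> s \<circ> uminus = s)}"

lemma zero_in_seqs: "0 \<in> seqs p r c"
proof -
  have "fs.pact p shift 0 = (0 :: int \<Rightarrow> 'a)" for p :: "'a poly"
    by (auto simp: fun_eq_iff pact_shift)
  moreover have "0 \<circ> uminus = (0 :: int \<Rightarrow> 'a)" by (auto simp: fun_eq_iff)
  ultimately show ?thesis by (simp add: seqs_def recs_def F_0)
qed

text \<open>Such a sequence is annihilated by \<open>p\<close> and by the reflection of
  \<open>r\<close>. Unless \<open>p\<close> is the conjugate of \<open>r\<close>, these are coprime
  and a Bezout identity annihilates the sequence.\<close>

lemma seqs_not_conjugate:
  assumes p: "mirr p" and r: "mirr r" and n: "p \<noteq> conjugate_poly r"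
  shows "seqs p r c = {0}"
proof -
  have "s = 0" if "s \<in> seqs p r c" for s
  proof -
    have s: "fs.pact p shift s = 0" "fs.pact (reflect_poly r) shift s = 0"
      using that pact_shift_uminus[OF mirr_D(6)[OF r]] by (auto simp: seqs_def recs_def)
    have "\<not> p dvd reflect_poly r" using mirr_dvd_reflect p r n by blast
    then obtain a b where ab: "a * p + b * reflect_poly r = 1"
      using irreducible_over_bezout[OF mirr_D(1)[OF p] P_reflect[OF mirr_D(2)[OF r]]] by blast
    have "s = fs.pact (a * p + b * reflect_poly r) shift s" by (simp add: ab)
    also have "\<dots> = fs.pact a shift (fs.pact p shift s) + fs.pact b shift (fs.pact (reflect_poly r) shift s)"
      by (simp add: fs.pact_add fs.pact_mult[OF module_hom_shift])
    also have "\<dots> = 0"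
      unfolding s by (simp add: module_hom.zero[OF fs.hom_pact[OF module_hom_shift]])
    finally show ?thesis .
  qed
  thus ?thesis using zero_in_seqs by blast
qed

text \<open>If \<open>p\<close> is the conjugate of \<open>r\<close>, the second recurrence follows
  from the first by \<open>pact_shift_uminus\<close>, so all of \<open>recs p\<close>
  remains.\<close>

lemma card_seqs_off_diagonal:
  assumes p: "mirr p" and r: "mirr r"
  shows "card (seqs p r False) = (if p = conjugate_poly r then q ^ Polynomial.degree p else 1)"
proof (cases "p = conjugate_poly r")
  case True
  have "fs.pact r shift (s \<circ> uminus) = 0" if "s \<in> recs p" for s
    using that True pact_conjugate_eq_0_iff[OF r] pact_shift_uminus[OF mirr_D(6)[OF r]] by (auto simp: recs_def)
  hence "seqs p r False = recs p" by (auto simp: seqs_def)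
  thus ?thesis using card_recs mirr_D[OF p] True by simp
next
  case False
  thus ?thesis using seqs_not_conjugate[OF p r] by simp
qed

end

context finite_subfield_2
begin

lemma self_conjugate_reflect:
  assumes "mirr p" "p = conjugate_poly p"
  shows "poly p 0 = 1" "reflect_poly p = p"
proof -
  have "poly p 0 = inverse (poly p 0)" using conjugate_props(3)[OF assms(1)] assms(2) by simp
  hence "poly p 0 * poly p 0 = 1" using mirr_D(6)[OF assms(1)] by (metis right_inverse)
  hence "(poly p 0 + 1) * (poly p 0 + 1) = 0" by (simp add: algebra_simps)
  hence "poly p 0 + 1 = 0" by simp
  thus "poly p 0 = 1" using add_eq_0_iff[of 1 "poly p 0"] by (simp add: add.commute)
  thus "reflect_poly p = p" using assms(2) by (simp add: conjugate_poly_def)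
qed

text \<open>In odd degree the coefficients of a palindrome pair off completely, so 1 is a root in
  characteristic two, and a monic irreducible polynomial with a root in \<open>F\<close> is
  linear.\<close>

lemma self_conjugate_even_degree:
  assumes "mirr p" "p = conjugate_poly p" "p \<noteq> [:1, 1:]"
  shows "even (Polynomial.degree p)"
proof (rule ccontr)
  assume "odd (Polynomial.degree p)"
  then obtain j where j: "Polynomial.degree p = 2 * j + 1" by (elim oddE)
  let ?c = "Polynomial.coeff p"
  have pal: "?c (2 * j + 1 - k) = ?c k" if "k \<le> 2 * j + 1" for k
    using that j arg_cong[OF self_conjugate_reflect(2)[OF assms(1,2)], of "\<lambda>p. Polynomial.coeff p k"]
    by (simp add: coeff_reflect_poly split: if_splits)
  have "poly p 1 = (\<Sum>k\<le>2*j+1. ?c k)" by (simp add: poly_altdef j)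
  also have "{..2*j+1} = {..j} \<union> {j+1..2*j+1}" by auto
  also have "sum ?c ({..j} \<union> {j+1..2*j+1}) = sum ?c {..j} + sum ?c {j+1..2*j+1}"
    by (rule sum.union_disjoint) auto
  also have "sum ?c {j+1..2*j+1} = sum ?c {..j}"
    by (rule sum.reindex_bij_witness[of _ "\<lambda>k. 2*j+1 - k" "\<lambda>k. 2*j+1 - k"]) (use pal in auto)
  finally have "poly p 1 = 0" by simp
  from monic_irreducible_root[OF mirr_D(1,3)[OF assms(1)] F_1 this] assms(3) show False by simp
qed

lemma card_seqs_diagonal:
  assumes p: "mirr p"
  shows "card (seqs p p True) =
    (if p = conjugate_poly p \<and> p \<noteq> [:1, 1:] then q ^ (Polynomial.degree p div 2) else 1)"
proof (cases "p = conjugate_poly p")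
  case sc: True
  note D = mirr_D[OF p] and R = self_conjugate_reflect[OF p sc]
  have eq: "seqs p p True = {s \<in> recs p. s 0 = 0 \<and> s \<circ> uminus = s}"
    using R pact_shift_uminus[OF D(6)] by (auto simp: seqs_def recs_def)
  show ?thesis
  proof (cases "p = [:1, 1:]")
    case True
    \<comment> \<open>Recurrences for \<open>z + 1\<close> have order one, so the single value
      \<open>s 0 = 0\<close> kills the sequence.\<close>
    have "s = 0" if "s \<in> seqs p p True" for s
      using recurrence_unique[OF D(6,4), of s 0] that True by (auto simp: seqs_def recs_def)
    hence "seqs p p True = {0}" using zero_in_seqs by blast
    thus ?thesis using True by simp
  next
    case False
    obtain j where j: "Polynomial.degree p = 2 * j"
      using self_conjugate_even_degree[OF p sc False] by blast
    hence "j > 0" using D(4) by simp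
    show ?thesis using card_symmetric_recs[OF D(2,3) R(2) j \<open>j > 0\<close>] sc False eq j by simp
  qed
next
  case False
  thus ?thesis using seqs_not_conjugate[OF p p] by simp
qed

text \<open>The number of ways to extend an invariant alternating form from \<open>s\<close> to \<open>s + 1\<close> copies of \<open>F[z]/(p)\<close>.\<close>

definition form_weight :: "'a poly \<Rightarrow> nat \<Rightarrow> nat" where
  "form_weight p s = (if p = conjugate_poly p then
     (if p = [:1, 1:] then 1 else q ^ (Polynomial.degree p div 2)) * q ^ (Polynomial.degree p * s) else 1)"

text \<open>An element encodes one invariant alternating form on the direct sum of the modules
  \<open>F[z]/(\<phi> i)\<close>: entry \<open>(i, j)\<close> records the products of
  \<open>z^k v_i\<close> with \<open>v_j\<close>, where \<open>v_i\<close> is the generator of the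
  summand \<open>i\<close>.\<close>

definition gram_seqs :: "nat \<Rightarrow> (nat \<Rightarrow> 'a poly) \<Rightarrow> (nat \<times> nat \<Rightarrow> int \<Rightarrow> 'a) set" where
  "gram_seqs m \<phi> = Pi\<^sub>E {(i, j). i \<le> j \<and> j < m} (\<lambda>(i, j). seqs (\<phi> i) (\<phi> j) (i = j))"

text \<open>The product is taken column by column. In column \<open>j\<close> the diagonal entry
  contributes the alternating count; by \<open>conj\<close> an earlier row contributes only if it
  carries the same, self-conjugate polynomial, and the number of such rows is the second argument of
  \<open>form_weight\<close>.\<close>

lemma card_gram_seqs:
  assumes \<phi>: "\<And>i. i < m \<Longrightarrow> mirr (\<phi> i)"
    and conj: "\<And>i j. i < m \<Longrightarrow> j < m \<Longrightarrow> \<phi> i = conjugate_poly (\<phi> j) \<Longrightarrow> \<phi> i = \<phi> j"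
    and \<Phi>: "finite \<Phi>" "\<phi> ` {..<m} \<subseteq> \<Phi>"
  shows "card (gram_seqs m \<phi>) = (\<Prod>x\<in>\<Phi>. \<Prod>s<card {i. i < m \<and> \<phi> i = x}. form_weight x s)"
proof -
  have set: "{(i, j). i \<le> j \<and> j < m} = (\<lambda>(j, i). (i, j)) ` (SIGMA j:{..<m}. {..j})"
    by (auto simp: image_iff)
  have fin: "finite {(i, j). i \<le> j \<and> j < m}" unfolding set by auto
  have "card (gram_seqs m \<phi>) = (\<Prod>(i, j)\<in>{(i, j). i \<le> j \<and> j < m}. card (seqs (\<phi> i) (\<phi> j) (i = j)))"
    unfolding gram_seqs_def by (subst card_PiE[OF fin]) (simp add: split_def)
  also have "\<dots> = (\<Prod>(j, i)\<in>(SIGMA j:{..<m}. {..j}). card (seqs (\<phi> i) (\<phi> j) (i = j)))"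
    unfolding set by (subst prod.reindex) (auto simp: inj_on_def split_def)
  also have "\<dots> = (\<Prod>j<m. \<Prod>i\<le>j. card (seqs (\<phi> i) (\<phi> j) (i = j)))"
    by (rule prod.Sigma[symmetric]) auto
  also have "\<dots> = (\<Prod>j<m. form_weight (\<phi> j) (card {i. i < j \<and> \<phi> i = \<phi> j}))"
  proof (rule prod.cong[OF refl])
    fix j assume "j \<in> {..<m}"
    hence j: "j < m" by simp
    have "(\<Prod>i\<le>j. card (seqs (\<phi> i) (\<phi> j) (i = j))) = card (seqs (\<phi> j) (\<phi> j) True) * (\<Prod>i<j. card (seqs (\<phi> i) (\<phi> j) (i = j)))"
      by (simp add: lessThan_Suc_atMost[symmetric] mult.commute)
    also have "(\<Prod>i<j. card (seqs (\<phi> i) (\<phi> j) (i = j))) =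
        (\<Prod>i<j. if \<phi> i = \<phi> j then (if \<phi> j = conjugate_poly (\<phi> j) then q ^ Polynomial.degree (\<phi> j) else 1) else 1)"
    proof (rule prod.cong[OF refl])
      fix i assume "i \<in> {..<j}"
      hence i: "i < m" "i < j" using j by auto
      have "card (seqs (\<phi> i) (\<phi> j) (i = j)) = (if \<phi> i = conjugate_poly (\<phi> j) then q ^ Polynomial.degree (\<phi> i) else 1)"
        using card_seqs_off_diagonal[OF \<phi>[OF i(1)] \<phi>[OF j]] i by simp
      thus "card (seqs (\<phi> i) (\<phi> j) (i = j)) = (if \<phi> i = \<phi> j then (if \<phi> j = conjugate_poly (\<phi> j) then q ^ Polynomial.degree (\<phi> j) else 1) else 1)"
        using conj[OF i(1) j] by auto
    qed
    also have "\<dots> = (\<Prod>i\<in>{i. i < j \<and> \<phi> i = \<phi> j}. (if \<phi> j = conjugate_poly (\<phi> j) then q ^ Polynomial.degree (\<phi> j) else 1))"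
      by (rule prod.mono_neutral_cong_right) auto
    finally show "(\<Prod>i\<le>j. card (seqs (\<phi> i) (\<phi> j) (i = j))) = form_weight (\<phi> j) (card {i. i < j \<and> \<phi> i = \<phi> j})"
      using card_seqs_diagonal[OF \<phi>[OF j]] by (simp add: form_weight_def power_mult)
  qed
  also have "\<dots> = (\<Prod>x\<in>\<Phi>. \<Prod>s<card {i. i < m \<and> \<phi> i = x}. form_weight x s)"
    by (rule prod_by_value[OF \<Phi>])
  finally show ?thesis .
qed

end

section \<open>Generators of cyclic modules\<close>

text \<open>\<open>S\<close> models the full isometry group of \<open>V\<close> by linear maps of
  the ambient space: \<open>S_ext\<close> and \<open>S_full\<close> make restriction to
  \<open>V\<close> a bijection onto the isometries. Inverses are not postulated, since injectivity
  on the finite \<open>V\<close> suffices. Keeping the ambient action makes eigenvectors outside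
  \<open>V\<close> available later.\<close>

locale symplectic_group = symplectic_space scale F V \<omega> + finite_subfield_2 F
  for scale :: "'a::field \<Rightarrow> 'v::ab_group_add \<Rightarrow> 'v" and F :: "'a set" and V :: "'v set"
    and \<omega> :: "'v \<Rightarrow> 'v \<Rightarrow> 'a" +
  fixes S :: "('v \<Rightarrow> 'v) set"
  assumes finite_S: "finite S"
    and S_hom: "\<And>T. T \<in> S \<Longrightarrow> module_hom scale scale T"
    and S_V: "\<And>T x. T \<in> S \<Longrightarrow> x \<in> V \<Longrightarrow> T x \<in> V"
    and S_isometry: "\<And>T x y. T \<in> S \<Longrightarrow> x \<in> V \<Longrightarrow> y \<in> V \<Longrightarrow> \<omega> (T x) (T y) = \<omega> x y"
    and S_comp: "\<And>T U. T \<in> S \<Longrightarrow> U \<in> S \<Longrightarrow> T \<circ> U \<in> S"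
    and S_ext: "\<And>T U. T \<in> S \<Longrightarrow> U \<in> S \<Longrightarrow> (\<And>x. x \<in> V \<Longrightarrow> T x = U x) \<Longrightarrow> T = U"
    and S_full: "\<And>L. linear_isometry L \<Longrightarrow> \<exists>T\<in>S. \<forall>x\<in>V. T x = L x"
begin

lemma S_inj: "T \<in> S \<Longrightarrow> inj_on T V"
proof
  fix x y assume T: "T \<in> S" and x: "x \<in> V" "y \<in> V" and eq: "T x = T y"
  have "x - y = 0"
  proof (rule \<omega>_nondegenerate)
    fix z assume z: "z \<in> V"
    have "\<omega> (x - y) z = \<omega> (T (x - y)) (T z)" using S_isometry[OF T V_diff[OF x] z] by simp
    also have "T (x - y) = 0" using eq by (simp add: module_hom.diff[OF S_hom[OF T]])
    finally show "\<omega> (x - y) z = 0" by simp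
  qed (rule V_diff[OF x])
  thus "x = y" by simp
qed

lemma S_surj: "T \<in> S \<Longrightarrow> T ` V = V"
  using endo_inj_surj[OF finite_V _ S_inj] S_V by blast

lemma S_comb: "T \<in> S \<Longrightarrow> T (comb J f c) = comb J (\<lambda>x. T (f x)) c"
  by (simp add: comb_def module_hom.sum[OF S_hom] module_hom.scale[OF S_hom])

lemma S_indep:
  assumes T: "T \<in> S" and f: "f \<in> J \<rightarrow> V" "indep J f"
  shows "indep J (\<lambda>x. T (f x))"
  unfolding indep_def
proof (intro ballI impI)
  fix c x assume c: "c \<in> J \<rightarrow> F" "comb J (\<lambda>x. T (f x)) c = 0" and x: "x \<in> J"
  have "T (comb J f c) = T 0" by (simp only: S_comb[OF T] c(2) module_hom.zero[OF S_hom[OF T]])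
  hence "comb J f c = 0"
    using inj_onD[OF S_inj[OF T]] comb_in_V[OF f(1) c(1)] V_0 by blast
  thus "c x = 0" using f(2) c(1) x by (auto simp: indep_def)
qed

text \<open>If nonempty, this is one orbit of \<open>S\<close> on families, by Witt's theorem
  (\<open>orbit_transporter\<close>).\<close>

definition orbit :: "'i set \<Rightarrow> ('i \<Rightarrow> 'i \<Rightarrow> 'a) \<Rightarrow> ('i \<Rightarrow> 'v) set" where
  "orbit J G = {f \<in> J \<rightarrow>\<^sub>E V. indep J f \<and> (\<forall>x\<in>J. \<forall>y\<in>J. \<omega> (f x) (f y) = G x y)}"

lemma finite_orbit: "finite J \<Longrightarrow> finite (orbit J G)"
  unfolding orbit_def by (rule finite_subset[OF _ finite_PiE[of J "\<lambda>_. V"]]) (auto simp: finite_V)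

lemma orbit_transporter:
  fixes J :: "'i set"
  assumes inf: "infinite (UNIV :: 'i set)" and J: "finite J" and f: "f \<in> orbit J G" and g: "g \<in> orbit J G"
  shows "\<exists>T\<in>S. \<forall>x\<in>J. T (f x) = g x"
proof -
  have "f \<in> J \<rightarrow> V" "indep J f" "g \<in> J \<rightarrow> V" "indep J g"
    "\<And>x y. x \<in> J \<Longrightarrow> y \<in> J \<Longrightarrow> \<omega> (f x) (f y) = \<omega> (g x) (g y)"
    using f g by (auto simp: orbit_def)
  from Witt[OF inf J this] obtain L where L: "linear_isometry L" "\<forall>x\<in>J. L (f x) = g x" by blast
  obtain T where "T \<in> S" "\<forall>x\<in>V. T x = L x" using S_full[OF L(1)] by blast
  thus ?thesis using L(2) f by (intro bexI[of _ T]) (auto simp: orbit_def PiE_iff)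
qed

text \<open>Composing with a transporter from \<open>g\<close> to \<open>f\<close> on the right and
  with one from \<open>f'\<close> to \<open>g'\<close> on the left injects the first set into the
  second; cancellation uses that elements of \<open>S\<close> permute \<open>V\<close>.\<close>

lemma card_transporter_le:
  fixes J :: "'i set"
  assumes inf: "infinite (UNIV :: 'i set)" and J: "finite J"
    and f: "f \<in> orbit J G" and f': "f' \<in> orbit J G" and g: "g \<in> orbit J G" and g': "g' \<in> orbit J G"
  shows "card {T\<in>S. \<forall>x\<in>J. T (f x) = f' x} \<le> card {T\<in>S. \<forall>x\<in>J. T (g x) = g' x}"
proof -
  obtain w where w: "w \<in> S" "\<forall>x\<in>J. w (g x) = f x" using orbit_transporter[OF inf J g f] by blast
  obtain u where u: "u \<in> S" "\<forall>x\<in>J. u (f' x) = g' x" using orbit_transporter[OF inf J f' g'] by blast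
  have "inj_on (\<lambda>T. u \<circ> T \<circ> w) {T\<in>S. \<forall>x\<in>J. T (f x) = f' x}"
  proof
    fix T U assume "T \<in> {T\<in>S. \<forall>x\<in>J. T (f x) = f' x}" "U \<in> {T\<in>S. \<forall>x\<in>J. T (f x) = f' x}"
    hence TU: "T \<in> S" "U \<in> S" by auto
    assume eq: "u \<circ> T \<circ> w = u \<circ> U \<circ> w"
    show "T = U"
    proof (rule S_ext[OF TU])
      fix x assume "x \<in> V"
      then obtain y where y: "y \<in> V" "x = w y" using S_surj[OF w(1)] by blast
      have "u (T x) = u (U x)" using fun_cong[OF eq, of y] y by simp
      thus "T x = U x" using inj_onD[OF S_inj[OF u(1)]] S_V TU \<open>x \<in> V\<close> by blast
    qed
  qed
  moreover have "(\<lambda>T. u \<circ> T \<circ> w) ` {T\<in>S. \<forall>x\<in>J. T (f x) = f' x} \<subseteq> {T\<in>S. \<forall>x\<in>J. T (g x) = g' x}"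
    using w u S_comp by auto
  ultimately show ?thesis using finite_S by (intro card_inj_on_le) auto
qed

text \<open>Orbit-stabiliser: every transporter between two families of the orbit has the same size.\<close>

lemma sum_transporters:
  fixes J :: "'i set"
  assumes inf: "infinite (UNIV :: 'i set)" and J: "finite J"
    and \<tau>: "\<And>f. f \<in> orbit J G \<Longrightarrow> \<tau> f \<in> orbit J G"
  shows "(\<Sum>f\<in>orbit J G. card {T\<in>S. \<forall>x\<in>J. T (f x) = \<tau> f x}) = (if orbit J G = {} then 0 else card S)"
proof (cases "orbit J G = {}")
  case False
  then obtain g where g: "g \<in> orbit J G" by blast
  let ?N = "\<lambda>f f'. {T\<in>S. \<forall>x\<in>J. T (f x) = f' x}"
  have const: "card (?N f f') = card (?N g g)" if "f \<in> orbit J G" "f' \<in> orbit J G" for f f'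
    by (rule antisym[OF card_transporter_le[OF inf J that g g] card_transporter_le[OF inf J g g that]])
  \<comment> \<open>Sorting \<open>S\<close> by the image of one fixed \<open>g\<close> writes
    \<open>card S\<close> as a sum of transporter sizes. As all sizes agree, the transporters from
    \<open>g\<close> to \<open>f\<close> may be replaced by those from \<open>f\<close> to
    \<open>\<tau> f\<close>.\<close>
  have "S = (\<Union>f\<in>orbit J G. ?N g f)"
  proof (intro equalityI subsetI)
    fix T assume T: "T \<in> S"
    define f where "f = (\<lambda>x\<in>J. T (g x))"
    have gV: "g \<in> J \<rightarrow> V" using g by (auto simp: orbit_def)
    have "indep J f \<longleftrightarrow> indep J (\<lambda>x. T (g x))" by (rule indep_cong) (simp add: f_def)
    hence "indep J f" using S_indep[OF T gV] g by (simp add: orbit_def)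
    moreover have "\<omega> (f x) (f y) = G x y" if "x \<in> J" "y \<in> J" for x y
    proof -
      have "g x \<in> V" "g y \<in> V" using that gV by auto
      thus ?thesis using that g S_isometry[OF T] by (simp add: f_def orbit_def)
    qed
    moreover have "f \<in> J \<rightarrow>\<^sub>E V" using gV S_V[OF T] by (auto simp: f_def)
    ultimately have "f \<in> orbit J G" by (simp add: orbit_def)
    moreover have "T \<in> ?N g f" using T by (simp add: f_def)
    ultimately show "T \<in> (\<Union>f\<in>orbit J G. ?N g f)" by blast
  qed auto
  hence "card S = card (\<Union>f\<in>orbit J G. ?N g f)" by simp
  also have "\<dots> = (\<Sum>f\<in>orbit J G. card (?N g f))"
  proof (rule card_UN_disjoint)
    show "\<forall>f\<in>orbit J G. \<forall>f'\<in>orbit J G. f \<noteq> f' \<longrightarrow> ?N g f \<inter> ?N g f' = {}"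
    proof (intro ballI impI, rule ccontr)
      fix f f' assume f: "f \<in> orbit J G" "f' \<in> orbit J G" "f \<noteq> f'" "?N g f \<inter> ?N g f' \<noteq> {}"
      then obtain T where "T \<in> ?N g f" "T \<in> ?N g f'" by blast
      hence "f x = f' x" if "x \<in> J" for x using that by auto
      moreover have "f \<in> J \<rightarrow>\<^sub>E V" "f' \<in> J \<rightarrow>\<^sub>E V" using f by (auto simp: orbit_def)
      ultimately show False using f(3) PiE_ext by blast
    qed
  qed (use finite_S finite_orbit[OF J] in auto)
  also have "\<dots> = (\<Sum>f\<in>orbit J G. card {T\<in>S. \<forall>x\<in>J. T (f x) = \<tau> f x})"
  proof (rule sum.cong[OF refl])
    fix f assume f: "f \<in> orbit J G"
    show "card (?N g f) = card (?N f (\<tau> f))" using const[OF g f] const[OF f \<tau>[OF f]] by simp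
  qed
  finally show ?thesis using False by simp
qed simp

end

section \<open>Families of iterates and their Gram matrices\<close>

locale generators = symplectic_group scale F V \<omega> S
  for scale :: "'a::field \<Rightarrow> 'v::ab_group_add \<Rightarrow> 'v" and F :: "'a set" and V :: "'v set"
    and \<omega> :: "'v \<Rightarrow> 'v \<Rightarrow> 'a" and S :: "('v \<Rightarrow> 'v) set" +
  fixes m :: nat and \<phi> :: "nat \<Rightarrow> 'a poly"
  assumes mirr_\<phi>: "\<And>i. i < m \<Longrightarrow> mirr (\<phi> i)"
begin

abbreviation "d i \<equiv> Polynomial.degree (\<phi> i)"

definition Idx :: "(nat \<times> nat) set" where
  "Idx = (SIGMA i:{..<m}. {..<d i})"

text \<open>If \<open>f (i, a) = T\<^sup>a v\<^sub>i\<close> with \<open>\<phi>\<^sub>i(T) v\<^sub>i = 0\<close>, then \<open>succ f\<close> is \<open>T \<circ> f\<close> on \<open>Idx\<close>, but it is defined without \<open>T\<close>.\<close>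

definition succ :: "(nat \<times> nat \<Rightarrow> 'v) \<Rightarrow> nat \<times> nat \<Rightarrow> 'v" where
  "succ f = (\<lambda>(i, a)\<in>Idx. if Suc a < d i then f (i, Suc a)
     else - (\<Sum>s<d i. scale (Polynomial.coeff (\<phi> i) s) (f (i, s))))"

text \<open>The data \<open>b\<close> of an invariant form are only recorded for \<open>i \<le> j\<close>; as \<open>T\<close> is an isometry and the characteristic
  is two, exchanging the arguments reverses the sequence.\<close>

definition two_sided :: "(nat \<times> nat \<Rightarrow> int \<Rightarrow> 'a) \<Rightarrow> nat \<Rightarrow> nat \<Rightarrow> int \<Rightarrow> 'a" where
  "two_sided b i j = (if i \<le> j then b (i, j) else b (j, i) \<circ> uminus)"

definition gram :: "(nat \<times> nat \<Rightarrow> int \<Rightarrow> 'a) \<Rightarrow> nat \<times> nat \<Rightarrow> nat \<times> nat \<Rightarrow> 'a" where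
  "gram b x y = two_sided b (fst x) (fst y) (int (snd x) - int (snd y))"

lemma finite_Idx: "finite Idx"
  by (simp add: Idx_def)

lemma Idx_iff: "(i, a) \<in> Idx \<longleftrightarrow> i < m \<and> a < d i"
  by (auto simp: Idx_def)

lemma card_Idx: "card Idx = (\<Sum>i<m. d i)"
  by (simp add: Idx_def)

lemma d_pos: "i < m \<Longrightarrow> d i > 0"
  using mirr_D(4)[OF mirr_\<phi>] .

lemma lead: "i < m \<Longrightarrow> Polynomial.coeff (\<phi> i) (d i) = 1"
  using mirr_D(3)[OF mirr_\<phi>] .

lemma comb_Idx: "comb Idx f c = (\<Sum>i<m. \<Sum>a<d i. scale (c (i, a)) (f (i, a)))"
  unfolding comb_def Idx_def by (subst sum.Sigma) auto

lemma succ_in_V: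
  assumes "f \<in> Idx \<rightarrow> V"
  shows "succ f \<in> Idx \<rightarrow>\<^sub>E V"
proof -
  have "succ f (i, a) \<in> V" if ia: "(i, a) \<in> Idx" for i a
  proof (cases "Suc a < d i")
    case True
    hence "(i, Suc a) \<in> Idx" using ia by (simp add: Idx_iff)
    thus ?thesis using True assms ia by (auto simp: succ_def)
  next
    case False
    have i: "i < m" using ia by (simp add: Idx_iff)
    have "- (\<Sum>s<d i. scale (Polynomial.coeff (\<phi> i) s) (f (i, s))) \<in> V"
    proof (intro V_uminus V_sum V_scale P_coeff mirr_D(2)[OF mirr_\<phi>[OF i]])
      fix s assume "s \<in> {..<d i}"
      hence "(i, s) \<in> Idx" using i by (simp add: Idx_iff)
      thus "f (i, s) \<in> V" using assms by auto
    qed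
    thus ?thesis using False ia by (simp add: succ_def)
  qed
  thus ?thesis by (auto simp: succ_def)
qed

text \<open>The coefficients are multiplied by the companion matrix: each moves up one place, and
  the one that falls off the top returns through the lower coefficients of
  \<open>\<phi> i\<close>.\<close>

lemma comb_succ:
  assumes "\<And>i. i < m \<Longrightarrow> d i > 0"
  shows "comb Idx (succ f) c = comb Idx f (\<lambda>(i, a). (if a = 0 then 0 else c (i, a - 1)) -
     c (i, d i - 1) * Polynomial.coeff (\<phi> i) a)"
  unfolding comb_Idx
proof (rule sum.cong[OF refl])
  fix i assume "i \<in> {..<m}"
  hence i: "i < m" by simp
  obtain e where e: "d i = Suc e" using d_pos[OF i] by (cases "d i") auto
  have "(\<Sum>a<d i. scale (c (i, a)) (succ f (i, a))) =
      (\<Sum>a<e. scale (c (i, a)) (succ f (i, a))) + scale (c (i, e)) (succ f (i, e))"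
    by (simp add: e)
  also have "(\<Sum>a<e. scale (c (i, a)) (succ f (i, a))) = (\<Sum>a<e. scale (c (i, a)) (f (i, Suc a)))"
    by (intro sum.cong) (auto simp: succ_def Idx_iff i e)
  also have "scale (c (i, e)) (succ f (i, e)) = - (\<Sum>s<Suc e. scale (c (i, e) * Polynomial.coeff (\<phi> i) s) (f (i, s)))"
  proof -
    have "succ f (i, e) = - (\<Sum>s<Suc e. scale (Polynomial.coeff (\<phi> i) s) (f (i, s)))"
      by (simp add: succ_def Idx_iff i e del: sum.lessThan_Suc)
    thus ?thesis by (simp add: scale_sum_right del: sum.lessThan_Suc)
  qed
  also have "(\<Sum>a<e. scale (c (i, a)) (f (i, Suc a))) =
      (\<Sum>a<Suc e. scale (if a = 0 then 0 else c (i, a - 1)) (f (i, a)))"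
    by (subst sum.lessThan_Suc_shift) simp
  finally show "(\<Sum>a<d i. scale (c (i, a)) (succ f (i, a))) =
      (\<Sum>a<d i. scale (case (i, a) of (i, a) \<Rightarrow> (if a = 0 then 0 else c (i, a - 1)) -
        c (i, d i - 1) * Polynomial.coeff (\<phi> i) a) (f (i, a)))"
    unfolding e by (simp add: e scale_left_diff_distrib sum_subtractf del: sum.lessThan_Suc)
qed

text \<open>The companion matrix is invertible because \<open>\<phi> i\<close> has nonzero constant
  term: position 0 forces the top coefficient to vanish, and then the others follow.\<close>

lemma indep_succ:
  assumes f: "indep Idx f"
  shows "indep Idx (succ f)"
  unfolding indep_def
proof (intro ballI impI)
  fix c x assume c: "c \<in> Idx \<rightarrow> F" "comb Idx (succ f) c = 0" and x: "x \<in> Idx"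
  let ?c = "\<lambda>(i, a). (if a = 0 then 0 else c (i, a - 1)) - c (i, d i - 1) * Polynomial.coeff (\<phi> i) a"
  have "?c \<in> Idx \<rightarrow> F"
  proof
    fix y assume y: "y \<in> Idx"
    obtain i a where ia: "y = (i, a)" by (cases y)
    have i: "i < m" "a < d i" using y ia by (auto simp: Idx_iff)
    have "c (i, d i - 1) \<in> F" "a \<noteq> 0 \<Longrightarrow> c (i, a - 1) \<in> F"
      using c(1) i by (auto simp: Idx_iff Pi_iff)
    thus "?c y \<in> F" using mirr_D(2)[OF mirr_\<phi>[OF i(1)]] by (auto simp: ia intro!: F_diff F_mult P_coeff F_0)
  qed
  moreover have "comb Idx f ?c = 0" using comb_succ[OF d_pos] c(2) by simp
  ultimately have all: "\<forall>y\<in>Idx. ?c y = 0" using f unfolding indep_def by blast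
  have z: "(if a = 0 then 0 else c (i, a - 1)) - c (i, d i - 1) * Polynomial.coeff (\<phi> i) a = 0" if "i < m" "a < d i" for i a
    using bspec[OF all, of "(i, a)"] that by (simp add: Idx_iff)
  obtain i a where ia: "x = (i, a)" by (cases x)
  have i: "i < m" "a < d i" using x ia by (auto simp: Idx_iff)
  have "Polynomial.coeff (\<phi> i) 0 \<noteq> 0" using mirr_D(6)[OF mirr_\<phi>[OF i(1)]] by (simp add: poly_0_coeff_0)
  hence top: "c (i, d i - 1) = 0" using z[OF i(1), of 0] d_pos[OF i(1)] by simp
  show "c x = 0"
  proof (cases "Suc a < d i")
    case True
    thus ?thesis using z[OF i(1), of "Suc a"] top ia by simp
  next
    case False
    hence "a = d i - 1" using i by simp
    thus ?thesis using top ia by simp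
  qed
qed

lemma two_sided_props:
  assumes b: "b \<in> gram_seqs m \<phi>" and ij: "i < m" "j < m"
  shows "fs.pact (\<phi> i) shift (two_sided b i j) = 0" "two_sided b j i = two_sided b i j \<circ> uminus"
    "two_sided b i i 0 = 0" "two_sided b i j k \<in> F"
proof -
  have s: "b (i, j) \<in> seqs (\<phi> i) (\<phi> j) (i = j)" if "i \<le> j" "j < m" for i j
    using b that unfolding gram_seqs_def by (force simp: PiE_iff)
  have u: "x \<circ> uminus \<circ> uminus = x" for x :: "int \<Rightarrow> 'a" by (auto simp: fun_eq_iff)
  show "fs.pact (\<phi> i) shift (two_sided b i j) = 0"
    using s[of i j] s[of j i] ij by (auto simp: two_sided_def seqs_def recs_def)
  show "two_sided b j i = two_sided b i j \<circ> uminus"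
    using s[of i j] s[of j i] ij u by (auto simp: two_sided_def seqs_def)
  show "two_sided b i i 0 = 0" using s[of i i] ij by (auto simp: two_sided_def seqs_def)
  show "two_sided b i j k \<in> F"
    using s[of i j] s[of j i] ij by (auto simp: two_sided_def seqs_def recs_def)
qed

lemma two_sided_rec:
  assumes b: "b \<in> gram_seqs m \<phi>" and ij: "i < m" "j < m"
  shows "(\<Sum>s<d i. Polynomial.coeff (\<phi> i) s * two_sided b i j (k + int s)) = two_sided b i j (k + int (d i))"
proof -
  have "(\<Sum>s\<le>d i. Polynomial.coeff (\<phi> i) s * two_sided b i j (k + int s)) = 0"
    using fun_cong[OF two_sided_props(1)[OF assms], of k] by (simp add: pact_shift)
  moreover have "{..d i} = insert (d i) {..<d i}" by auto
  ultimately have "two_sided b i j (k + int (d i)) + (\<Sum>s<d i. Polynomial.coeff (\<phi> i) s * two_sided b i j (k + int s)) = 0"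
    using lead[OF ij(1)] by simp
  thus ?thesis using uminus_eq by (metis add_eq_0_iff)
qed

text \<open>Advancing both arguments leaves an invariant form unchanged; at the top index the
  recurrence for the entries of \<open>b\<close> takes the place of \<open>T\<close>. This lets
  \<open>sum_transporters\<close> be applied with \<open>succ\<close> as
  \<open>\<tau>\<close>.\<close>

lemma succ_orbit:
  assumes b: "b \<in> gram_seqs m \<phi>" and f: "f \<in> orbit Idx (gram b)"
  shows "succ f \<in> orbit Idx (gram b)"
proof -
  have g: "\<omega> (f (i, a)) (f (j, a')) = two_sided b i j (int a - int a')" if "(i, a) \<in> Idx" "(j, a') \<in> Idx" for i a j a'
    using f that by (auto simp: orbit_def gram_def)
  have step1: "\<omega> (succ f (i, a)) (f (j, a')) = two_sided b i j (int a + 1 - int a')"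
    if ia: "(i, a) \<in> Idx" "(j, a') \<in> Idx" for i a j a'
  proof (cases "Suc a < d i")
    case True
    thus ?thesis using g[of i "Suc a" j a'] ia by (simp add: succ_def Idx_iff add.commute)
  next
    case False
    have i: "i < m" "j < m" and a: "Suc a = d i" using ia False by (auto simp: Idx_iff)
    have "\<omega> (succ f (i, a)) (f (j, a')) = (\<Sum>s<d i. Polynomial.coeff (\<phi> i) s * \<omega> (f (i, s)) (f (j, a')))"
      using ia False by (simp add: succ_def \<omega>_minus_left \<omega>_sum_left \<omega>_scale_left)
    also have "\<dots> = (\<Sum>s<d i. Polynomial.coeff (\<phi> i) s * two_sided b i j (- int a' + int s))"
      using ia by (intro sum.cong) (auto simp: g Idx_iff)
    also have "\<dots> = two_sided b i j (- int a' + int (d i))" by (rule two_sided_rec[OF b i])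
    finally show ?thesis by (simp add: a[symmetric] algebra_simps)
  qed
  have step2: "\<omega> (succ f (i, a)) (succ f (j, a')) = two_sided b i j (int a - int a')"
    if ia: "(i, a) \<in> Idx" "(j, a') \<in> Idx" for i a j a'
  proof (cases "Suc a' < d j")
    case True
    thus ?thesis using step1[of i a j "Suc a'"] ia by (simp add: succ_def[of f] Idx_iff)
  next
    case False
    have i: "i < m" "j < m" and a: "Suc a' = d j" using ia False by (auto simp: Idx_iff)
    have "\<omega> (succ f (i, a)) (succ f (j, a')) = - \<omega> (succ f (j, a')) (succ f (i, a))" by (rule \<omega>_antisym)
    also have "\<dots> = (\<Sum>s<d j. Polynomial.coeff (\<phi> j) s * \<omega> (f (j, s)) (succ f (i, a)))"
      using ia False by (simp add: succ_def[of f] \<omega>_minus_left \<omega>_sum_left \<omega>_scale_left)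
    also have "\<dots> = (\<Sum>s<d j. Polynomial.coeff (\<phi> j) s * two_sided b j i (- int a - 1 + int s))"
    proof (intro sum.cong refl)
      fix s assume "s \<in> {..<d j}"
      hence js: "(j, s) \<in> Idx" using i by (simp add: Idx_iff)
      have "\<omega> (f (j, s)) (succ f (i, a)) = - \<omega> (succ f (i, a)) (f (j, s))" by (rule \<omega>_antisym)
      also have "\<dots> = two_sided b i j (int a + 1 - int s)" using step1[OF ia(1) js] by simp
      also have "\<dots> = two_sided b j i (- int a - 1 + int s)"
        unfolding two_sided_props(2)[OF b i] by (simp add: algebra_simps)
      finally show "Polynomial.coeff (\<phi> j) s * \<omega> (f (j, s)) (succ f (i, a)) =
        Polynomial.coeff (\<phi> j) s * two_sided b j i (- int a - 1 + int s)" by simp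
    qed
    also have "\<dots> = two_sided b j i (- int a - 1 + int (d j))" by (rule two_sided_rec[OF b i(2) i(1)])
    also have "\<dots> = two_sided b i j (int a - int a')"
      unfolding two_sided_props(2)[OF b i] by (simp add: a[symmetric] algebra_simps)
    finally show ?thesis .
  qed
  have fV: "f \<in> Idx \<rightarrow> V" and "indep Idx f" using f by (auto simp: orbit_def)
  thus ?thesis unfolding orbit_def using succ_in_V[OF fV] indep_succ step2 by (auto simp: gram_def)
qed

end

section \<open>Kernels of polynomials and independent generators\<close>

context symplectic_group
begin

definition ker :: "('v \<Rightarrow> 'v) \<Rightarrow> 'a poly \<Rightarrow> 'v set" where
  "ker T p = {v \<in> V. pact p T v = 0}"

definition pcomb :: "('v \<Rightarrow> 'v) \<Rightarrow> nat \<Rightarrow> (nat \<Rightarrow> 'v) \<Rightarrow> (nat \<Rightarrow> 'a poly) \<Rightarrow> 'v" where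
  "pcomb T m v r = (\<Sum>i<m. pact (r i) T (v i))"

definition pspan :: "('v \<Rightarrow> 'v) \<Rightarrow> nat \<Rightarrow> (nat \<Rightarrow> 'v) \<Rightarrow> 'v set" where
  "pspan T m v = {x. \<exists>r. (\<forall>i<m. r i \<in> P) \<and> x = pcomb T m v r}"

text \<open>When each \<open>v i\<close> is killed by its \<open>\<phi> i\<close>, this says that
  the map from the direct sum of the \<open>F[z]/(\<phi> i)\<close> onto \<open>pspan\<close> is
  injective.\<close>

definition pindep :: "('v \<Rightarrow> 'v) \<Rightarrow> nat \<Rightarrow> (nat \<Rightarrow> 'a poly) \<Rightarrow> (nat \<Rightarrow> 'v) \<Rightarrow> bool" where
  "pindep T m \<phi> v \<longleftrightarrow> (\<forall>r. (\<forall>i<m. r i \<in> P) \<longrightarrow> pcomb T m v r = 0 \<longrightarrow> (\<forall>i<m. \<phi> i dvd r i))"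

definition gens :: "('v \<Rightarrow> 'v) \<Rightarrow> nat \<Rightarrow> (nat \<Rightarrow> 'a poly) \<Rightarrow> (nat \<Rightarrow> 'v) set" where
  "gens T m \<phi> = {v \<in> {..<m} \<rightarrow>\<^sub>E V. (\<forall>i<m. v i \<in> ker T (\<phi> i)) \<and> pindep T m \<phi> v}"

lemma finite_gens: "finite (gens T m \<phi>)"
  unfolding gens_def by (rule finite_subset[OF _ finite_PiE[of "{..<m}" "\<lambda>_. V"]]) (auto simp: finite_V)

lemma finite_ker: "finite (ker T p)"
  using finite_V by (simp add: ker_def)

lemma pact_0_right: "T \<in> S \<Longrightarrow> pact p T 0 = 0"
  by (rule module_hom.zero[OF hom_pact[OF S_hom]])

lemma pact_pcomb: "T \<in> S \<Longrightarrow> pact a T (pcomb T m v r) = pcomb T m v (\<lambda>i. a * r i)"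
  by (simp add: pcomb_def module_hom.sum[OF hom_pact[OF S_hom]] pact_mult[OF S_hom])

lemma pact_dvd:
  assumes "T \<in> S" "p dvd r" "pact p T x = 0"
  shows "pact r T x = 0"
proof -
  obtain s where "r = s * p" using assms(2) by (metis dvdE mult.commute)
  thus ?thesis using assms by (simp add: pact_mult[OF S_hom] pact_0_right)
qed

lemma pact_mod:
  assumes "T \<in> S" "pact p T x = 0"
  shows "pact (r mod p) T x = pact r T x"
proof -
  have "pact (r - r mod p) T x = 0" using assms by (rule pact_dvd[OF _ dvd_minus_mod])
  thus ?thesis by (simp add: pact_diff)
qed

lemma pspan_subset_V:
  assumes "T \<in> S" "\<And>i. i < m \<Longrightarrow> v i \<in> V"
  shows "pspan T m v \<subseteq> V"
  using assms S_V by (auto simp: pspan_def pcomb_def intro!: V_sum pact_in_V)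

text \<open>A vector of the span that is killed by \<open>p\<close> has components only at the
  generators with \<open>\<phi> i = p\<close>, and there a coefficient counts modulo
  \<open>p\<close>.\<close>

lemma card_ker_inter_pspan:
  assumes T: "T \<in> S" and \<phi>: "\<And>i. i < m \<Longrightarrow> mirr (\<phi> i)" and p: "mirr p" and v: "v \<in> gens T m \<phi>"
  shows "card (ker T p \<inter> pspan T m v) = q ^ (Polynomial.degree p * card {i. i < m \<and> \<phi> i = p})"
proof -
  define K where "K = {i. i < m \<and> \<phi> i = p}"
  define g where "g r = (\<Sum>i\<in>K. pact (r i) T (v i))" for r
  let ?Pd = "small_polys (Polynomial.degree p)"
  have K: "finite K" "K \<subseteq> {..<m}" by (auto simp: K_def)
  have vker: "pact (\<phi> i) T (v i) = 0" "v i \<in> V" if "i < m" for i using v that by (auto simp: gens_def ker_def)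
  have ind: "\<phi> i dvd r i" if "\<And>i. i < m \<Longrightarrow> r i \<in> P" "pcomb T m v r = 0" "i < m" for r i
    using v that by (auto simp: gens_def pindep_def)
  have gp: "g r = pcomb T m v (\<lambda>i. if i \<in> K then r i else 0)" for r
    unfolding g_def pcomb_def using K by (intro sum.mono_neutral_cong_left) auto
  have PdP: "?Pd \<subseteq> P" by (auto simp: small_polys_def)
  have inj: "inj_on g (K \<rightarrow>\<^sub>E ?Pd)"
  proof
    fix r s assume r: "r \<in> K \<rightarrow>\<^sub>E ?Pd" and s: "s \<in> K \<rightarrow>\<^sub>E ?Pd" and eq: "g r = g s"
    let ?t = "\<lambda>i. if i \<in> K then r i - s i else 0"
    have tP: "?t i \<in> P" for i using r s PdP by (auto simp: P_0 PiE_iff intro!: P_diff)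
    have "g (\<lambda>i. r i - s i) = 0" using eq by (simp add: g_def pact_diff sum_subtractf)
    hence t0: "pcomb T m v ?t = 0" by (simp add: gp)
    have dvd: "p dvd r i - s i" if "i \<in> K" for i
    proof -
      have "\<phi> i dvd ?t i" by (rule ind[OF tP t0]) (use that in \<open>simp add: K_def\<close>)
      thus ?thesis using that by (simp add: K_def)
    qed
    have "r i = s i" if i: "i \<in> K" for i
    proof -
      have "r i - s i \<in> ?Pd"
      proof -
        have "r i = 0 \<or> Polynomial.degree (r i) < Polynomial.degree p"
          "s i = 0 \<or> Polynomial.degree (s i) < Polynomial.degree p" "Polynomial.degree p > 0"
          using r s i mirr_D(4)[OF p] by (auto simp: small_polys_def PiE_iff)
        hence "Polynomial.degree (r i - s i) < Polynomial.degree p"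
          by (intro degree_diff_less) auto
        thus ?thesis using tP[of i] i by (simp add: small_polys_def)
      qed
      thus ?thesis using small_dvd_imp_0 dvd[OF i] by fastforce
    qed
    thus "r = s" using r s by (intro PiE_ext[of r K "\<lambda>_. ?Pd" s]) auto
  qed
  have "g ` (K \<rightarrow>\<^sub>E ?Pd) = ker T p \<inter> pspan T m v"
  proof (intro equalityI subsetI)
    fix x assume "x \<in> g ` (K \<rightarrow>\<^sub>E ?Pd)"
    then obtain r where r: "r \<in> K \<rightarrow>\<^sub>E ?Pd" "x = g r" by blast
    let ?r = "\<lambda>i. if i \<in> K then r i else 0"
    have rP: "?r i \<in> P" for i using r PdP by (auto simp: P_0 PiE_iff)
    have xs: "x \<in> pspan T m v" unfolding pspan_def using rP r(2) gp[of r] by (intro CollectI exI[of _ ?r]) auto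
    have "pact p T x = (\<Sum>i\<in>K. pact (r i) T (pact p T (v i)))"
      unfolding r(2) g_def by (simp add: module_hom.sum[OF hom_pact[OF S_hom[OF T]]] pact_commute[OF S_hom[OF T], of p])
    also have "\<dots> = 0" using vker by (intro sum.neutral) (auto simp: K_def pact_0_right[OF T])
    finally have "pact p T x = 0" .
    moreover have "pspan T m v \<subseteq> V" by (rule pspan_subset_V[OF T]) (rule vker(2))
    ultimately show "x \<in> ker T p \<inter> pspan T m v" using xs by (auto simp: ker_def)
  next
    fix x assume "x \<in> ker T p \<inter> pspan T m v"
    then obtain r where r: "\<And>i. i < m \<Longrightarrow> r i \<in> P" "x = pcomb T m v r" and px: "pact p T x = 0"
      by (auto simp: pspan_def ker_def)
    \<comment> \<open>At these indices \<open>\<phi> i\<close> divides \<open>p * r i\<close> but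
      not \<open>p\<close>, so it divides \<open>r i\<close> and the component is zero.\<close>
    have rz: "pact (r i) T (v i) = 0" if i: "i < m" "i \<notin> K" for i
    proof -
      have "pcomb T m v (\<lambda>i. p * r i) = 0" using px r pact_pcomb[OF T] by simp
      hence "\<phi> i dvd p * r i" using ind[of "\<lambda>i. p * r i"] i r(1) mirr_D(2)[OF p] P_mult by blast
      moreover have "\<not> \<phi> i dvd p" using mirr_dvd_eq[OF \<phi>[OF i(1)] p] i by (auto simp: K_def)
      ultimately have "\<phi> i dvd r i" using irreducible_over_prime[OF mirr_D(1)[OF \<phi>[OF i(1)]] mirr_D(2)[OF p]] by blast
      thus ?thesis using pact_dvd[OF T] vker(1)[OF i(1)] by blast
    qed
    let ?s = "\<lambda>i\<in>K. r i mod p"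
    have "?s \<in> K \<rightarrow>\<^sub>E ?Pd" using mod_small mirr_D[OF p] r(1) by (auto simp: K_def)
    moreover have "x = g ?s"
    proof -
      have "x = (\<Sum>i\<in>K. pact (r i) T (v i))"
        unfolding r(2) pcomb_def using K rz by (intro sum.mono_neutral_right) auto
      also have "\<dots> = g ?s"
        unfolding g_def using vker(1) by (intro sum.cong) (auto simp: K_def pact_mod[OF T])
      finally show ?thesis .
    qed
    ultimately show "x \<in> g ` (K \<rightarrow>\<^sub>E ?Pd)" by blast
  qed
  hence "card (ker T p \<inter> pspan T m v) = card (K \<rightarrow>\<^sub>E ?Pd)" using card_image[OF inj] by simp
  also have "\<dots> = q ^ (Polynomial.degree p * card K)"
    using K by (simp add: card_PiE card_small_polys power_mult)
  finally show ?thesis by (simp add: K_def)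
qed

lemma pcomb_Suc: "pcomb T (Suc m) v r = pcomb T m v r + pact (r m) T (v m)"
  by (simp add: pcomb_def)

lemma pcomb_cong: "(\<And>i. i < m \<Longrightarrow> v i = w i) \<Longrightarrow> (\<And>i. i < m \<Longrightarrow> r i = s i) \<Longrightarrow> pcomb T m v r = pcomb T m w s"
  by (simp add: pcomb_def)

lemma gens_extend:
  assumes T: "T \<in> S" and p: "mirr (\<phi> m)" and v: "v \<in> gens T m \<phi>" and u: "u \<in> ker T (\<phi> m)" "u \<notin> pspan T m v"
  shows "v(m := u) \<in> gens T (Suc m) \<phi>"
proof -
  have "pindep T (Suc m) \<phi> (v(m := u))"
    unfolding pindep_def
  proof (intro allI impI)
    fix r i assume r: "\<forall>i<Suc m. r i \<in> P" and z: "pcomb T (Suc m) (v(m := u)) r = 0" and i: "i < Suc m"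
    have "pcomb T m (v(m := u)) r = pcomb T m v r" by (rule pcomb_cong) auto
    hence z': "pcomb T m v r + pact (r m) T u = 0" using z by (simp add: pcomb_Suc)
    \<comment> \<open>Otherwise \<open>r m\<close> is invertible modulo \<open>\<phi> m\<close>, and
      applying its inverse to the relation expresses \<open>u\<close> through the old
      generators.\<close>
    have dvd: "\<phi> m dvd r m"
    proof (rule ccontr)
      assume "\<not> \<phi> m dvd r m"
      then obtain a b where ab: "a \<in> P" "b \<in> P" "a * \<phi> m + b * r m = 1"
        using irreducible_over_bezout[OF mirr_D(1)[OF p]] r by blast
      have "u = pact (a * \<phi> m + b * r m) T u" by (simp add: ab)
      also have "\<dots> = pact b T (pact (r m) T u)"
        using u(1) by (simp add: pact_add pact_mult[OF S_hom[OF T]] ker_def pact_0_right[OF T])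
      also have "pact (r m) T u = pcomb T m v (\<lambda>i. - r i)"
      proof -
        have neg: "pact (- s) T x = - pact s T x" for s x using pact_diff[of 0 s T x] by simp
        have "pcomb T m v (\<lambda>i. - r i) = - pcomb T m v r" by (simp only: pcomb_def neg sum_negf)
        thus ?thesis using z' add_eq_0_iff by metis
      qed
      also have "pact b T \<dots> = pcomb T m v (\<lambda>i. b * - r i)" by (rule pact_pcomb[OF T])
      finally have "u = pcomb T m v (\<lambda>i. b * - r i)" .
      moreover have "b * - r i \<in> P" if "i < m" for i
        using P_mult[OF ab(2) P_diff[OF P_0, of "r i"]] r that by simp
      ultimately have "u \<in> pspan T m v"
        unfolding pspan_def by (intro CollectI exI[of _ "\<lambda>i. b * - r i"] conjI allI impI)
      thus False using u(2) by blast
    qed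
    hence "pact (r m) T u = 0" using pact_dvd[OF T] u(1) by (auto simp: ker_def)
    hence "pcomb T m v r = 0" using z' by simp
    hence "\<forall>i<m. \<phi> i dvd r i" using v r by (auto simp: gens_def pindep_def)
    thus "\<phi> i dvd r i" using dvd i by (auto simp: less_Suc_eq)
  qed
  moreover have "v(m := u) \<in> {..<Suc m} \<rightarrow>\<^sub>E V"
    using v u(1) by (auto simp: gens_def ker_def PiE_iff extensional_def less_Suc_eq)
  ultimately show ?thesis using v u(1) by (auto simp: gens_def less_Suc_eq)
qed

lemma gens_restrict:
  assumes T: "T \<in> S" and p: "mirr (\<phi> m)" and w: "w \<in> gens T (Suc m) \<phi>"
  shows "restrict w {..<m} \<in> gens T m \<phi>" "w m \<in> ker T (\<phi> m) - pspan T m (restrict w {..<m})"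
proof -
  have ind: "\<phi> i dvd r i" if "\<And>i. i < Suc m \<Longrightarrow> r i \<in> P" "pcomb T (Suc m) w r = 0" "i < Suc m" for r i
    using w that by (auto simp: gens_def pindep_def)
  have pc: "pcomb T m (restrict w {..<m}) r = pcomb T m w r" for r by (rule pcomb_cong) auto
  have "pindep T m \<phi> (restrict w {..<m})"
    unfolding pindep_def pc
  proof (intro allI impI)
    fix r i assume r: "\<forall>i<m. r i \<in> P" "pcomb T m w r = 0" "i < m"
    have "pcomb T (Suc m) w (r(m := 0)) = pcomb T m w r"
      unfolding pcomb_Suc by (simp add: pcomb_def)
    hence z0: "pcomb T (Suc m) w (r(m := 0)) = 0" using r(2) by simp
    have "\<phi> i dvd (r(m := 0)) i"
      by (rule ind[OF _ z0]) (use r P_0 in \<open>auto simp: less_Suc_eq\<close>)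
    thus "\<phi> i dvd r i" using r by simp
  qed
  moreover have wk: "w i \<in> ker T (\<phi> i)" if "i < Suc m" for i using w that by (auto simp: gens_def)
  ultimately show "restrict w {..<m} \<in> gens T m \<phi>" by (auto simp: gens_def ker_def)
  have "w m \<notin> pspan T m (restrict w {..<m})"
  proof
    assume "w m \<in> pspan T m (restrict w {..<m})"
    then obtain r where r: "\<forall>i<m. r i \<in> P" "w m = pcomb T m w r" by (auto simp: pspan_def pc)
    \<comment> \<open>Membership in the span would amount to a relation with coefficient
      \<open>- 1\<close> at \<open>m\<close>, which \<open>\<phi> m\<close> cannot divide.\<close>
    have "pcomb T (Suc m) w (r(m := - 1)) = pcomb T m w r + pact (- 1) T (w m)"
      unfolding pcomb_Suc by (simp add: pcomb_def)
    also have "pact (- 1) T (w m) = - w m" using pact_diff[of 0 1 T "w m"] by simp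
    finally have z0: "pcomb T (Suc m) w (r(m := - 1)) = 0" by (simp only: r(2) right_minus)
    have rP: "(r(m := - 1)) i \<in> P" if "i < Suc m" for i
      using r that P_diff[OF P_0 P_1] by (auto simp: less_Suc_eq)
    have "\<phi> m dvd (r(m := - 1)) m" by (rule ind[OF rP z0]) simp_all
    hence "\<phi> m dvd 1" by simp
    hence "Polynomial.degree (\<phi> m) \<le> Polynomial.degree (1 :: 'a poly)" by (rule dvd_imp_degree_le) simp
    thus False using mirr_D(4)[OF p] by simp
  qed
  thus "w m \<in> ker T (\<phi> m) - pspan T m (restrict w {..<m})" using wk by simp
qed

text \<open>Generators are chosen one at a time: the next one is any vector of its kernel outside
  the span of the previous ones, and \<open>card_ker_inter_pspan\<close> counts the excluded
  vectors.\<close>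

lemma card_gens:
  assumes T: "T \<in> S" and \<phi>: "\<And>i. i < m \<Longrightarrow> mirr (\<phi> i)"
  shows "card (gens T m \<phi>) =
    (\<Prod>j<m. card (ker T (\<phi> j)) - q ^ (Polynomial.degree (\<phi> j) * card {i. i < j \<and> \<phi> i = \<phi> j}))"
  using \<phi>
proof (induction m)
  case 0
  have "gens T 0 \<phi> = {\<lambda>x. undefined}" by (auto simp: gens_def pindep_def)
  thus ?case by simp
next
  case (Suc m)
  have p: "mirr (\<phi> m)" using Suc.prems by simp
  have \<phi>: "mirr (\<phi> i)" if "i < m" for i using Suc.prems that by simp
  let ?A = "SIGMA v:gens T m \<phi>. ker T (\<phi> m) - pspan T m v"
  have "bij_betw (\<lambda>(v, u). v(m := u)) ?A (gens T (Suc m) \<phi>)"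
  proof (rule bij_betwI[where g = "\<lambda>w. (restrict w {..<m}, w m)"])
    show "(\<lambda>(v, u). v(m := u)) \<in> ?A \<rightarrow> gens T (Suc m) \<phi>" using gens_extend[where \<phi> = \<phi> and m = m, OF T p] by auto
    show "(\<lambda>w. (restrict w {..<m}, w m)) \<in> gens T (Suc m) \<phi> \<rightarrow> ?A" using gens_restrict[where \<phi> = \<phi> and m = m, OF T p] by auto
    show "(restrict ((\<lambda>(v, u). v(m := u)) x) {..<m}, ((\<lambda>(v, u). v(m := u)) x) m) = x" if "x \<in> ?A" for x
    proof -
      obtain v u where x: "x = (v, u)" by (cases x)
      hence "v \<in> {..<m} \<rightarrow>\<^sub>E V" using that by (auto simp: gens_def)
      hence "restrict (v(m := u)) {..<m} = v" by (auto simp: fun_eq_iff PiE_iff extensional_def)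
      thus ?thesis using x by simp
    qed
    show "(\<lambda>(v, u). v(m := u)) (restrict w {..<m}, w m) = w" if "w \<in> gens T (Suc m) \<phi>" for w
      using that by (auto simp: gens_def fun_eq_iff PiE_iff extensional_def)
  qed
  hence "card (gens T (Suc m) \<phi>) = card ?A" by (rule bij_betw_same_card[symmetric])
  also have "\<dots> = (\<Sum>v\<in>gens T m \<phi>. card (ker T (\<phi> m) - pspan T m v))"
    using finite_gens finite_ker by (intro card_SigmaI) auto
  also have "\<dots> = (\<Sum>v\<in>gens T m \<phi>. card (ker T (\<phi> m)) - q ^ (Polynomial.degree (\<phi> m) * card {i. i < m \<and> \<phi> i = \<phi> m}))"
  proof (rule sum.cong[OF refl])
    fix v assume v: "v \<in> gens T m \<phi>"
    have "card (ker T (\<phi> m) - pspan T m v) = card (ker T (\<phi> m)) - card (ker T (\<phi> m) \<inter> pspan T m v)"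
      by (rule card_Diff_subset_Int) (simp add: finite_ker)
    thus "card (ker T (\<phi> m) - pspan T m v) = card (ker T (\<phi> m)) - q ^ (Polynomial.degree (\<phi> m) * card {i. i < m \<and> \<phi> i = \<phi> m})"
      using card_ker_inter_pspan[OF T \<phi> p v] by simp
  qed
  also have "\<dots> = card (gens T m \<phi>) * (card (ker T (\<phi> m)) - q ^ (Polynomial.degree (\<phi> m) * card {i. i < m \<and> \<phi> i = \<phi> m}))"
    by simp
  finally show ?case using Suc.IH[OF \<phi>] by simp
qed

text \<open>Take the least \<open>k\<close> with \<open>?N \<le> ?Q ^ k\<close>. Every factor in the
  count of independent \<open>k\<close>-tuples is then positive, so such a tuple exists, and its
  \<open>?Q ^ k\<close> combinations fit into the kernel. This replaces a vector space structure
  over \<open>F[z]/(p)\<close>.\<close>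

lemma card_ker_power:
  assumes T: "T \<in> S" and p: "mirr p"
  shows "\<exists>k. card (ker T p) = (q ^ Polynomial.degree p) ^ k"
proof -
  let ?N = "card (ker T p)" and ?Q = "q ^ Polynomial.degree p"
  have Q2: "?Q \<ge> 2"
    using q_ge_2 mirr_D(4)[OF p] self_le_power[of q "Polynomial.degree p"] by linarith
  have "?N < 2 ^ ?N" by (rule less_exp)
  also have "\<dots> \<le> ?Q ^ ?N" using Q2 by (intro power_mono) auto
  finally have "?N \<le> ?Q ^ ?N" by simp
  hence ex: "\<exists>k. ?N \<le> ?Q ^ k" by blast
  define k where "k = (LEAST k. ?N \<le> ?Q ^ k)"
  have k: "?N \<le> ?Q ^ k" unfolding k_def using LeastI_ex[OF ex] .
  have less: "?Q ^ j < ?N" if "j < k" for j using not_less_Least[of j "\<lambda>k. ?N \<le> ?Q ^ k"] that by (auto simp: k_def)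
  have "card (gens T k (\<lambda>_. p)) = (\<Prod>j<k. ?N - ?Q ^ j)"
    using card_gens[OF T, of k "\<lambda>_. p"] p by (simp add: power_mult)
  also have "\<dots> > 0" using less by (intro prod_pos) auto
  finally obtain v where v: "v \<in> gens T k (\<lambda>_. p)" by (metis card.empty ex_in_conv less_irrefl)
  have "?Q ^ k = card (ker T p \<inter> pspan T k v)"
    using card_ker_inter_pspan[OF T _ p v] p by (simp add: power_mult)
  also have "\<dots> \<le> ?N" by (intro card_mono finite_ker) auto
  finally show ?thesis using k by (intro exI[of _ k]) simp
qed

end

section \<open>Sequences of products and the realisation of Gram matrices\<close>

context symplectic_group
begin

lemma S_funpow_V: "T \<in> S \<Longrightarrow> x \<in> V \<Longrightarrow> (T ^^ k) x \<in> V"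
  by (induction k) (auto simp: S_V)

lemma S_funpow_isometry: "T \<in> S \<Longrightarrow> x \<in> V \<Longrightarrow> y \<in> V \<Longrightarrow> \<omega> ((T ^^ k) x) ((T ^^ k) y) = \<omega> x y"
  by (induction k) (auto simp: S_isometry S_funpow_V)

lemma \<omega>_sym: "\<omega> x y = \<omega> y x"
  using \<omega>_antisym[of x y] by simp

text \<open>The product of \<open>T^k x\<close> with \<open>y\<close>; for negative \<open>k\<close>
  the power is moved to the other argument by isometry, so no inverse of \<open>T\<close> is
  needed.\<close>

definition form_seq :: "('v \<Rightarrow> 'v) \<Rightarrow> 'v \<Rightarrow> 'v \<Rightarrow> int \<Rightarrow> 'a" where
  "form_seq T x y k = (if k \<ge> 0 then \<omega> ((T ^^ nat k) x) y else \<omega> x ((T ^^ nat (- k)) y))"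

lemma form_seq_eq:
  assumes T: "T \<in> S" and x: "x \<in> V" and y: "y \<in> V"
  shows "\<omega> ((T ^^ a) x) ((T ^^ b) y) = form_seq T x y (int a - int b)"
proof (cases "a \<ge> b")
  case True
  hence "(T ^^ a) x = (T ^^ b) ((T ^^ (a - b)) x)" by (metis funpow_add le_add_diff_inverse o_apply)
  hence "\<omega> ((T ^^ a) x) ((T ^^ b) y) = \<omega> ((T ^^ (a - b)) x) y"
    using S_funpow_isometry[OF T S_funpow_V[OF T x] y] by simp
  moreover have "nat (int a - int b) = a - b" by simp
  ultimately show ?thesis using True by (simp add: form_seq_def)
next
  case False
  hence "(T ^^ b) y = (T ^^ a) ((T ^^ (b - a)) y)" by (metis funpow_add le_add_diff_inverse linear o_apply)
  hence "\<omega> ((T ^^ a) x) ((T ^^ b) y) = \<omega> x ((T ^^ (b - a)) y)"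
    using S_funpow_isometry[OF T x S_funpow_V[OF T y]] by simp
  moreover have "nat (- (int a - int b)) = b - a" by simp
  ultimately show ?thesis using False by (simp add: form_seq_def)
qed

lemma form_seq_in_F:
  assumes "T \<in> S" "x \<in> V" "y \<in> V"
  shows "form_seq T x y k \<in> F"
  using assms by (auto simp: form_seq_def intro!: \<omega>_in_F S_funpow_V)

lemma form_seq_uminus: "form_seq T x y \<circ> uminus = form_seq T y x"
  by (auto simp: form_seq_def fun_eq_iff \<omega>_sym)

lemma form_seq_0: "form_seq T x x 0 = 0"
  by (simp add: form_seq_def \<omega>_alternating)

lemma form_seq_rec:
  assumes T: "T \<in> S" and x: "x \<in> V" and y: "y \<in> V" and z: "pact p T x = 0"
  shows "fs.pact p shift (form_seq T x y) = 0"
proof -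
  have "fs.pact p shift (form_seq T x y) k = 0" for k
  proof -
    \<comment> \<open>The exponents \<open>s + M\<close> and \<open>N\<close> are nonnegative and
      differ by \<open>k + s\<close>, so the two-sided recurrence is evaluated with honest iterates
      of \<open>T\<close>.\<close>
    define N where "N = nat \<bar>k\<bar>"
    define M where "M = nat (k + int N)"
    have M: "k + int s = int (s + M) - int N" for s by (simp add: M_def N_def)
    have "fs.pact p shift (form_seq T x y) k = (\<Sum>s\<le>Polynomial.degree p. Polynomial.coeff p s * \<omega> ((T ^^ (s + M)) x) ((T ^^ N) y))"
      unfolding pact_shift M form_seq_eq[OF T x y] ..
    also have "\<dots> = \<omega> (pact p T ((T ^^ M) x)) ((T ^^ N) y)"
      by (simp add: pact_def \<omega>_sum_left \<omega>_scale_left funpow_add)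
    also have "pact p T ((T ^^ M) x) = 0"
      using pact_funpow[OF S_hom[OF T]] z module_hom.zero[OF hom_funpow[OF S_hom[OF T]]] by simp
    finally show ?thesis by (simp only: \<omega>_0_left)
  qed
  thus ?thesis by (simp add: fun_eq_iff)
qed

text \<open>Each \<open>f x\<close> is a vector \<open>e (h x)\<close> of its own plus a correction
  from the \<open>e'\<close>. Products with the \<open>e'\<close> read off coefficients, which gives
  independence, and the corrections produce the prescribed Gram matrix.\<close>

lemma orbit_nonempty:
  assumes J: "finite J" and n: "card J \<le> n"
    and e: "\<And>k. k < n \<Longrightarrow> e k \<in> V" "\<And>k. k < n \<Longrightarrow> e' k \<in> V"
    and ee: "\<And>k l. k < n \<Longrightarrow> l < n \<Longrightarrow> \<omega> (e k) (e l) = 0" "\<And>k l. k < n \<Longrightarrow> l < n \<Longrightarrow> \<omega> (e' k) (e' l) = 0"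
      "\<And>k l. k < n \<Longrightarrow> l < n \<Longrightarrow> \<omega> (e k) (e' l) = (if k = l then 1 else 0)"
    and G: "\<And>x y. x \<in> J \<Longrightarrow> y \<in> J \<Longrightarrow> G x y \<in> F" "\<And>x y. x \<in> J \<Longrightarrow> y \<in> J \<Longrightarrow> G x y = G y x" "\<And>x. x \<in> J \<Longrightarrow> G x x = 0"
  shows "orbit J G \<noteq> {}"
proof -
  obtain h where h: "bij_betw h J {0..<card J}" using ex_bij_betw_finite_nat[OF J] by blast
  have hn: "h x < n" if "x \<in> J" for x using bij_betw_apply[OF h that] n by simp
  have hinj: "h x = h y \<longleftrightarrow> x = y" if "x \<in> J" "y \<in> J" for x y
    using h that by (auto simp: bij_betw_def inj_on_def)
  \<comment> \<open>This is the strictly triangular half of \<open>G\<close> in the order given by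
    \<open>h\<close>; since \<open>G\<close> is symmetric with zero diagonal,
    \<open>c x y + c y x\<close> recovers \<open>G x y\<close>.\<close>
  define c where "c x z = (if h z < h x then G z x else 0)" for x z
  define f where "f = (\<lambda>x\<in>J. e (h x) + (\<Sum>z\<in>J. scale (c x z) (e' (h z))))"
  have cF: "c x z \<in> F" if "x \<in> J" "z \<in> J" for x z using that G(1) F_0 by (simp add: c_def)
  have fV: "f x \<in> V" if "x \<in> J" for x
    using that hn e cF by (auto simp: f_def intro!: V_add V_sum V_scale)
  have fe': "\<omega> (f x) (e' (h y)) = (if x = y then 1 else 0)" if "x \<in> J" "y \<in> J" for x y
    using that hn hinj ee by (simp add: f_def \<omega>_add_left \<omega>_sum_left \<omega>_scale_left)
  have fe: "\<omega> (f x) (e (h y)) = c x y" if "x \<in> J" "y \<in> J" for x y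
  proof -
    have "\<omega> (f x) (e (h y)) = (\<Sum>z\<in>J. c x z * \<omega> (e (h y)) (e' (h z)))"
      using that hn ee(1) by (simp add: f_def \<omega>_add_left \<omega>_sum_left \<omega>_scale_left \<omega>_sym[of "e' _"])
    also have "\<dots> = (\<Sum>z\<in>J. if y = z then c x z else 0)"
      using that hn hinj ee(3) by (intro sum.cong) auto
    finally show ?thesis using J that by simp
  qed
  have gr: "\<omega> (f x) (f y) = G x y" if xy: "x \<in> J" "y \<in> J" for x y
  proof -
    have "\<omega> (f x) (f y) = \<omega> (f x) (e (h y)) + (\<Sum>z\<in>J. c y z * \<omega> (f x) (e' (h z)))"
      unfolding f_def using xy by (simp add: \<omega>_add_right \<omega>_sum_right \<omega>_scale_right)
    also have "(\<Sum>z\<in>J. c y z * \<omega> (f x) (e' (h z))) = (\<Sum>z\<in>J. if x = z then c y z else 0)"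
      using xy fe' by (intro sum.cong) auto
    also have "\<dots> = c y x" using J xy by simp
    also have "\<omega> (f x) (e (h y)) = c x y" by (rule fe[OF xy])
    finally have "\<omega> (f x) (f y) = c x y + c y x" .
    moreover have "h x < h y \<or> h y < h x \<or> x = y" using hinj[OF xy] by linarith
    ultimately show ?thesis using G(2)[OF xy] G(3)[OF xy(1)] by (auto simp: c_def)
  qed
  have "indep J f"
    unfolding indep_def
  proof (intro ballI impI)
    fix a y assume a: "a \<in> J \<rightarrow> F" "comb J f a = 0" and y: "y \<in> J"
    have "0 = \<omega> (comb J f a) (e' (h y))" by (simp add: a)
    also have "\<dots> = (\<Sum>x\<in>J. if x = y then a x else 0)"
      unfolding \<omega>_comb_left using fe' y by (intro sum.cong) auto
    finally show "a y = 0" using J y by simp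
  qed
  moreover have "f \<in> J \<rightarrow>\<^sub>E V" using fV by (auto simp: f_def)
  ultimately have "f \<in> orbit J G" using gr by (simp add: orbit_def)
  thus ?thesis by blast
qed

end

context generators
begin

definition spin :: "('v \<Rightarrow> 'v) \<Rightarrow> (nat \<Rightarrow> 'v) \<Rightarrow> nat \<times> nat \<Rightarrow> 'v" where
  "spin T v = (\<lambda>(i, a)\<in>Idx. (T ^^ a) (v i))"

text \<open>The link between two counts: for fixed \<open>T\<close> these correspond to the tuples
  of independent generators, while for fixed \<open>f\<close> the last condition makes
  \<open>T\<close> a transporter from \<open>f\<close> to \<open>succ f\<close>.\<close>

definition families :: "('v \<Rightarrow> 'v) \<Rightarrow> (nat \<times> nat \<Rightarrow> 'v) set" where
  "families T = {f \<in> Idx \<rightarrow>\<^sub>E V. indep Idx f \<and> (\<forall>x\<in>Idx. T (f x) = succ f x)}"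

lemma pact_\<phi>:
  assumes "i < m"
  shows "pact (\<phi> i) T x = (\<Sum>s<d i. scale (Polynomial.coeff (\<phi> i) s) ((T ^^ s) x)) + (T ^^ d i) x"
proof -
  have "{..d i} = insert (d i) {..<d i}" by auto
  thus ?thesis using lead[OF assms] by (simp add: pact_def add.commute)
qed

lemma spin_succ:
  assumes T: "T \<in> S" and v: "\<And>i. i < m \<Longrightarrow> pact (\<phi> i) T (v i) = 0" and x: "x \<in> Idx"
  shows "T (spin T v x) = succ (spin T v) x"
proof -
  obtain i a where ia: "x = (i, a)" "i < m" "a < d i" using x by (cases x) (auto simp: Idx_iff)
  have sp: "spin T v (i, s) = (T ^^ s) (v i)" if "s < d i" for s
    using that ia by (simp add: spin_def Idx_iff)
  show ?thesis
  proof (cases "Suc a < d i")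
    case True
    thus ?thesis using ia by (simp add: succ_def Idx_iff sp)
  next
    case False
    hence a: "Suc a = d i" using ia by simp
    have "T (spin T v x) = (T ^^ d i) (v i)" using ia by (simp add: sp a[symmetric])
    also have "\<dots> = - (\<Sum>s<d i. scale (Polynomial.coeff (\<phi> i) s) ((T ^^ s) (v i)))"
      using v[OF ia(2)] unfolding pact_\<phi>[OF ia(2)] by (simp only: add_eq_0_iff)
    also have "\<dots> = succ (spin T v) x"
      using ia False by (simp add: succ_def Idx_iff sp)
    finally show ?thesis .
  qed
qed

lemma families_spin:
  assumes T: "T \<in> S" and f: "\<And>x. x \<in> Idx \<Longrightarrow> T (f x) = succ f x" and i: "i < m"
  shows "a < d i \<Longrightarrow> f (i, a) = (T ^^ a) (f (i, 0))" "pact (\<phi> i) T (f (i, 0)) = 0"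
proof -
  show *: "f (i, a) = (T ^^ a) (f (i, 0))" if "a < d i" for a
    using that
  proof (induction a)
    case (Suc a)
    have ia: "(i, a) \<in> Idx" using Suc.prems i by (simp add: Idx_iff)
    have "f (i, Suc a) = succ f (i, a)" using Suc.prems ia by (simp add: succ_def)
    also have "\<dots> = T (f (i, a))" using f[OF ia] by simp
    finally show ?case using Suc by simp
  qed simp
  define e where "e = d i - 1"
  have e: "d i = Suc e" using d_pos[OF i] by (simp add: e_def)
  have ie: "(i, e) \<in> Idx" using i e by (simp add: Idx_iff)
  have "(T ^^ d i) (f (i, 0)) = T (f (i, e))" using *[of e] e by simp
  also have "\<dots> = succ f (i, e)" by (rule f[OF ie])
  also have "\<dots> = - (\<Sum>s<d i. scale (Polynomial.coeff (\<phi> i) s) (f (i, s)))"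
    using ie e by (simp add: succ_def del: sum.lessThan_Suc)
  also have "(\<Sum>s<d i. scale (Polynomial.coeff (\<phi> i) s) (f (i, s))) = (\<Sum>s<d i. scale (Polynomial.coeff (\<phi> i) s) ((T ^^ s) (f (i, 0))))"
  proof (rule sum.cong[OF refl])
    fix s assume "s \<in> {..<d i}"
    thus "scale (Polynomial.coeff (\<phi> i) s) (f (i, s)) = scale (Polynomial.coeff (\<phi> i) s) ((T ^^ s) (f (i, 0)))"
      using *[of s] by simp
  qed
  finally show "pact (\<phi> i) T (f (i, 0)) = 0"
    unfolding pact_\<phi>[OF i] by (simp only: add_eq_0_iff)
qed

lemma comb_spin:
  assumes T: "T \<in> S"
  shows "comb Idx (spin T v) c = pcomb T m v (\<lambda>i. \<Sum>a<d i. Polynomial.monom (c (i, a)) a)"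
  unfolding comb_Idx pcomb_def
proof (rule sum.cong[OF refl])
  fix i assume "i \<in> {..<m}"
  hence "spin T v (i, a) = (T ^^ a) (v i)" if "a < d i" for a using that by (simp add: spin_def Idx_iff)
  thus "(\<Sum>a<d i. scale (c (i, a)) (spin T v (i, a))) = pact (\<Sum>a<d i. Polynomial.monom (c (i, a)) a) T (v i)"
    by (simp add: pact_sum pact_monom)
qed

text \<open>Reducing a coefficient modulo \<open>\<phi> i\<close> does not change its action on
  \<open>v i\<close>, so polynomial relations amount to \<open>F\<close>-linear relations among the
  powers below the degree.\<close>

lemma indep_spin_iff:
  assumes T: "T \<in> S" and v: "\<And>i. i < m \<Longrightarrow> pact (\<phi> i) T (v i) = 0"
  shows "indep Idx (spin T v) \<longleftrightarrow> pindep T m \<phi> v"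
proof
  assume L: "indep Idx (spin T v)"
  show "pindep T m \<phi> v" unfolding pindep_def
  proof (intro allI impI)
    fix r i assume r: "\<forall>i<m. r i \<in> P" "pcomb T m v r = 0" and i: "i < m"
    let ?r = "\<lambda>i. r i mod \<phi> i"
    let ?c = "\<lambda>(i, a). Polynomial.coeff (?r i) a"
    have small: "?r i \<in> small_polys (d i)" if "i < m" for i
      using mod_small mirr_D[OF mirr_\<phi>[OF that]] r(1) that by blast
    have "comb Idx (spin T v) ?c = pcomb T m v ?r"
      unfolding comb_spin[OF T] using small_polys_sum[OF small] by (intro pcomb_cong) auto
    also have "\<dots> = pcomb T m v r"
      unfolding pcomb_def using pact_mod[OF T v] by (intro sum.cong) auto
    finally have "comb Idx (spin T v) ?c = 0" using r by simp
    moreover have "?c \<in> Idx \<rightarrow> F"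
      using small by (auto simp: Idx_iff small_polys_def intro: P_coeff)
    ultimately have all: "\<forall>x\<in>Idx. ?c x = 0" using L unfolding indep_def by blast
    have "Polynomial.coeff (?r i) a = 0" if "a < d i" for a
      using bspec[OF all, of "(i, a)"] that i by (simp add: Idx_iff)
    moreover have "?r i = (\<Sum>a<d i. Polynomial.monom (Polynomial.coeff (?r i) a) a)" by (rule small_polys_sum[OF small[OF i]])
    ultimately have "?r i = 0" by (metis (no_types, lifting) lessThan_iff monom_eq_0_iff sum.neutral)
    thus "\<phi> i dvd r i" by auto
  qed
next
  assume R: "pindep T m \<phi> v"
  show "indep Idx (spin T v)" unfolding indep_def
  proof (intro ballI impI)
    fix c x assume c: "c \<in> Idx \<rightarrow> F" "comb Idx (spin T v) c = 0" and x: "x \<in> Idx"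
    let ?r = "\<lambda>i. \<Sum>a<d i. Polynomial.monom (c (i, a)) a"
    have small: "?r i \<in> small_polys (d i)" if "i < m" for i
      using c(1) that by (intro sum_monom_small) (auto simp: Idx_iff)
    have z: "pcomb T m v ?r = 0" using c(2) comb_spin[OF T] by simp
    have rP: "\<forall>i<m. ?r i \<in> P" using small by (auto simp: small_polys_def)
    have "\<forall>i<m. \<phi> i dvd ?r i"
      by (rule R[unfolded pindep_def, THEN spec[of _ ?r], THEN mp, OF rP, THEN mp, OF z])
    hence dvd: "\<phi> i dvd ?r i" if "i < m" for i using that by blast
    obtain i a where ia: "x = (i, a)" "i < m" "a < d i" using x by (cases x) (auto simp: Idx_iff)
    have "?r i = 0" by (rule small_dvd_imp_0[OF small dvd]) (use ia in auto)
    hence "Polynomial.coeff (?r i) a = 0" by simp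
    thus "c x = 0" unfolding coeff_sum_monom using ia by simp
  qed
qed

lemma card_families:
  assumes T: "T \<in> S"
  shows "card (families T) = card (gens T m \<phi>)"
proof -
  have "bij_betw (spin T) (gens T m \<phi>) (families T)"
  proof (rule bij_betwI[where g = "\<lambda>f. \<lambda>i\<in>{..<m}. f (i, 0)"])
    show "spin T \<in> gens T m \<phi> \<rightarrow> families T"
    proof
      fix v assume v: "v \<in> gens T m \<phi>"
      have k: "pact (\<phi> i) T (v i) = 0" "v i \<in> V" if "i < m" for i using v that by (auto simp: gens_def ker_def)
      have "spin T v \<in> Idx \<rightarrow>\<^sub>E V" using k S_funpow_V[OF T] by (auto simp: spin_def Idx_iff)
      moreover have "pindep T m \<phi> v" using v by (simp add: gens_def)
      hence "indep Idx (spin T v)" using indep_spin_iff[OF T k(1)] by blast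
      ultimately show "spin T v \<in> families T"
        unfolding families_def using spin_succ[OF T k(1)] by (intro CollectI conjI ballI)
    qed
    show "(\<lambda>f. \<lambda>i\<in>{..<m}. f (i, 0)) \<in> families T \<rightarrow> gens T m \<phi>"
    proof
      fix f assume f: "f \<in> families T"
      let ?v = "\<lambda>i\<in>{..<m}. f (i, 0)"
      have Tf: "\<And>x. x \<in> Idx \<Longrightarrow> T (f x) = succ f x" using f by (auto simp: families_def)
      have k: "pact (\<phi> i) T (?v i) = 0" if "i < m" for i using families_spin(2)[OF T Tf that] that by simp
      have fV: "?v i \<in> V" if "i < m" for i using f that d_pos[OF that] by (auto simp: families_def Idx_iff PiE_iff)
      have "indep Idx (spin T ?v) \<longleftrightarrow> indep Idx f"
      proof (rule indep_cong)
        fix x assume "x \<in> Idx"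
        then obtain i a where ia: "x = (i, a)" "i < m" "a < d i" by (cases x) (auto simp: Idx_iff)
        show "spin T ?v x = f x"
          using families_spin(1)[OF T Tf ia(2,3)] ia by (simp add: spin_def Idx_iff)
      qed
      moreover have "indep Idx f" using f by (simp add: families_def)
      ultimately have "pindep T m \<phi> ?v" using indep_spin_iff[OF T k] by blast
      moreover have "?v i \<in> ker T (\<phi> i)" if "i < m" for i unfolding ker_def using k[OF that] fV[OF that] by blast
      moreover have "?v \<in> {..<m} \<rightarrow>\<^sub>E V" using fV by auto
      ultimately show "?v \<in> gens T m \<phi>" unfolding gens_def by blast
    qed
    show "(\<lambda>i\<in>{..<m}. spin T v (i, 0)) = v" if "v \<in> gens T m \<phi>" for v
    proof
      fix i
      have "v i = undefined" if "\<not> i < m" using \<open>v \<in> gens T m \<phi>\<close> that by (auto simp: gens_def PiE_iff extensional_def)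
      thus "(\<lambda>i\<in>{..<m}. spin T v (i, 0)) i = v i" using d_pos by (simp add: spin_def Idx_iff)
    qed
    show "spin T (\<lambda>i\<in>{..<m}. f (i, 0)) = f" if f: "f \<in> families T" for f
    proof
      fix x :: "nat \<times> nat"
      have Tf: "\<And>x. x \<in> Idx \<Longrightarrow> T (f x) = succ f x" using f by (auto simp: families_def)
      obtain i a where x: "x = (i, a)" by (cases x)
      show "spin T (\<lambda>i\<in>{..<m}. f (i, 0)) x = f x"
      proof (cases "x \<in> Idx")
        case True
        thus ?thesis using families_spin(1)[OF T Tf, of i a] by (simp add: x spin_def Idx_iff)
      next
        case False
        hence "f x = undefined" using f unfolding families_def by (intro PiE_arb[of f Idx "\<lambda>_. V"]) auto
        thus ?thesis using False by (simp add: spin_def x)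
      qed
    qed
  qed
  thus ?thesis by (rule bij_betw_same_card[symmetric])
qed

lemma finite_gram_seqs: "finite (gram_seqs m \<phi>)"
proof -
  have fin: "finite (recs (\<phi> i))" if "i < m" for i
  proof (rule card_ge_0_finite)
    note D = mirr_D[OF mirr_\<phi>[OF that]]
    have "q ^ d i > 0" using q_ge_2 by (intro zero_less_power) linarith
    thus "card (recs (\<phi> i)) > 0" by (simp only: card_recs[OF D(2,3,6,4)])
  qed
  have sub: "seqs p r c \<subseteq> recs p" for p r c by (auto simp: seqs_def)
  have fins: "finite (seqs (\<phi> i) (\<phi> j) (i = j))" if "i < m" for i j
    by (rule finite_subset[OF sub fin[OF that]])
  have "finite {(i, j). i \<le> j \<and> j < m}"
    by (rule finite_subset[of _ "{..<m} \<times> {..<m}"]) auto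
  thus ?thesis unfolding gram_seqs_def
  proof (rule finite_PiE)
    fix x assume "x \<in> {(i, j). i \<le> j \<and> j < m}"
    then obtain i j where "x = (i, j)" "i < m" by auto
    thus "finite (case x of (i, j) \<Rightarrow> seqs (\<phi> i) (\<phi> j) (i = j))" using fins by simp
  qed
qed

text \<open>The products of \<open>f (i, k)\<close> with \<open>f (j, 0)\<close> for
  \<open>k < d i\<close> are a full window of the sequence \<open>b (i, j)\<close>.\<close>

lemma gram_determines:
  assumes b: "b \<in> gram_seqs m \<phi>" "b' \<in> gram_seqs m \<phi>"
    and f: "f \<in> orbit Idx (gram b)" "f \<in> orbit Idx (gram b')"
  shows "b = b'"
proof -
  have "b (i, j) = b' (i, j)" if ij: "i \<le> j" "j < m" for i j
  proof (rule recs_eqI)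
    have i: "i < m" using ij by simp
    show "poly (\<phi> i) 0 \<noteq> 0" "d i > 0" using mirr_D[OF mirr_\<phi>[OF i]] by auto
    show "b (i, j) \<in> recs (\<phi> i)" "b' (i, j) \<in> recs (\<phi> i)"
      using b ij by (force simp: gram_seqs_def PiE_iff seqs_def)+
    fix k assume k: "k < d i"
    have x: "(i, k) \<in> Idx" "(j, 0) \<in> Idx" using k i ij d_pos[of j] by (auto simp: Idx_iff)
    have "gram b (i, k) (j, 0) = gram b' (i, k) (j, 0)"
      using f x by (simp add: orbit_def)
    thus "b (i, j) (0 + int k) = b' (i, j) (0 + int k)" using ij by (simp add: gram_def two_sided_def)
  qed
  thus ?thesis using b unfolding gram_seqs_def
    by (intro PiE_ext[of b "{(i, j). i \<le> j \<and> j < m}" "\<lambda>(i, j). seqs (\<phi> i) (\<phi> j) (i = j)" b']) auto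
qed

lemma families_orbit:
  assumes T: "T \<in> S" and f: "f \<in> families T"
  shows "\<exists>b\<in>gram_seqs m \<phi>. f \<in> orbit Idx (gram b)"
proof -
  define v where "v i = f (i, 0)" for i
  have Tf: "\<And>x. x \<in> Idx \<Longrightarrow> T (f x) = succ f x" using f by (auto simp: families_def)
  have k: "pact (\<phi> i) T (v i) = 0" if "i < m" for i using families_spin(2)[OF T Tf that] by (simp add: v_def)
  have vV: "v i \<in> V" if "i < m" for i
    using f that d_pos[OF that] by (auto simp: v_def families_def Idx_iff PiE_iff)
  define b where "b = (\<lambda>(i, j)\<in>{(i, j). i \<le> j \<and> j < m}. form_seq T (v i) (v j))"
  have bb: "two_sided b i j = form_seq T (v i) (v j)" if "i < m" "j < m" for i j
    using that form_seq_uminus[of T "v j" "v i"] by (simp add: two_sided_def b_def)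
  have "form_seq T (v i) (v j) \<in> seqs (\<phi> i) (\<phi> j) (i = j)" if "i < m" "j < m" for i j
    using that form_seq_rec[OF T vV vV k, of i j] form_seq_rec[OF T vV vV k, of j i] form_seq_in_F[OF T vV vV]
    by (auto simp: seqs_def recs_def form_seq_uminus form_seq_0)
  hence "b \<in> gram_seqs m \<phi>" by (auto simp: b_def gram_seqs_def)
  moreover have "f \<in> orbit Idx (gram b)"
  proof -
    have "\<omega> (f (i, a)) (f (j, a')) = gram b (i, a) (j, a')" if "(i, a) \<in> Idx" "(j, a') \<in> Idx" for i a j a'
      using that families_spin(1)[OF T Tf, of i a] families_spin(1)[OF T Tf, of j a'] form_seq_eq[OF T vV vV, of i j a a']
      by (simp add: Idx_iff gram_def bb v_def)
    thus ?thesis using f by (auto simp: orbit_def families_def)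
  qed
  ultimately show ?thesis by blast
qed

text \<open>Pairs \<open>(f, T)\<close> with \<open>T\<close> carrying \<open>f\<close> to
  \<open>succ f\<close> are counted twice. Sorted by \<open>T\<close> they give independent
  generators; sorted by the Gram data \<open>b\<close> of \<open>f\<close>, each nonempty orbit
  contributes \<open>card S\<close> by \<open>sum_transporters\<close>.\<close>

theorem sum_card_gens:
  "(\<Sum>T\<in>S. card (gens T m \<phi>)) = card S * card {b \<in> gram_seqs m \<phi>. orbit Idx (gram b) \<noteq> {}}"
proof -
  let ?A = "\<lambda>b. SIGMA f:orbit Idx (gram b). {T\<in>S. \<forall>x\<in>Idx. T (f x) = succ f x}"
  have inf: "infinite (UNIV :: (nat \<times> nat) set)"
    by (simp add: finite_prod)
  have finfam: "finite (families T)" for T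
    unfolding families_def by (rule finite_subset[OF _ finite_PiE[of Idx "\<lambda>_. V"]]) (auto simp: finite_V finite_Idx)
  have "(\<Sum>T\<in>S. card (gens T m \<phi>)) = (\<Sum>T\<in>S. card (families T))"
    using card_families by simp
  also have "\<dots> = card (SIGMA T:S. families T)"
    using finite_S finfam by (subst card_SigmaI) auto
  also have "\<dots> = card ((\<lambda>(T, f). (f, T)) ` (SIGMA T:S. families T))"
    by (rule card_image[symmetric]) (auto simp: inj_on_def)
  also have "(\<lambda>(T, f). (f, T)) ` (SIGMA T:S. families T) = (\<Union>b\<in>gram_seqs m \<phi>. ?A b)"
  proof (intro equalityI subsetI)
    fix x assume "x \<in> (\<lambda>(T, f). (f, T)) ` (SIGMA T:S. families T)"
    then obtain T f where x: "x = (f, T)" "T \<in> S" "f \<in> families T" by auto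
    obtain b where "b \<in> gram_seqs m \<phi>" "f \<in> orbit Idx (gram b)" using families_orbit[OF x(2,3)] by (elim bexE)
    thus "x \<in> (\<Union>b\<in>gram_seqs m \<phi>. ?A b)" using x by (auto simp: families_def)
  next
    fix x assume "x \<in> (\<Union>b\<in>gram_seqs m \<phi>. ?A b)"
    then obtain b f T where x: "x = (f, T)" "f \<in> orbit Idx (gram b)" "T \<in> S" "\<forall>x\<in>Idx. T (f x) = succ f x" by auto
    hence "f \<in> families T" by (auto simp: families_def orbit_def)
    thus "x \<in> (\<lambda>(T, f). (f, T)) ` (SIGMA T:S. families T)"
      using x by (intro image_eqI[of _ _ "(T, f)"]) auto
  qed
  also have "card (\<Union>b\<in>gram_seqs m \<phi>. ?A b) = (\<Sum>b\<in>gram_seqs m \<phi>. card (?A b))"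
  proof (rule card_UN_disjoint)
    show "\<forall>b\<in>gram_seqs m \<phi>. finite (?A b)"
      using finite_orbit[OF finite_Idx] finite_S by auto
    show "\<forall>b\<in>gram_seqs m \<phi>. \<forall>b'\<in>gram_seqs m \<phi>. b \<noteq> b' \<longrightarrow> ?A b \<inter> ?A b' = {}"
    proof (intro ballI impI, rule ccontr)
      fix b b' assume b: "b \<in> gram_seqs m \<phi>" "b' \<in> gram_seqs m \<phi>" "b \<noteq> b'" and "?A b \<inter> ?A b' \<noteq> {}"
      then obtain f where "f \<in> orbit Idx (gram b)" "f \<in> orbit Idx (gram b')" by auto
      from gram_determines[OF b(1,2) this] b(3) show False by simp
    qed
  qed (rule finite_gram_seqs)
  also have "\<dots> = (\<Sum>b\<in>gram_seqs m \<phi>. if orbit Idx (gram b) = {} then 0 else card S)"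
  proof (rule sum.cong[OF refl])
    fix b assume b: "b \<in> gram_seqs m \<phi>"
    have "card (?A b) = (\<Sum>f\<in>orbit Idx (gram b). card {T\<in>S. \<forall>x\<in>Idx. T (f x) = succ f x})"
      using finite_orbit[OF finite_Idx] finite_S by (intro card_SigmaI) auto
    also have "\<dots> = (if orbit Idx (gram b) = {} then 0 else card S)"
      by (rule sum_transporters[OF inf finite_Idx succ_orbit[OF b]])
    finally show "card (?A b) = (if orbit Idx (gram b) = {} then 0 else card S)" .
  qed
  also have "\<dots> = (\<Sum>b\<in>{b \<in> gram_seqs m \<phi>. orbit Idx (gram b) \<noteq> {}}. card S)"
    by (rule sum.mono_neutral_cong_right) (auto simp: finite_gram_seqs)
  finally show ?thesis by simp
qed

lemma gram_alternating:
  assumes b: "b \<in> gram_seqs m \<phi>" and x: "x \<in> Idx" "y \<in> Idx"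
  shows "gram b x y \<in> F" "gram b x y = gram b y x" "gram b x x = 0"
proof -
  have i: "fst x < m" "fst y < m" using x by (auto simp: Idx_def)
  show "gram b x y \<in> F" "gram b x x = 0" using two_sided_props(3,4)[OF b] i by (simp_all add: gram_def)
  show "gram b x y = gram b y x"
    unfolding gram_def two_sided_props(2)[OF b i] by simp
qed

end

section \<open>Moebius inversion and moments\<close>

text \<open>For \<open>N = Q^a\<close> the summand is \<open>(-1)^k Q^(k(k-1)/2)\<close> times the
  Gaussian binomial of \<open>a\<close> over \<open>k\<close>. The identity is the analogue of the
  fact that a partial alternating sum of binomials of \<open>a\<close> is, up to sign, a binomial of
  \<open>a - 1\<close>.\<close>

lemma moebius_partial_sum:
  fixes Q N :: real
  assumes "Q > 1"
  shows "(\<Sum>k\<le>K. \<Prod>s<k. - (N - Q ^ s) / (Q ^ Suc s - 1)) = (\<Prod>s<K. - (N - Q ^ Suc s) / (Q ^ Suc s - 1))"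
proof (induction K)
  case (Suc K)
  let ?D = "\<Prod>s<K. Q ^ Suc s - 1"
  have nz: "Q ^ Suc s - 1 \<noteq> 0" for s
    using one_less_power[OF assms, of "Suc s"] by simp
  hence D: "?D \<noteq> 0" by simp
  have shift: "(\<Prod>s<Suc K. - (N - Q ^ s)) = - (N - 1) * (\<Prod>s<K. - (N - Q ^ Suc s))"
    by (subst prod.lessThan_Suc_shift) simp
  have "(\<Sum>k\<le>Suc K. \<Prod>s<k. - (N - Q ^ s) / (Q ^ Suc s - 1)) =
      (\<Prod>s<K. - (N - Q ^ Suc s)) / ?D + - (N - 1) * (\<Prod>s<K. - (N - Q ^ Suc s)) / (?D * (Q ^ Suc K - 1))"
    using Suc.IH shift by (simp add: prod_dividef del: power_Suc)
  also have "\<dots> = (\<Prod>s<K. - (N - Q ^ Suc s)) * (- (N - Q ^ Suc K)) / (?D * (Q ^ Suc K - 1))"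
    using D nz[of K] by (simp add: field_simps del: power_Suc)
  also have "\<dots> = (\<Prod>s<Suc K. - (N - Q ^ Suc s) / (Q ^ Suc s - 1))"
    by (simp add: prod_dividef del: power_Suc)
  finally show ?case .
qed simp

text \<open>Moebius inversion over the subspaces of a vector space with \<open>Q ^ a\<close> elements: all contributions
  except that of the zero space cancel.\<close>

lemma moebius_sum:
  fixes Q :: nat
  assumes Q: "Q > 1" and a: "a \<le> K"
  shows "(\<Sum>k\<le>K. (\<Prod>s<k. - 1 / (real Q ^ Suc s - 1)) * real (\<Prod>s<k. Q ^ a - Q ^ s)) = (if Q ^ a = 1 then 1 else 0)"
proof -
  have summand: "(\<Prod>s<k. - 1 / (real Q ^ Suc s - 1)) * real (\<Prod>s<k. Q ^ a - Q ^ s) =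
      (\<Prod>s<k. - (real Q ^ a - real Q ^ s) / (real Q ^ Suc s - 1))" for k
  \<comment> \<open>If \<open>a < k\<close>, the factor at \<open>s = a\<close> vanishes on both
    sides, so the truncated subtraction at larger \<open>s\<close> does no harm.\<close>
  proof (cases "a < k")
    case True
    hence "(\<Prod>s<k. Q ^ a - Q ^ s) = 0" "(\<Prod>s<k. - (real Q ^ a - real Q ^ s) / (real Q ^ Suc s - 1)) = 0"
      by (auto simp: prod_zero_iff simp del: power_Suc)
    thus ?thesis by (metis mult_zero_right of_nat_0)
  next
    case False
    have "real (\<Prod>s<k. Q ^ a - Q ^ s) = (\<Prod>s<k. real Q ^ a - real Q ^ s)"
      unfolding of_nat_prod
    proof (rule prod.cong[OF refl])
      fix s assume "s \<in> {..<k}"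
      hence "Q ^ s \<le> Q ^ a" using False Q by (intro power_increasing) auto
      thus "real (Q ^ a - Q ^ s) = real Q ^ a - real Q ^ s" by (simp add: of_nat_diff)
    qed
    hence "(\<Prod>s<k. - 1 / (real Q ^ Suc s - 1)) * real (\<Prod>s<k. Q ^ a - Q ^ s) =
        (\<Prod>s<k. - 1 / (real Q ^ Suc s - 1) * (real Q ^ a - real Q ^ s))"
      by (simp only: prod.distrib)
    also have "\<dots> = (\<Prod>s<k. - (real Q ^ a - real Q ^ s) / (real Q ^ Suc s - 1))"
      by (rule prod.cong[OF refl]) (simp only: times_divide_eq_left mult_minus_left mult_1_left)
    finally show ?thesis .
  qed
  have "(\<Sum>k\<le>K. (\<Prod>s<k. - 1 / (real Q ^ Suc s - 1)) * real (\<Prod>s<k. Q ^ a - Q ^ s)) =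
      (\<Prod>s<K. - (real Q ^ a - real Q ^ Suc s) / (real Q ^ Suc s - 1))"
    unfolding summand using Q by (intro moebius_partial_sum) simp
  also have "\<dots> = (if Q ^ a = 1 then 1 else 0)"
  \<comment> \<open>For \<open>a = 0\<close> every factor is 1. For \<open>a = Suc b\<close> the
    factor at \<open>s = b\<close> vanishes, and \<open>b < K\<close> by
    \<open>a \<le> K\<close>.\<close>
  proof (cases a)
    case 0
    have "- (real Q ^ a - real Q ^ Suc s) / (real Q ^ Suc s - 1) = 1" for s
    proof -
      have "real Q ^ Suc s > 1" using Q by (intro one_less_power) auto
      thus ?thesis using 0 by (simp del: power_Suc)
    qed
    thus ?thesis using 0 by simp
  next
    case (Suc b)
    hence "(\<Prod>s<K. - (real Q ^ a - real Q ^ Suc s) / (real Q ^ Suc s - 1)) = 0"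
      using a by (intro prod_zero bexI[of _ b]) auto
    moreover have "Q ^ a \<noteq> 1" using Q Suc one_less_power[of Q a] by auto
    ultimately show ?thesis by simp
  qed
  finally show ?thesis .
qed

lemma ex_enumeration_with_multiplicities:
  assumes "finite \<Phi>"
  shows "\<exists>(m::nat) \<phi>. \<phi> ` {..<m} \<subseteq> \<Phi> \<and> (\<forall>p\<in>\<Phi>. card {i. i < m \<and> \<phi> i = p} = k p)"
proof -
  define M where "M = (\<Sum>p\<in>\<Phi>. replicate_mset (k p) p)"
  obtain xs where xs: "mset xs = M" using ex_mset by blast
  have cnt: "count M p = (if p \<in> \<Phi> then k p else 0)" for p
    unfolding M_def count_sum using assms by simp
  have "card {i. i < length xs \<and> xs ! i = p} = k p" if "p \<in> \<Phi>" for p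
  proof -
    have "card {i. i < length xs \<and> xs ! i = p} = length (filter (\<lambda>x. x = p) xs)"
      by (simp add: length_filter_conv_card)
    also have "\<dots> = count (mset xs) p" by (induction xs) auto
    finally show ?thesis using cnt that xs by simp
  qed
  moreover have "(\<lambda>i. xs ! i) ` {..<length xs} \<subseteq> \<Phi>"
  proof
    fix p assume "p \<in> (\<lambda>i. xs ! i) ` {..<length xs}"
    hence "p \<in># M" using xs by auto
    thus "p \<in> \<Phi>" using cnt[of p] by (auto simp: count_greater_zero_iff[symmetric] simp del: count_greater_zero_iff split: if_splits)
  qed
  ultimately show ?thesis by blast
qed

context finite_subfield_2
begin

text \<open>With \<open>Q = q^(deg p)\<close> this is the Moebius value
  \<open>(-1)^k Q^(k(k-1)/2)\<close> of a \<open>k\<close>-dimensional space divided by the order of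
  \<open>GL_k(Q)\<close>; the division turns a count of independent tuples into a count of
  subspaces.\<close>

definition moebius_weight :: "'a poly \<Rightarrow> nat \<Rightarrow> real" where
  "moebius_weight p k = (\<Prod>s<k. - 1 / (real (q ^ Polynomial.degree p) ^ Suc s - 1))"

text \<open>The Moebius weight times the number of invariant alternating forms on \<open>k\<close>
  copies of \<open>F[z]/(p)\<close> when \<open>p\<close> is self-conjugate; otherwise the weight
  alone. It is the \<open>k\<close>-th term of the series belonging to \<open>p\<close>.\<close>

definition local_term :: "'a poly \<Rightarrow> nat \<Rightarrow> real" where
  "local_term p k = (\<Prod>s<k. - real (form_weight p s) / (real (q ^ Polynomial.degree p) ^ Suc s - 1))"

lemma local_term_eq: "moebius_weight p k * (\<Prod>s<k. real (form_weight p s)) = local_term p k"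
  unfolding moebius_weight_def local_term_def prod.distrib[symmetric]
  by (rule prod.cong) (simp_all del: power_Suc)

end

text \<open>The \<open>n\<close> hyperbolic pairs are the supply for \<open>orbit_nonempty\<close>:
  every alternating Gram matrix of size at most \<open>n\<close> is realised.\<close>

locale hyperbolic_group = symplectic_group scale F V \<omega> S
  for scale :: "'a::field \<Rightarrow> 'v::ab_group_add \<Rightarrow> 'v" and F :: "'a set" and V :: "'v set"
    and \<omega> :: "'v \<Rightarrow> 'v \<Rightarrow> 'a" and S :: "('v \<Rightarrow> 'v) set" +
  fixes n :: nat and e e' :: "nat \<Rightarrow> 'v"
  assumes e_V: "\<And>k. k < n \<Longrightarrow> e k \<in> V" "\<And>k. k < n \<Longrightarrow> e' k \<in> V"
    and e_e: "\<And>k l. k < n \<Longrightarrow> l < n \<Longrightarrow> \<omega> (e k) (e l) = 0"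
    and e'_e': "\<And>k l. k < n \<Longrightarrow> l < n \<Longrightarrow> \<omega> (e' k) (e' l) = 0"
    and e_e': "\<And>k l. k < n \<Longrightarrow> l < n \<Longrightarrow> \<omega> (e k) (e' l) = (if k = l then 1 else 0)"
    and S_nonempty: "S \<noteq> {}"
begin

definition moment :: "'a poly set \<Rightarrow> ('a poly \<Rightarrow> nat) \<Rightarrow> real" where
  "moment \<Phi> k = (\<Sum>T\<in>S. real (\<Prod>p\<in>\<Phi>. \<Prod>s<k p. card (ker T p) - (q ^ Polynomial.degree p) ^ s)) / real (card S)"

definition forms :: "'a poly set \<Rightarrow> ('a poly \<Rightarrow> nat) \<Rightarrow> real" where
  "forms \<Phi> k = (\<Prod>p\<in>\<Phi>. \<Prod>s<k p. real (form_weight p s))"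

lemma card_S_pos: "card S > 0"
  using S_nonempty finite_S by (simp add: card_gt_0_iff)

text \<open>The mean number of independent generating tuples equals the number of invariant alternating forms
  that occur as a Gram matrix, which is all of them once \<open>n\<close> is large.\<close>

lemma moment_bounds:
  assumes fin: "finite \<Phi>" and \<Phi>: "\<And>p. p \<in> \<Phi> \<Longrightarrow> mirr p"
    and conj: "\<And>p r. p \<in> \<Phi> \<Longrightarrow> r \<in> \<Phi> \<Longrightarrow> p = conjugate_poly r \<Longrightarrow> p = r"
  shows "0 \<le> moment \<Phi> k" "moment \<Phi> k \<le> forms \<Phi> k"
    "(\<Sum>p\<in>\<Phi>. Polynomial.degree p * k p) \<le> n \<Longrightarrow> moment \<Phi> k = forms \<Phi> k"
proof -
  obtain m and \<phi> :: "nat \<Rightarrow> 'a poly" where \<phi>: "\<phi> ` {..<m} \<subseteq> \<Phi>" "\<And>p. p \<in> \<Phi> \<Longrightarrow> card {i. i < m \<and> \<phi> i = p} = k p"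
    using ex_enumeration_with_multiplicities[OF fin, of k] by blast
  have m\<phi>: "mirr (\<phi> i)" "\<phi> i \<in> \<Phi>" if "i < m" for i using \<phi>(1) \<Phi> that by auto
  interpret generators scale F V \<omega> S m \<phi>
    by unfold_locales (rule m\<phi>)
  have gens: "card (gens T m \<phi>) = (\<Prod>p\<in>\<Phi>. \<Prod>s<k p. card (ker T p) - (q ^ Polynomial.degree p) ^ s)" if "T \<in> S" for T
  proof -
    have "card (gens T m \<phi>) = (\<Prod>j<m. card (ker T (\<phi> j)) - (q ^ Polynomial.degree (\<phi> j)) ^ card {i. i < j \<and> \<phi> i = \<phi> j})"
      using card_gens[OF that m\<phi>(1)] by (simp add: power_mult)
    also have "\<dots> = (\<Prod>p\<in>\<Phi>. \<Prod>s<card {i. i < m \<and> \<phi> i = p}. card (ker T p) - (q ^ Polynomial.degree p) ^ s)"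
      by (rule prod_by_value[OF fin \<phi>(1), where h = "\<lambda>p s. card (ker T p) - (q ^ Polynomial.degree p) ^ s"])
    also have "\<dots> = (\<Prod>p\<in>\<Phi>. \<Prod>s<k p. card (ker T p) - (q ^ Polynomial.degree p) ^ s)"
      by (intro prod.cong refl) (simp add: \<phi>(2))
    finally show ?thesis .
  qed
  let ?R = "{b \<in> gram_seqs m \<phi>. orbit Idx (gram b) \<noteq> {}}"
  have "(\<Sum>T\<in>S. real (\<Prod>p\<in>\<Phi>. \<Prod>s<k p. card (ker T p) - (q ^ Polynomial.degree p) ^ s)) = real (\<Sum>T\<in>S. card (gens T m \<phi>))"
    by (simp add: gens del: of_nat_prod)
  also have "\<dots> = real (card S) * real (card ?R)" unfolding sum_card_gens by simp
  finally have mom: "moment \<Phi> k = real (card ?R)" using card_S_pos by (simp add: moment_def)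
  have "card (gram_seqs m \<phi>) = (\<Prod>p\<in>\<Phi>. \<Prod>s<card {i. i < m \<and> \<phi> i = p}. form_weight p s)"
    by (rule card_gram_seqs[OF m\<phi>(1) conj[OF m\<phi>(2) m\<phi>(2)] fin \<phi>(1)])
  also have "\<dots> = (\<Prod>p\<in>\<Phi>. \<Prod>s<k p. form_weight p s)"
    by (intro prod.cong refl) (simp add: \<phi>(2))
  finally have forms: "forms \<Phi> k = real (card (gram_seqs m \<phi>))" by (simp add: forms_def)
  show "0 \<le> moment \<Phi> k" by (simp add: mom)
  show "moment \<Phi> k \<le> forms \<Phi> k"
    unfolding mom forms of_nat_le_iff by (rule card_mono[OF finite_gram_seqs]) auto
  assume le: "(\<Sum>p\<in>\<Phi>. Polynomial.degree p * k p) \<le> n"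
  \<comment> \<open>This is the dimension of the module whose forms are to be realised; once it is
    at most \<open>n\<close>, \<open>orbit_nonempty\<close> applies to every
    \<open>b\<close>.\<close>
  have "card Idx = (\<Sum>i<m. Polynomial.degree (\<phi> i))" by (rule card_Idx)
  also have "\<dots> = (\<Sum>p\<in>\<Phi>. \<Sum>i\<in>{i\<in>{..<m}. \<phi> i = p}. Polynomial.degree (\<phi> i))"
    by (rule sum.group[symmetric]) (use fin \<phi>(1) in auto)
  also have "\<dots> = (\<Sum>p\<in>\<Phi>. Polynomial.degree p * k p)"
    by (intro sum.cong refl) (simp add: \<phi>(2)[symmetric] mult.commute)
  finally have n: "card Idx \<le> n" using le by simp
  have "orbit Idx (gram b) \<noteq> {}" if "b \<in> gram_seqs m \<phi>" for b
    by (rule orbit_nonempty[OF finite_Idx n e_V e_e e'_e' e_e' gram_alternating(1)[OF that]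
          gram_alternating(2)[OF that] gram_alternating(3)[OF that]])
  hence "?R = gram_seqs m \<phi>" by auto
  thus "moment \<Phi> k = forms \<Phi> k" by (simp add: mom forms)
qed

definition avoiding :: "'a poly set \<Rightarrow> ('v \<Rightarrow> 'v) set" where
  "avoiding \<Phi> = {T \<in> S. \<forall>p\<in>\<Phi>. card (ker T p) = 1}"

text \<open>Moebius inversion is applied to every kernel separately; the product over
  \<open>\<Phi>\<close> of these sums is expanded into a sum over multiplicity functions and
  averaged over \<open>S\<close>.\<close>

lemma avoiding_eq_moments:
  assumes fin: "finite \<Phi>" and \<Phi>: "\<And>p. p \<in> \<Phi> \<Longrightarrow> mirr p" and K: "card V \<le> q ^ K"
  shows "real (card (avoiding \<Phi>)) / real (card S) =
    (\<Sum>k\<in>\<Phi> \<rightarrow>\<^sub>E {..K}. (\<Prod>p\<in>\<Phi>. moebius_weight p (k p)) * moment \<Phi> k)"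
proof -
  let ?Q = "\<lambda>p. q ^ Polynomial.degree p"
  let ?g = "\<lambda>T p k. real (\<Prod>s<k. card (ker T p) - ?Q p ^ s)"
  have ind: "(if T \<in> avoiding \<Phi> then 1 else 0) = (\<Sum>k\<in>\<Phi> \<rightarrow>\<^sub>E {..K}. \<Prod>p\<in>\<Phi>. moebius_weight p (k p) * ?g T p (k p))"
    if T: "T \<in> S" for T
  proof -
    have "(\<Sum>k\<le>K. moebius_weight p k * ?g T p k) = (if card (ker T p) = 1 then 1 else 0)" if p: "p \<in> \<Phi>" for p
    proof -
      obtain a where a: "card (ker T p) = ?Q p ^ a" using card_ker_power[OF T \<Phi>[OF p]] by blast
      have Q: "?Q p > 1" using q_ge_2 mirr_D(4)[OF \<Phi>[OF p]] by (intro one_less_power) auto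
      \<comment> \<open>The kernel has at most \<open>q ^ K\<close> elements, so its dimension
        \<open>a\<close> is at most \<open>K\<close> and the truncated inversion is exact.\<close>
      have "q ^ a \<le> ?Q p ^ a"
        using q_ge_2 mirr_D(4)[OF \<Phi>[OF p]] by (intro power_mono self_le_power) auto
      also have "\<dots> \<le> card V" unfolding a[symmetric] ker_def by (intro card_mono finite_V) auto
      also have "\<dots> \<le> q ^ K" by (rule K)
      finally have "a \<le> K" using q_ge_2 power_le_imp_le_exp[of q a K] by linarith
      from moebius_sum[OF Q this] show ?thesis by (simp add: moebius_weight_def a del: of_nat_prod power_Suc)
    qed
    hence "(\<Prod>p\<in>\<Phi>. \<Sum>k\<le>K. moebius_weight p k * ?g T p k) = (\<Prod>p\<in>\<Phi>. if card (ker T p) = 1 then 1 else 0)"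
      by (intro prod.cong) auto
    also have "\<dots> = (if T \<in> avoiding \<Phi> then 1 else 0)"
    proof (cases "\<forall>p\<in>\<Phi>. card (ker T p) = 1")
      case True
      thus ?thesis using T by (simp add: avoiding_def)
    next
      case False
      then obtain p where "p \<in> \<Phi>" "card (ker T p) \<noteq> 1" by blast
      hence "(\<Prod>p\<in>\<Phi>. if card (ker T p) = 1 then 1 else (0::real)) = 0"
        using fin by (intro prod_zero) auto
      thus ?thesis using False by (simp add: avoiding_def)
    qed
    finally show ?thesis
      using prod_sum_PiE[OF fin, of "\<lambda>_. {..K}" "\<lambda>p k. moebius_weight p k * ?g T p k"] by simp
  qed
  have "real (card (avoiding \<Phi>)) = (\<Sum>T\<in>S. if T \<in> avoiding \<Phi> then 1 else 0)"
    using finite_S by (simp add: sum.If_cases avoiding_def Int_def conj_assoc)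
  also have "\<dots> = (\<Sum>T\<in>S. \<Sum>k\<in>\<Phi> \<rightarrow>\<^sub>E {..K}. \<Prod>p\<in>\<Phi>. moebius_weight p (k p) * ?g T p (k p))"
    using ind by (rule sum.cong[OF refl])
  also have "\<dots> = (\<Sum>k\<in>\<Phi> \<rightarrow>\<^sub>E {..K}. \<Sum>T\<in>S. \<Prod>p\<in>\<Phi>. moebius_weight p (k p) * ?g T p (k p))"
    by (rule sum.swap)
  also have "\<dots> = (\<Sum>k\<in>\<Phi> \<rightarrow>\<^sub>E {..K}. (\<Prod>p\<in>\<Phi>. moebius_weight p (k p)) * moment \<Phi> k) * real (card S)"
    using card_S_pos unfolding sum_distrib_right moment_def
    by (intro sum.cong refl) (simp add: prod.distrib sum_distrib_left)
  finally show ?thesis using card_S_pos by (simp add: field_simps)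
qed

text \<open>Dominated convergence in finite form. For multiplicities up to \<open>L\<close> the
  moments equal the numbers of forms; the other terms are bounded by the same expressions in
  absolute value, and their sum is the difference of the two full products.\<close>

lemma avoiding_approx:
  assumes fin: "finite \<Phi>" and \<Phi>: "\<And>p. p \<in> \<Phi> \<Longrightarrow> mirr p"
    and conj: "\<And>p r. p \<in> \<Phi> \<Longrightarrow> r \<in> \<Phi> \<Longrightarrow> p = conjugate_poly r \<Longrightarrow> p = r"
    and K: "card V \<le> q ^ K" and L: "L \<le> K" "L * (\<Sum>p\<in>\<Phi>. Polynomial.degree p) \<le> n"
  shows "\<bar>real (card (avoiding \<Phi>)) / real (card S) - (\<Prod>p\<in>\<Phi>. \<Sum>k\<le>L. local_term p k)\<bar>
    \<le> (\<Prod>p\<in>\<Phi>. \<Sum>k\<le>K. \<bar>local_term p k\<bar>) - (\<Prod>p\<in>\<Phi>. \<Sum>k\<le>L. \<bar>local_term p k\<bar>)"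
proof -
  let ?A = "\<Phi> \<rightarrow>\<^sub>E {..K}" and ?B = "\<Phi> \<rightarrow>\<^sub>E {..L}"
  let ?w = "\<lambda>k. \<Prod>p\<in>\<Phi>. moebius_weight p (k p)" and ?t = "\<lambda>k. \<Prod>p\<in>\<Phi>. local_term p (k p)"
  have t: "?t k = ?w k * forms \<Phi> k" for k
    by (simp add: forms_def local_term_eq[symmetric] prod.distrib)
  have finA: "finite ?A" using fin by (intro finite_PiE) auto
  have sub: "?B \<subseteq> ?A" using L by (intro PiE_mono) auto
  have small: "?w k * moment \<Phi> k = ?t k" if "k \<in> ?B" for k
  proof -
    have "(\<Sum>p\<in>\<Phi>. Polynomial.degree p * k p) \<le> (\<Sum>p\<in>\<Phi>. Polynomial.degree p * L)"
      using that by (intro sum_mono mult_left_mono) auto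
    also have "\<dots> \<le> n" using L(2) by (simp add: sum_distrib_left mult.commute)
    finally show ?thesis using moment_bounds(3)[OF fin \<Phi> conj] t by simp
  qed
  have "real (card (avoiding \<Phi>)) / real (card S) = (\<Sum>k\<in>?A. ?w k * moment \<Phi> k)"
    by (rule avoiding_eq_moments[OF fin \<Phi> K])
  also have "\<dots> = (\<Sum>k\<in>?A - ?B. ?w k * moment \<Phi> k) + (\<Sum>k\<in>?B. ?w k * moment \<Phi> k)"
    by (rule sum.subset_diff[OF sub finA])
  also have "(\<Sum>k\<in>?B. ?w k * moment \<Phi> k) = (\<Sum>k\<in>?B. ?t k)"
    using small by (rule sum.cong[OF refl])
  also have "\<dots> = (\<Prod>p\<in>\<Phi>. \<Sum>k\<le>L. local_term p k)"
    using prod_sum_PiE[OF fin, of "\<lambda>_. {..L}" local_term] by simp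
  finally have "\<bar>real (card (avoiding \<Phi>)) / real (card S) - (\<Prod>p\<in>\<Phi>. \<Sum>k\<le>L. local_term p k)\<bar> =
      \<bar>\<Sum>k\<in>?A - ?B. ?w k * moment \<Phi> k\<bar>" by simp
  also have "\<dots> \<le> (\<Sum>k\<in>?A - ?B. \<bar>?w k * moment \<Phi> k\<bar>)" by (rule sum_abs)
  also have "\<dots> \<le> (\<Sum>k\<in>?A - ?B. \<bar>?t k\<bar>)"
  proof (rule sum_mono)
    fix k
    have "\<bar>?w k\<bar> * moment \<Phi> k \<le> \<bar>?w k\<bar> * forms \<Phi> k"
      using moment_bounds(2)[OF fin \<Phi> conj] by (intro mult_left_mono) auto
    moreover have "0 \<le> moment \<Phi> k" "0 \<le> forms \<Phi> k"
      using moment_bounds(1)[OF fin \<Phi> conj] by (auto simp: forms_def intro!: prod_nonneg)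
    ultimately show "\<bar>?w k * moment \<Phi> k\<bar> \<le> \<bar>?t k\<bar>" by (simp add: t abs_mult)
  qed
  also have "\<dots> = (\<Sum>k\<in>?A. \<bar>?t k\<bar>) - (\<Sum>k\<in>?B. \<bar>?t k\<bar>)"
    using sum.subset_diff[OF sub finA, of "\<lambda>k. \<bar>?t k\<bar>"] by simp
  also have "(\<Sum>k\<in>?A. \<bar>?t k\<bar>) = (\<Prod>p\<in>\<Phi>. \<Sum>k\<le>K. \<bar>local_term p k\<bar>)"
    using prod_sum_PiE[OF fin, of "\<lambda>_. {..K}" "\<lambda>p k. \<bar>local_term p k\<bar>"] by (simp add: abs_prod)
  also have "(\<Sum>k\<in>?B. \<bar>?t k\<bar>) = (\<Prod>p\<in>\<Phi>. \<Sum>k\<le>L. \<bar>local_term p k\<bar>)"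
    using prod_sum_PiE[OF fin, of "\<lambda>_. {..L}" "\<lambda>p k. \<bar>local_term p k\<bar>"] by (simp add: abs_prod)
  finally show ?thesis .
qed

end

section \<open>Euler's identities and the local factors\<close>

lemma summable_prod_of_ratios:
  fixes r :: "nat \<Rightarrow> real"
  assumes r: "r \<longlonglongrightarrow> l" and l: "\<bar>l\<bar> < 1"
  shows "summable (\<lambda>k. \<bar>\<Prod>s<k. r s\<bar>)"
proof -
  obtain c where c: "\<bar>l\<bar> < c" "c < 1" using dense[OF l] by blast
  have "(\<lambda>s. \<bar>r s\<bar>) \<longlonglongrightarrow> \<bar>l\<bar>" using r by (rule tendsto_rabs)
  hence "eventually (\<lambda>s. \<bar>r s\<bar> < c) sequentially" using c(1) by (rule order_tendstoD)
  then obtain N where N: "\<And>s. s \<ge> N \<Longrightarrow> \<bar>r s\<bar> < c" by (auto simp: eventually_at_top_linorder)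
  show ?thesis
  proof (rule summable_ratio_test[OF c(2)])
    fix k assume "k \<ge> N"
    hence "\<bar>r k\<bar> \<le> c" using N by fastforce
    hence "\<bar>\<Prod>s<k. r s\<bar> * \<bar>r k\<bar> \<le> \<bar>\<Prod>s<k. r s\<bar> * c" by (rule mult_left_mono) simp
    thus "norm \<bar>\<Prod>s<Suc k. r s\<bar> \<le> c * norm \<bar>\<Prod>s<k. r s\<bar>" by (simp add: abs_mult mult.commute)
  qed
qed

lemma power_series_along_geometric:
  fixes c :: "nat \<Rightarrow> real"
  assumes x: "x \<noteq> 0" and s: "summable (\<lambda>k. c k * x ^ k)" and p: "\<bar>p\<bar> < 1"
  shows "(\<lambda>N. \<Sum>k. c k * (x * p ^ N) ^ k) \<longlonglongrightarrow> c 0"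
proof -
  have "isCont (\<lambda>x. \<Sum>k. c k * x ^ k) 0"
    by (rule isCont_powser[OF s]) (use x in auto)
  moreover have "(\<lambda>N. x * p ^ N) \<longlonglongrightarrow> x * 0"
    by (intro tendsto_mult tendsto_const LIMSEQ_power_zero) (use p in auto)
  ultimately have "(\<lambda>N. \<Sum>k. c k * (x * p ^ N) ^ k) \<longlonglongrightarrow> (\<Sum>k. c k * 0 ^ k)"
    using isCont_tendsto_compose[of 0 "\<lambda>x. \<Sum>k. c k * x ^ k" "\<lambda>N. x * p ^ N"] by simp
  thus ?thesis by simp
qed

lemma power_Suc_ne_1:
  fixes p :: real assumes "\<bar>p\<bar> < 1" shows "1 - p ^ Suc s \<noteq> 0"
proof
  assume "1 - p ^ Suc s = 0"
  hence "\<bar>p\<bar> ^ Suc s = 1" by (simp add: power_abs[symmetric] del: power_Suc)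
  moreover have "\<bar>p\<bar> ^ Suc s < 1" using assms by (subst power_less_one_iff) auto
  ultimately show False by simp
qed

lemma power_Suc_tendsto_0:
  fixes p :: real assumes "\<bar>p\<bar> < 1" shows "(\<lambda>s. p ^ Suc s) \<longlonglongrightarrow> 0"
  by (rule LIMSEQ_Suc[OF LIMSEQ_power_zero]) (use assms in simp)

lemma sums_multiples_tail:
  fixes a :: "nat \<Rightarrow> real"
  assumes "summable a" and "\<And>k. b (Suc k) = x * a k" and "b 0 = 0"
  shows "suminf b = x * suminf a"
proof -
  have "(\<lambda>k. b (Suc k)) sums (x * suminf a)"
    unfolding assms(2) by (intro sums_mult summable_sums assms(1))
  hence "b sums (x * suminf a + b 0)" by (rule sums_Suc)
  thus ?thesis using assms(3) by (simp add: sums_iff)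
qed

text \<open>Writing \<open>Fn\<close> for the series as a function of \<open>x\<close>, the equation
  \<open>Fn y * (1 - y) = Fn (y * p)\<close> is iterated \<open>N\<close> times, and
  \<open>Fn (x * p ^ N)\<close> tends to 1.\<close>

lemma euler_reciprocal_product:
  fixes x p :: real
  assumes x: "\<bar>x\<bar> < 1" "x \<noteq> 0" and p: "\<bar>p\<bar> < 1"
  shows "summable (\<lambda>k. \<bar>\<Prod>s<k. x / (1 - p ^ Suc s)\<bar>)"
    and "(\<lambda>N. (\<Sum>k. \<Prod>s<k. x / (1 - p ^ Suc s)) * (\<Prod>i<N. 1 - x * p ^ i)) \<longlonglongrightarrow> 1"
proof -
  define c :: "nat \<Rightarrow> real" where "c k = (\<Prod>s<k. 1 / (1 - p ^ Suc s))" for k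
  have summand: "c k * y ^ k = (\<Prod>s<k. y / (1 - p ^ Suc s))" for k y
    by (simp add: c_def prod_dividef)
  have summ: "summable (\<lambda>k. \<bar>\<Prod>s<k. y / (1 - p ^ Suc s)\<bar>)" if "\<bar>y\<bar> < 1" for y
  proof (rule summable_prod_of_ratios)
    have "(\<lambda>s. y / (1 - p ^ Suc s)) \<longlonglongrightarrow> y / (1 - 0)"
      by (intro tendsto_intros power_Suc_tendsto_0[OF p]) simp
    thus "(\<lambda>s. y / (1 - p ^ Suc s)) \<longlonglongrightarrow> y" by simp
  qed (rule that)
  show "summable (\<lambda>k. \<bar>\<Prod>s<k. x / (1 - p ^ Suc s)\<bar>)" by (rule summ[OF x(1)])
  define Fn where "Fn y = (\<Sum>k. c k * y ^ k)" for y
  have sc: "summable (\<lambda>k. c k * y ^ k)" if "\<bar>y\<bar> < 1" for y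
    unfolding summand by (rule summable_rabs_cancel[OF summ[OF that]])
  have xp: "\<bar>x * p ^ N\<bar> < 1" for N
  proof -
    have "\<bar>p ^ N\<bar> \<le> 1" using p by (simp add: power_abs power_le_one)
    hence "\<bar>x\<bar> * \<bar>p ^ N\<bar> \<le> \<bar>x\<bar> * 1" by (intro mult_left_mono) auto
    thus ?thesis using x(1) unfolding abs_mult by linarith
  qed
  have step: "Fn y * (1 - y) = Fn (y * p)" if y: "\<bar>y\<bar> < 1" "\<bar>y * p\<bar> < 1" for y
  proof -
    have "Fn y - Fn (y * p) = (\<Sum>k. c k * y ^ k - c k * (y * p) ^ k)"
      unfolding Fn_def by (rule suminf_diff[OF sc[OF y(1)] sc[OF y(2)]])
    also have "\<dots> = y * (\<Sum>k. c k * y ^ k)"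
    proof (rule sums_multiples_tail[OF sc[OF y(1)]])
      fix k
      have "c (Suc k) * (1 - p ^ Suc k) = c k" using power_Suc_ne_1[OF p, of k] by (simp add: c_def del: power_Suc)
      hence "c (Suc k) * (1 - p ^ Suc k) * y ^ Suc k = c k * y ^ Suc k" by simp
      thus "c (Suc k) * y ^ Suc k - c (Suc k) * (y * p) ^ Suc k = y * (c k * y ^ k)"
        by (simp add: algebra_simps power_mult_distrib)
    qed simp
    finally show ?thesis by (simp add: Fn_def algebra_simps)
  qed
  have "Fn x * (\<Prod>i<N. 1 - x * p ^ i) = Fn (x * p ^ N)" for N
  proof (induction N)
    case (Suc N)
    have e: "x * p ^ Suc N = x * p ^ N * p" by simp
    have "Fn x * (\<Prod>i<Suc N. 1 - x * p ^ i) = Fn (x * p ^ N) * (1 - x * p ^ N)"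
      using Suc.IH by (simp add: mult.assoc[symmetric])
    also have "\<dots> = Fn (x * p ^ N * p)" by (rule step[OF xp xp[of "Suc N", unfolded e]])
    finally show ?case by (simp only: e)
  qed simp
  moreover have "(\<lambda>N. Fn (x * p ^ N)) \<longlonglongrightarrow> c 0"
    unfolding Fn_def by (rule power_series_along_geometric[OF x(2) sc[OF x(1)] p])
  moreover have "c 0 = 1" by (simp add: c_def)
  moreover have "Fn x = (\<Sum>k. \<Prod>s<k. x / (1 - p ^ Suc s))" unfolding Fn_def summand ..
  ultimately show "(\<lambda>N. (\<Sum>k. \<Prod>s<k. x / (1 - p ^ Suc s)) * (\<Prod>i<N. 1 - x * p ^ i)) \<longlonglongrightarrow> 1" by simp
qed

text \<open>Here the functional equation is \<open>Fn y = (1 + y) * Fn (y * p)\<close>; the extra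
  powers of \<open>p\<close> make the series converge for all arguments.\<close>

lemma euler_product:
  fixes x p :: real
  assumes x: "\<bar>x\<bar> < 1" "x \<noteq> 0" and p: "\<bar>p\<bar> < 1"
  shows "summable (\<lambda>k. \<bar>\<Prod>s<k. x * p ^ s / (1 - p ^ Suc s)\<bar>)"
    and "(\<lambda>N. \<Prod>i<N. 1 + x * p ^ i) \<longlonglongrightarrow> (\<Sum>k. \<Prod>s<k. x * p ^ s / (1 - p ^ Suc s))"
proof -
  define c :: "nat \<Rightarrow> real" where "c k = (\<Prod>s<k. p ^ s / (1 - p ^ Suc s))" for k
  have summand: "c k * y ^ k = (\<Prod>s<k. y * p ^ s / (1 - p ^ Suc s))" for k y
    by (simp add: c_def prod_dividef prod.distrib)
  have summ: "summable (\<lambda>k. \<bar>\<Prod>s<k. y * p ^ s / (1 - p ^ Suc s)\<bar>)" for y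
  proof (rule summable_prod_of_ratios)
    have "(\<lambda>s. y * p ^ s / (1 - p ^ Suc s)) \<longlonglongrightarrow> y * 0 / (1 - 0)"
      by (intro tendsto_intros power_Suc_tendsto_0[OF p] LIMSEQ_power_zero) (use p in auto)
    thus "(\<lambda>s. y * p ^ s / (1 - p ^ Suc s)) \<longlonglongrightarrow> 0" by simp
  qed simp
  show "summable (\<lambda>k. \<bar>\<Prod>s<k. x * p ^ s / (1 - p ^ Suc s)\<bar>)" by (rule summ)
  define Fn where "Fn y = (\<Sum>k. c k * y ^ k)" for y
  have sc: "summable (\<lambda>k. c k * y ^ k)" for y
    unfolding summand by (rule summable_rabs_cancel[OF summ])
  have step: "Fn y = (1 + y) * Fn (y * p)" for y
  proof -
    have "Fn y - Fn (y * p) = (\<Sum>k. c k * y ^ k - c k * (y * p) ^ k)"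
      unfolding Fn_def by (rule suminf_diff[OF sc sc])
    also have "\<dots> = y * (\<Sum>k. c k * (y * p) ^ k)"
    proof (rule sums_multiples_tail[OF sc])
      fix k
      have "c (Suc k) * (1 - p ^ Suc k) = c k * p ^ k" using power_Suc_ne_1[OF p, of k] by (simp add: c_def del: power_Suc)
      hence "c (Suc k) * (1 - p ^ Suc k) * y ^ Suc k = c k * p ^ k * y ^ Suc k" by simp
      thus "c (Suc k) * y ^ Suc k - c (Suc k) * (y * p) ^ Suc k = y * (c k * (y * p) ^ k)"
        by (simp add: algebra_simps power_mult_distrib)
    qed simp
    finally show ?thesis by (simp add: Fn_def algebra_simps)
  qed
  have "Fn x = (\<Prod>i<N. 1 + x * p ^ i) * Fn (x * p ^ N)" for N
  proof (induction N)
    case (Suc N)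
    thus ?case using step[of "x * p ^ N"] by (simp add: mult_ac)
  qed simp
  note eq = this
  have lim: "(\<lambda>N. Fn (x * p ^ N)) \<longlonglongrightarrow> 1"
  proof -
    have "(\<lambda>N. Fn (x * p ^ N)) \<longlonglongrightarrow> c 0"
      unfolding Fn_def by (rule power_series_along_geometric[OF x(2) sc p])
    thus ?thesis by (simp add: c_def)
  qed
  \<comment> \<open>The finite product is this quotient as soon as the denominator is nonzero, which
    holds eventually because it tends to 1.\<close>
  have "(\<lambda>N. Fn x / Fn (x * p ^ N)) \<longlonglongrightarrow> Fn x / 1"
    by (intro tendsto_divide tendsto_const lim) simp
  moreover have "eventually (\<lambda>N. Fn (x * p ^ N) \<noteq> 0) sequentially"
    using tendsto_imp_eventually_ne[OF lim] by simp
  hence "eventually (\<lambda>N. Fn x / Fn (x * p ^ N) = (\<Prod>i<N. 1 + x * p ^ i)) sequentially"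
    by eventually_elim (simp add: eq[symmetric] divide_eq_eq)
  ultimately have "(\<lambda>N. \<Prod>i<N. 1 + x * p ^ i) \<longlonglongrightarrow> Fn x / 1" by (rule Lim_transform_eventually)
  thus "(\<lambda>N. \<Prod>i<N. 1 + x * p ^ i) \<longlonglongrightarrow> (\<Sum>k. \<Prod>s<k. x * p ^ s / (1 - p ^ Suc s))"
    by (simp add: Fn_def summand)
qed

lemma exp_le_one_minus:
  fixes x :: real assumes "0 \<le> x" "x \<le> 1/2"
  shows "exp (- 2 * x) \<le> 1 - x"
proof -
  have "x * x \<le> x * (1/2)" using assms by (intro mult_left_mono) auto
  hence "- 2 * x \<le> - x - 2 * x\<^sup>2" by (simp add: power2_eq_square)
  also have "\<dots> \<le> ln (1 - x)" using assms by (rule ln_one_minus_pos_lower_bound)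
  finally have "exp (- 2 * x) \<le> exp (ln (1 - x))" by (simp only: exp_le_cancel_iff)
  thus ?thesis using assms by simp
qed

text \<open>The constant 4 is a factor 2 from \<open>exp_le_one_minus\<close> times a factor 2 from
  the geometric series with ratio at most 1/2.\<close>

lemma prod_one_minus_lower_bound:
  fixes z :: "nat \<Rightarrow> real"
  assumes z: "\<And>i. 0 \<le> z i" "\<And>i. z i \<le> y ^ Suc i" and y: "0 < y" "y \<le> 1/2"
  shows "exp (- 4 * y) \<le> (\<Prod>i<N. 1 - z i)"
proof -
  have half: "z i \<le> 1/2" for i
  proof -
    have "y ^ Suc i \<le> y ^ 1" using y by (intro power_decreasing) auto
    hence "y ^ Suc i \<le> y" unfolding power_one_right .
    thus ?thesis using z(2)[of i] y by linarith
  qed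
  have gs: "(\<Sum>i<N. y ^ i) \<le> 2"
  proof -
    have "(\<Sum>i<N. y ^ i) = (1 - y ^ N) / (1 - y)" using y by (simp add: sum_gp_strict)
    also have "\<dots> \<le> 1 / (1 - y)" using y by (intro divide_right_mono) auto
    also have "\<dots> \<le> 2" using y by (simp add: field_simps)
    finally show ?thesis .
  qed
  have "(\<Sum>i<N. z i) \<le> (\<Sum>i<N. y * y ^ i)" using z(2) by (intro sum_mono) simp
  also have "\<dots> = y * (\<Sum>i<N. y ^ i)" by (simp add: sum_distrib_left)
  also have "\<dots> \<le> y * 2" using gs y by (intro mult_left_mono) auto
  finally have le: "(\<Sum>i<N. z i) \<le> y * 2" .
  have "(\<Sum>i<N. - 2 * z i) = - 2 * (\<Sum>i<N. z i)" by (rule sum_distrib_left[symmetric])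
  hence "exp (- 4 * y) \<le> exp (\<Sum>i<N. - 2 * z i)" using le by simp
  also have "\<dots> = (\<Prod>i<N. exp (- 2 * z i))" by (simp add: exp_sum)
  also have "\<dots> \<le> (\<Prod>i<N. 1 - z i)" using exp_le_one_minus z(1) half by (intro prod_mono) auto
  finally show ?thesis .
qed

lemma prod_pos_one_minus_power:
  fixes z :: real assumes "\<bar>z\<bar> < 1" shows "(\<Prod>i<N. 1 - z ^ Suc i) \<noteq> 0"
  using power_Suc_ne_1[OF assms] by (simp del: power_Suc)

text \<open>The first \<open>2 * N\<close> factors are sorted by the parity of the exponent, and an
  even exponent is split by \<open>1 - z^(2m) = (1 - z^m) * (1 + z^m)\<close>.\<close>

lemma euler_odd_parts_finite:
  fixes z :: real
  shows "(\<Prod>i<2*N. 1 - z ^ Suc i) = (\<Prod>i<N. 1 - z ^ (2 * i + 1)) * ((\<Prod>i<N. 1 - z ^ Suc i) * (\<Prod>i<N. 1 + z ^ Suc i))"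
proof (induction N)
  case (Suc N)
  have "(\<Prod>i<2 * Suc N. 1 - z ^ Suc i) = (\<Prod>i<2*N. 1 - z ^ Suc i) * (1 - z ^ (2 * N + 1)) * (1 - z ^ (2 * N + 2))"
    by (simp del: power_Suc)
  also have "1 - z ^ (2 * N + 2) = (1 - z ^ Suc N) * (1 + z ^ Suc N)"
  proof -
    have "z ^ (2 * N + 2) = z ^ Suc N * z ^ Suc N" by (simp add: power_add[symmetric] mult_2 del: power_Suc)
    thus ?thesis by (simp add: algebra_simps del: power_Suc)
  qed
  finally have eq: "(\<Prod>i<2 * Suc N. 1 - z ^ Suc i) =
    (\<Prod>i<2*N. 1 - z ^ Suc i) * (1 - z ^ (2 * N + 1)) * ((1 - z ^ Suc N) * (1 + z ^ Suc N))" .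
  show ?case unfolding eq Suc.IH prod.lessThan_Suc by (simp only: mult_ac)
qed simp

lemma cancel_common_factor:
  fixes P c :: real assumes "P \<noteq> 0" "c \<noteq> 0"
  shows "a * P / (c * P) * c = a" "P * a / (c * P) * c = a"
  using assms by simp_all

text \<open>The identity of partitions into odd and into distinct parts. By the finite version the
  expression is a quotient of two partial products of the \<open>1 - z^i\<close>, which have the
  same nonzero limit.\<close>

lemma euler_odd_parts:
  fixes z :: real
  assumes z: "\<bar>z\<bar> < 1"
  shows "(\<lambda>N. (\<Prod>i<N. 1 - z ^ (2 * i + 1)) * (\<Prod>i<N. 1 + z ^ Suc i)) \<longlonglongrightarrow> 1"
proof (cases "z = 0")
  case False
  let ?a = "\<lambda>N. \<Prod>i<N. 1 - z ^ Suc i"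
  have lim: "convergent_prod (\<lambda>i. 1 + - (z ^ Suc i))"
  proof (rule summable_imp_convergent_prod_real)
    have "summable (\<lambda>i. \<bar>z\<bar> ^ Suc i)" using z by (subst summable_Suc_iff) (auto intro: summable_geometric)
    thus "summable (\<lambda>i. \<bar>- (z ^ Suc i)\<bar>)" by (simp add: power_abs del: power_Suc)
    show "- (z ^ Suc i) \<noteq> - 1" for i using power_Suc_ne_1[OF z, of i] by auto
  qed
  define a where "a = prodinf (\<lambda>i. 1 + - (z ^ Suc i))"
  have "(\<lambda>N. \<Prod>i\<le>N. 1 + - (z ^ Suc i)) \<longlonglongrightarrow> a"
    unfolding a_def by (rule convergent_prod_LIMSEQ[OF lim])
  hence a: "?a \<longlonglongrightarrow> a" using LIMSEQ_lessThan_iff_atMost[of "prod (\<lambda>i. 1 + - (z ^ Suc i))"] by simp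
  have "1 + - (z ^ Suc i) \<noteq> 0" for i using power_Suc_ne_1[OF z, of i] by simp
  hence a0: "a \<noteq> 0" unfolding a_def by (rule prodinf_nonzero[OF lim])
  have "(\<lambda>N. ?a (2 * N) / ?a N) \<longlonglongrightarrow> a / a"
  proof (intro tendsto_divide a a0)
    have "strict_mono (\<lambda>N::nat. 2 * N)" by (auto simp: strict_mono_def)
    from LIMSEQ_subseq_LIMSEQ[OF a this] show "(\<lambda>N. ?a (2 * N)) \<longlonglongrightarrow> a" by (simp add: o_def del: power_Suc)
  qed
  moreover have "?a (2 * N) / ?a N = (\<Prod>i<N. 1 - z ^ (2 * i + 1)) * (\<Prod>i<N. 1 + z ^ Suc i)" for N
    unfolding euler_odd_parts_finite using prod_pos_one_minus_power[OF z, of N] by (simp add: field_simps del: power_Suc)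
  ultimately show ?thesis using a0 by simp
qed simp

text \<open>In the next three lemmas the right-hand sides are the local factors of the limiting proportion:
  at \<open>z - 1\<close>, at a self-conjugate factor, and at a pair of conjugate factors.\<close>

lemma local_factor_unipotent:
  fixes y :: real
  assumes y: "0 < y" "y < 1"
  shows "summable (\<lambda>k. \<bar>\<Prod>s<k. - y / (1 - y ^ Suc s)\<bar>)"
    and "(\<lambda>N. \<Prod>i<N. 1 - y ^ (2 * i + 1)) \<longlonglongrightarrow> (\<Sum>k. \<Prod>s<k. - y / (1 - y ^ Suc s))"
proof -
  have a: "\<bar>- y\<bar> < 1" "- y \<noteq> 0" "\<bar>y\<bar> < 1" using y by auto
  note E = euler_reciprocal_product[OF a]
  show "summable (\<lambda>k. \<bar>\<Prod>s<k. - y / (1 - y ^ Suc s)\<bar>)" by (rule E(1))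
  let ?F = "\<Sum>k. \<Prod>s<k. - y / (1 - y ^ Suc s)"
  \<comment> \<open>Euler's series at \<open>x = - y\<close> with ratio \<open>y\<close> is the
    reciprocal of the product of the \<open>1 + y^i\<close>, and the odd parts identity turns that
    into the product over odd exponents.\<close>
  have 1: "(\<lambda>N. ?F * (\<Prod>i<N. 1 + y ^ Suc i)) \<longlonglongrightarrow> 1" using E(2) by simp
  have 2: "(\<lambda>N. (\<Prod>i<N. 1 - y ^ (2 * i + 1)) * (\<Prod>i<N. 1 + y ^ Suc i)) \<longlonglongrightarrow> 1" by (rule euler_odd_parts[OF a(3)])
  have pos: "(\<Prod>i<N. 1 + y ^ Suc i) > 0" for N using y by (intro prod_pos) (auto intro: add_pos_pos)
  have F0: "?F \<noteq> 0"
  proof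
    assume "?F = 0"
    hence "(\<lambda>N::nat. 0::real) \<longlonglongrightarrow> 1" using 1 by simp
    thus False by (simp add: LIMSEQ_const_iff)
  qed
  have "(\<lambda>N. (\<Prod>i<N. 1 - y ^ (2 * i + 1)) * (\<Prod>i<N. 1 + y ^ Suc i) / (?F * (\<Prod>i<N. 1 + y ^ Suc i)) * ?F) \<longlonglongrightarrow> 1 / 1 * ?F"
    by (intro tendsto_mult tendsto_divide 1 2 tendsto_const) simp
  moreover have "(\<Prod>i<N. 1 - y ^ (2 * i + 1)) * (\<Prod>i<N. 1 + y ^ Suc i) / (?F * (\<Prod>i<N. 1 + y ^ Suc i)) * ?F =
      (\<Prod>i<N. 1 - y ^ (2 * i + 1))" for N
    by (rule cancel_common_factor(1)[OF _ F0]) (use pos[of N] in linarith)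
  ultimately show "(\<lambda>N. \<Prod>i<N. 1 - y ^ (2 * i + 1)) \<longlonglongrightarrow> ?F" by simp
qed

lemma local_factor_unitary:
  fixes y :: real
  assumes y: "0 < y" "y < 1"
  shows "summable (\<lambda>k. \<bar>\<Prod>s<k. - y / (1 - (y\<^sup>2) ^ Suc s)\<bar>)"
    and "(\<lambda>N. \<Prod>i<N. 1 + (-1) ^ Suc i * y ^ Suc i) \<longlonglongrightarrow> (\<Sum>k. \<Prod>s<k. - y / (1 - (y\<^sup>2) ^ Suc s))"
proof -
  have a: "\<bar>- y\<bar> < 1" "- y \<noteq> 0" "\<bar>y\<^sup>2\<bar> < 1" using y by (auto simp: power_less_one_iff)
  note E = euler_reciprocal_product[OF a]
  show "summable (\<lambda>k. \<bar>\<Prod>s<k. - y / (1 - (y\<^sup>2) ^ Suc s)\<bar>)" by (rule E(1))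
  let ?F = "\<Sum>k. \<Prod>s<k. - y / (1 - (y\<^sup>2) ^ Suc s)"
  have m: "(- y) ^ k = (-1) ^ k * y ^ k" for k by (metis mult_minus1 power_mult_distrib)
  have 1: "(\<lambda>N. ?F * (\<Prod>i<N. 1 + y ^ (2 * i + 1))) \<longlonglongrightarrow> 1"
  proof -
    have "1 - - y * (y\<^sup>2) ^ i = 1 + y ^ (2 * i + 1)" for i by (simp add: power_mult)
    thus ?thesis using E(2) by (simp only:)
  qed
  \<comment> \<open>The odd parts identity is taken at \<open>- y\<close>: odd powers change sign,
    which produces the plus signs here and the alternating signs in the second product.\<close>
  have 2: "(\<lambda>N. (\<Prod>i<N. 1 + y ^ (2 * i + 1)) * (\<Prod>i<N. 1 + (-1) ^ Suc i * y ^ Suc i)) \<longlonglongrightarrow> 1"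
  proof -
    have "\<bar>- y\<bar> < 1" using a by simp
    moreover have "1 - (- y) ^ (2 * i + 1) = 1 + y ^ (2 * i + 1)" for i by simp
    moreover have "1 + (- y) ^ Suc i = 1 + (-1) ^ Suc i * y ^ Suc i" for i by (simp only: m)
    ultimately show ?thesis using euler_odd_parts[of "- y"] by (simp only:)
  qed
  have pos: "(\<Prod>i<N. 1 + y ^ (2 * i + 1)) > 0" for N using y by (intro prod_pos) (auto intro: add_pos_pos)
  have F0: "?F \<noteq> 0"
  proof
    assume "?F = 0"
    hence "(\<lambda>N::nat. 0::real) \<longlonglongrightarrow> 1" using 1 by simp
    thus False by (simp add: LIMSEQ_const_iff)
  qed
  have "(\<lambda>N. (\<Prod>i<N. 1 + y ^ (2 * i + 1)) * (\<Prod>i<N. 1 + (-1) ^ Suc i * y ^ Suc i) / (?F * (\<Prod>i<N. 1 + y ^ (2 * i + 1))) * ?F) \<longlonglongrightarrow> 1 / 1 * ?F"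
    by (intro tendsto_mult tendsto_divide 1 2 tendsto_const) simp
  moreover have "(\<Prod>i<N. 1 + y ^ (2 * i + 1)) * (\<Prod>i<N. 1 + (-1) ^ Suc i * y ^ Suc i) / (?F * (\<Prod>i<N. 1 + y ^ (2 * i + 1))) * ?F =
      (\<Prod>i<N. 1 + (-1) ^ Suc i * y ^ Suc i)" for N
    by (rule cancel_common_factor(2)[OF _ F0]) (use pos[of N] in linarith)
  ultimately show "(\<lambda>N. \<Prod>i<N. 1 + (-1) ^ Suc i * y ^ Suc i) \<longlonglongrightarrow> ?F" by simp
qed

lemma local_factor_linear:
  fixes y :: real
  assumes y: "0 < y" "y < 1"
  shows "summable (\<lambda>k. \<bar>\<Prod>s<k. - (y ^ Suc s) / (1 - y ^ Suc s)\<bar>)"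
    and "(\<lambda>N. \<Prod>i<N. 1 - y ^ Suc i) \<longlonglongrightarrow> (\<Sum>k. \<Prod>s<k. - (y ^ Suc s) / (1 - y ^ Suc s))"
proof -
  have a: "\<bar>- y\<bar> < 1" "- y \<noteq> 0" "\<bar>y\<bar> < 1" using y by auto
  note E = euler_product[OF a]
  show "summable (\<lambda>k. \<bar>\<Prod>s<k. - (y ^ Suc s) / (1 - y ^ Suc s)\<bar>)" using E(1) by simp
  show "(\<lambda>N. \<Prod>i<N. 1 - y ^ Suc i) \<longlonglongrightarrow> (\<Sum>k. \<Prod>s<k. - (y ^ Suc s) / (1 - y ^ Suc s))" using E(2) by simp
qed

text \<open>From below every factor is at least \<open>1 - y ^ Suc i\<close>. From above, each
  factor larger than 1 is absorbed by the smaller factor before it, so factors are taken in pairs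
  and an unpaired last one is below 1.\<close>

lemma unitary_prod_bounds:
  fixes y :: real
  assumes y: "0 < y" "y \<le> 1/2"
  shows "exp (- 4 * y) \<le> (\<Prod>i<N. 1 + (-1) ^ Suc i * y ^ Suc i)"
    and "(\<Prod>i<N. 1 + (-1) ^ Suc i * y ^ Suc i) \<le> 1"
proof -
  have yi: "y ^ Suc i < 1" for i
    using y by (subst power_less_one_iff) auto
  have "exp (- 4 * y) \<le> (\<Prod>i<N. 1 - y ^ Suc i)"
    by (rule prod_one_minus_lower_bound) (use y in auto)
  also have "\<dots> \<le> (\<Prod>i<N. 1 + (-1) ^ Suc i * y ^ Suc i)"
  proof (rule prod_mono)
    fix i
    have "y ^ Suc i \<ge> 0" using y by simp
    moreover have "(-1::real) ^ Suc i = 1 \<or> (-1::real) ^ Suc i = - 1" by (metis neg_one_even_power neg_one_odd_power)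
    ultimately show "0 \<le> 1 - y ^ Suc i \<and> 1 - y ^ Suc i \<le> 1 + (-1) ^ Suc i * y ^ Suc i"
      using yi[of i] by auto
  qed
  finally show "exp (- 4 * y) \<le> (\<Prod>i<N. 1 + (-1) ^ Suc i * y ^ Suc i)" .
  let ?f = "\<lambda>i. 1 + (-1) ^ Suc i * y ^ Suc i"
  have nonneg: "0 \<le> ?f i" for i
  proof -
    have "y ^ Suc i \<ge> 0" using y by simp
    moreover have "(-1::real) ^ Suc i = 1 \<or> (-1::real) ^ Suc i = - 1" by (metis neg_one_even_power neg_one_odd_power)
    ultimately show ?thesis using yi[of i] by auto
  qed
  have even: "(\<Prod>i<2*M. ?f i) \<le> 1 \<and> 0 \<le> (\<Prod>i<2*M. ?f i)" for M
  proof (induction M)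
    case (Suc M)
    let ?u = "y ^ (2 * M + 1)"
    have u: "0 \<le> ?u" "0 \<le> y" "y \<le> 1" using y by auto
    have "?f (2*M) = 1 - ?u" "?f (2*M+1) = 1 + ?u * y" by (simp_all add: power_add)
    hence "?f (2*M) * ?f (2*M+1) = (1 - ?u) * (1 + ?u * y)" by simp
    also have "\<dots> \<le> (1 - ?u) * (1 + ?u * 1)"
      using u yi[of "2*M"] by (intro mult_left_mono add_left_mono) auto
    also have "\<dots> = 1 - ?u * ?u" by (simp add: algebra_simps)
    also have "\<dots> \<le> 1" by simp
    finally have le: "?f (2*M) * ?f (2*M+1) \<le> 1" .
    have "(\<Prod>i<2*Suc M. ?f i) = (\<Prod>i<2*M. ?f i) * (?f (2*M) * ?f (2*M+1))"
      by (simp add: mult.assoc del: power_Suc)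
    also have "\<dots> \<le> 1 * 1"
      by (rule mult_mono[OF conjunct1[OF Suc.IH] le _ mult_nonneg_nonneg[OF nonneg nonneg]]) simp
    finally have "(\<Prod>i<2*Suc M. ?f i) \<le> 1" by (simp only: mult_1)
    moreover have "0 \<le> (\<Prod>i<2*Suc M. ?f i)" by (rule prod_nonneg) (rule nonneg)
    ultimately show ?case by blast
  qed simp
  show "(\<Prod>i<N. ?f i) \<le> 1"
  proof (cases "even N")
    case True
    then obtain M where "N = 2 * M" by blast
    thus ?thesis using even[of M] by simp
  next
    case False
    then obtain M where M: "N = 2 * M + 1" by (elim oddE)
    have "?f (2*M) \<le> 1" using y by simp
    hence "(\<Prod>i<2*M. ?f i) * ?f (2*M) \<le> 1 * 1"
      by (rule mult_mono[OF conjunct1[OF even] _ _ nonneg]) simp_all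
    thus ?thesis by (simp add: M)
  qed
qed

section \<open>Symplectic matrices\<close>

context symplectic_group
begin

text \<open>Up to a scalar and a power of \<open>T\<close>, the adjoint of \<open>p(T)\<close> is
  the conjugate polynomial in \<open>T\<close>. If the latter is injective, it is onto
  \<open>V\<close>, and a vector of \<open>ker T p\<close> is orthogonal to its image.\<close>

lemma ker_conjugate_trivial:
  assumes T: "T \<in> S" and p: "mirr p" and k: "ker T (conjugate_poly p) = {0}"
  shows "ker T p = {0}"
proof -
  let ?c = "conjugate_poly p" and ?d = "Polynomial.degree p"
  have cV: "pact ?c T x \<in> V" if "x \<in> V" for x
    using pact_in_V[OF S_V[OF T] conjugate_props(4)[OF p] that] .
  have "inj_on (pact ?c T) V"
  proof
    fix x y assume xy: "x \<in> V" "y \<in> V" "pact ?c T x = pact ?c T y"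
    have "x - y \<in> ker T ?c"
      using xy V_diff by (simp add: ker_def module_hom.diff[OF hom_pact[OF S_hom[OF T]]])
    thus "x = y" using k by simp
  qed
  hence surj: "pact ?c T ` V = V" using endo_inj_surj[OF finite_V] cV by blast
  have "x = 0" if x: "x \<in> ker T p" for x
  proof (rule \<omega>_nondegenerate)
    show xV: "x \<in> V" using x by (simp add: ker_def)
    fix z assume "z \<in> V"
    then obtain y where y: "y \<in> V" "z = pact ?c T y" using surj by blast
    have deg: "Polynomial.degree (reflect_poly p) = ?d"
      using mirr_D(6)[OF p] by (simp add: poly_0_coeff_0)
    have "\<omega> x (pact (reflect_poly p) T y) = (\<Sum>k\<le>?d. Polynomial.coeff p (?d - k) * \<omega> x ((T ^^ k) y))"
      unfolding pact_def deg \<omega>_sum_right \<omega>_scale_right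
      by (intro sum.cong refl) (auto simp: coeff_reflect_poly)
    also have "\<dots> = (\<Sum>k\<le>?d. Polynomial.coeff p k * \<omega> x ((T ^^ (?d - k)) y))"
      by (rule sum.reindex_bij_witness[of _ "\<lambda>k. ?d - k" "\<lambda>k. ?d - k"]) auto
    also have "\<dots> = (\<Sum>k\<le>?d. Polynomial.coeff p k * \<omega> ((T ^^ k) x) ((T ^^ ?d) y))"
    proof (intro sum.cong refl arg_cong[of _ _ "(*) _"])
      fix k assume "k \<in> {..?d}"
      hence "(T ^^ ?d) y = (T ^^ k) ((T ^^ (?d - k)) y)" by (metis atMost_iff funpow_add le_add_diff_inverse o_apply)
      thus "\<omega> x ((T ^^ (?d - k)) y) = \<omega> ((T ^^ k) x) ((T ^^ ?d) y)"
        using S_funpow_isometry[OF T xV S_funpow_V[OF T y(1)]] by simp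
    qed
    also have "\<dots> = \<omega> (pact p T x) ((T ^^ ?d) y)"
      by (simp add: pact_def \<omega>_sum_left \<omega>_scale_left)
    also have "\<dots> = 0" using x by (simp add: ker_def)
    finally show "\<omega> x z = 0" unfolding y conjugate_poly_def pact_smult \<omega>_scale_right by simp
  qed
  moreover have "0 \<in> ker T p" using V_0 pact_0_right[OF T] by (simp add: ker_def)
  ultimately show ?thesis by blast
qed

end

section \<open>Matrices as operators on functions\<close>

definition unit_fn :: "nat \<Rightarrow> nat \<Rightarrow> 'a::field" where
  "unit_fn k = (\<lambda>i. if i = k then 1 else 0)"

text \<open>Column vectors are functions that vanish from \<open>N\<close> on, so all dimensions
  live in one vector space type; the vectors with entries in \<open>F\<close> form the finite subset
  needed for \<open>V\<close>.\<close>

definition vecs :: "'a::field set \<Rightarrow> nat \<Rightarrow> (nat \<Rightarrow> 'a) set" where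
  "vecs F N = {x. (\<forall>i<N. x i \<in> F) \<and> (\<forall>i\<ge>N. x i = 0)}"

definition mat_act :: "'a::field mat \<Rightarrow> (nat \<Rightarrow> 'a) \<Rightarrow> nat \<Rightarrow> 'a" where
  "mat_act A x = (\<lambda>i. if i < dim_row A then \<Sum>j<dim_col A. A $$ (i, j) * x j else 0)"

definition sform :: "nat \<Rightarrow> (nat \<Rightarrow> 'a::field) \<Rightarrow> (nat \<Rightarrow> 'a) \<Rightarrow> 'a" where
  "sform n x y = (\<Sum>i<n. x i * y (n + i) - x (n + i) * y i)"

lemma sum_split_at: "(\<Sum>k<n + m. f k) = (\<Sum>k<n. f k) + (\<Sum>k<m. f (n + k) :: 'b::comm_monoid_add)"
  for n m :: nat
  by (induction m) (auto simp: add.assoc)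

lemma sform_symplectic_form:
  "sform n x y = (\<Sum>k<2*n. \<Sum>l<2*n. x k * symplectic_form n $$ (k, l) * y l)"
proof -
  have J: "symplectic_form n $$ (k, l) = (if k < n then (if l = n + k then 1 else 0) else (if k = n + l then - 1 else 0))"
    if "k < 2*n" "l < 2*n" for k l
    using that by (auto simp: symplectic_form_def)
  have "(\<Sum>l<2*n. x k * symplectic_form n $$ (k, l) * y l) = (if k < n then x k * y (n + k) else - (x k * y (k - n)))"
    if k: "k < 2*n" for k
  proof (cases "k < n")
    case True
    have "(\<Sum>l<2*n. x k * symplectic_form n $$ (k, l) * y l) = (\<Sum>l<2*n. if l = n + k then x k * y l else 0)"
      using True k by (intro sum.cong) (auto simp: J)
    thus ?thesis using True by simp
  next
    case False
    have "(\<Sum>l<2*n. x k * symplectic_form n $$ (k, l) * y l) = (\<Sum>l<2*n. if l = k - n then - (x k * y l) else 0)"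
      using False k by (intro sum.cong) (auto simp: J)
    thus ?thesis using False k by simp
  qed
  hence "(\<Sum>k<2*n. \<Sum>l<2*n. x k * symplectic_form n $$ (k, l) * y l) = (\<Sum>k<n+n. if k < n then x k * y (n + k) else - (x k * y (k - n)))"
    by (intro sum.cong) auto
  thus ?thesis unfolding sum_split_at by (simp add: sform_def sum_subtractf sum_negf)
qed

lemma mat_act_unit:
  assumes "A \<in> carrier_mat N N" "j < N"
  shows "mat_act A (unit_fn j) = (\<lambda>i. if i < N then A $$ (i, j) else 0)"
proof
  fix i
  have "(\<Sum>k<N. A $$ (i, k) * unit_fn j k) = (\<Sum>k<N. if k = j then A $$ (i, k) else 0)"
    by (intro sum.cong) (auto simp: unit_fn_def)
  thus "mat_act A (unit_fn j) i = (if i < N then A $$ (i, j) else 0)"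
    using assms by (simp add: mat_act_def)
qed

lemma mat_act_inj:
  assumes A: "A \<in> carrier_mat N N" and B: "B \<in> carrier_mat N N"
    and eq: "\<And>j. j < N \<Longrightarrow> mat_act A (unit_fn j) = mat_act B (unit_fn j)"
  shows "A = B"
proof (rule eq_matI)
  fix i j assume "i < dim_row B" "j < dim_col B"
  hence ij: "i < N" "j < N" using B by auto
  show "A $$ (i, j) = B $$ (i, j)"
    using fun_cong[OF eq[OF ij(2)], of i] ij by (simp add: mat_act_unit[OF A] mat_act_unit[OF B])
qed (use A B in auto)

lemma mat_act_mult:
  assumes A: "A \<in> carrier_mat N N" and B: "B \<in> carrier_mat N N"
  shows "mat_act (A * B) = mat_act A \<circ> mat_act B"
proof (intro ext)
  fix x i
  show "mat_act (A * B) x i = (mat_act A \<circ> mat_act B) x i"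
  proof (cases "i < N")
    case True
    have "mat_act (A * B) x i = (\<Sum>j<N. (\<Sum>k<N. A $$ (i, k) * B $$ (k, j)) * x j)"
      using A B True by (simp add: mat_act_def scalar_prod_def lessThan_atLeast0)
    also have "\<dots> = (\<Sum>j<N. \<Sum>k<N. A $$ (i, k) * (B $$ (k, j) * x j))"
      by (simp add: sum_distrib_right mult.assoc)
    also have "\<dots> = (\<Sum>k<N. \<Sum>j<N. A $$ (i, k) * (B $$ (k, j) * x j))" by (rule sum.swap)
    also have "\<dots> = (mat_act A \<circ> mat_act B) x i"
      using A B True by (simp add: mat_act_def sum_distrib_left)
    finally show ?thesis .
  qed (use A B in \<open>simp add: mat_act_def\<close>)
qed

lemma module_hom_mat_act: "module_hom fscale fscale (mat_act A)"
proof -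
  have "mat_act A (x + y) = mat_act A x + mat_act A y" for x y
    by (auto simp: mat_act_def fun_eq_iff distrib_left sum.distrib)
  moreover have "mat_act A (fscale c x) = fscale c (mat_act A x)" for c x
    by (auto simp: mat_act_def fun_eq_iff sum_distrib_left mult_ac)
  ultimately show ?thesis by (simp add: module_hom_iff fs.module_axioms)
qed

lemma unit_expansion:
  assumes "\<And>i. i \<ge> N \<Longrightarrow> x i = 0"
  shows "x = (\<Sum>j<N. fscale (x j) (unit_fn j))"
proof
  fix i
  have "(\<Sum>j<N. fscale (x j) (unit_fn j) i) = (\<Sum>j<N. if i = j then x j else 0)"
    by (intro sum.cong) (auto simp: unit_fn_def)
  thus "x i = (\<Sum>j<N. fscale (x j) (unit_fn j)) i"
    using assms[of i] by (simp add: sum_fun_apply)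
qed

lemma symplectic_form_carrier: "(symplectic_form n :: 'a::field mat) \<in> carrier_mat (2*n) (2*n)"
  unfolding symplectic_form_def mult_2 by (rule four_block_carrier_mat) auto

lemma transpose_mult_form:
  fixes A :: "'a::field mat"
  assumes A: "A \<in> carrier_mat (2*n) (2*n)" and ij: "i < 2*n" "j < 2*n"
  shows "(transpose_mat A * symplectic_form n * A) $$ (i, j) = sform n (mat_act A (unit_fn i)) (mat_act A (unit_fn j))"
proof -
  note J = symplectic_form_carrier[of n, where 'a = 'a]
  have "(transpose_mat A * symplectic_form n * A) $$ (i, j) =
      (\<Sum>l<2*n. (\<Sum>k<2*n. A $$ (k, i) * symplectic_form n $$ (k, l)) * A $$ (l, j))"
    using carrier_matD[OF A] carrier_matD[OF J] ij by (simp add: scalar_prod_def lessThan_atLeast0)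
  also have "\<dots> = (\<Sum>l<2*n. \<Sum>k<2*n. A $$ (k, i) * symplectic_form n $$ (k, l) * A $$ (l, j))"
    by (simp add: sum_distrib_right)
  also have "\<dots> = (\<Sum>k<2*n. \<Sum>l<2*n. A $$ (k, i) * symplectic_form n $$ (k, l) * A $$ (l, j))"
    by (rule sum.swap)
  also have "\<dots> = sform n (mat_act A (unit_fn i)) (mat_act A (unit_fn j))"
    unfolding sform_symplectic_form mat_act_unit[OF A ij(1)] mat_act_unit[OF A ij(2)]
    by (intro sum.cong refl) auto
  finally show ?thesis .
qed

lemma sform_unit: "i < 2*n \<Longrightarrow> j < 2*n \<Longrightarrow> sform n (unit_fn i) (unit_fn j) = symplectic_form n $$ (i, j)"
proof -
  assume ij: "i < 2*n" "j < 2*n"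
  have "sform n (unit_fn i) (unit_fn j) = (\<Sum>k<2*n. \<Sum>l<2*n. unit_fn i k * symplectic_form n $$ (k, l) * unit_fn j l)"
    by (rule sform_symplectic_form)
  also have "\<dots> = (\<Sum>k<2*n. \<Sum>l<2*n. if l = j then (if k = i then symplectic_form n $$ (k, l) else 0) else 0)"
    by (intro sum.cong refl) (simp add: unit_fn_def)
  also have "\<dots> = symplectic_form n $$ (i, j)" using ij by simp
  finally show ?thesis .
qed

lemma Sp_iff:
  fixes A :: "'a::field mat"
  shows
  "A \<in> Sp n F \<longleftrightarrow> A \<in> carrier_mat (2*n) (2*n) \<and> (\<forall>i<2*n. \<forall>j<2*n. A $$ (i, j) \<in> F) \<and>
     (\<forall>i<2*n. \<forall>j<2*n. sform n (mat_act A (unit_fn i)) (mat_act A (unit_fn j)) = sform n (unit_fn i) (unit_fn j))"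
proof (cases "A \<in> carrier_mat (2*n) (2*n)")
  case True
  note J = symplectic_form_carrier[of n, where 'a = 'a]
  have "elements_mat A \<subseteq> F \<longleftrightarrow> (\<forall>i<2*n. \<forall>j<2*n. A $$ (i, j) \<in> F)"
  proof
    assume F: "elements_mat A \<subseteq> F"
    show "\<forall>i<2*n. \<forall>j<2*n. A $$ (i, j) \<in> F"
    proof (intro allI impI)
      fix i j assume "i < 2*n" "j < 2*n"
      from elements_matI[OF True this refl] show "A $$ (i, j) \<in> F" using F by blast
    qed
  next
    assume F: "\<forall>i<2*n. \<forall>j<2*n. A $$ (i, j) \<in> F"
    show "elements_mat A \<subseteq> F"
    proof
      fix a assume "a \<in> elements_mat A"
      then obtain i j where "i < dim_row A" "j < dim_col A" "a = A $$ (i, j)" by (elim elements_matD[elim_format]) blast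
      thus "a \<in> F" using F carrier_matD[OF True] by simp
    qed
  qed
  moreover have "transpose_mat A * symplectic_form n * A = symplectic_form n \<longleftrightarrow>
    (\<forall>i<2*n. \<forall>j<2*n. (transpose_mat A * symplectic_form n * A) $$ (i, j) = symplectic_form n $$ (i, j))"
  proof
    assume *: "\<forall>i<2*n. \<forall>j<2*n. (transpose_mat A * symplectic_form n * A) $$ (i, j) = symplectic_form n $$ (i, j)"
    show "transpose_mat A * symplectic_form n * A = symplectic_form n"
    proof (rule eq_matI)
      fix i j assume "i < dim_row (symplectic_form n :: 'a mat)" "j < dim_col (symplectic_form n :: 'a mat)"
      hence "i < 2*n" "j < 2*n" using J by auto
      thus "(transpose_mat A * symplectic_form n * A) $$ (i, j) = symplectic_form n $$ (i, j)" using * by blast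
    qed (use True J in \<open>auto simp del: index_mult_mat(1)\<close>)
  qed simp
  ultimately show ?thesis using True by (simp add: Sp_def transpose_mult_form[OF True] sform_unit del: index_mult_mat(1))
qed (simp add: Sp_def)

lemma sform_add_left: "sform n (x + y) z = sform n x z + sform n y z"
  by (simp add: sform_def sum.distrib[symmetric] algebra_simps)

lemma sform_add_right: "sform n z (x + y) = sform n z x + sform n z y"
  by (simp add: sform_def sum.distrib[symmetric] algebra_simps)

lemma sform_scale_left: "sform n (fscale c x) z = c * sform n x z"
  by (simp add: sform_def sum_distrib_left algebra_simps)

lemma sform_scale_right: "sform n z (fscale c x) = c * sform n z x"
  by (simp add: sform_def sum_distrib_left algebra_simps)

lemma sform_unit_right:
  assumes "k < n"
  shows "sform n x (unit_fn (n + k)) = x k" "sform n x (unit_fn k) = - x (n + k)"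
proof -
  have "sform n x (unit_fn (n + k)) = (\<Sum>i<n. if i = k then x i else 0)"
    unfolding sform_def by (intro sum.cong) (use assms in \<open>auto simp: unit_fn_def\<close>)
  thus "sform n x (unit_fn (n + k)) = x k" using assms by simp
  have "sform n x (unit_fn k) = (\<Sum>i<n. if i = k then - x (n + i) else 0)"
    unfolding sform_def by (intro sum.cong) (use assms in \<open>auto simp: unit_fn_def\<close>)
  thus "sform n x (unit_fn k) = - x (n + k)" using assms by simp
qed

lemma sform_mat_act:
  fixes A :: "'a::field mat"
  assumes A: "\<And>i j. i < 2*n \<Longrightarrow> j < 2*n \<Longrightarrow>
      sform n (mat_act A (unit_fn i)) (mat_act A (unit_fn j)) = sform n (unit_fn i) (unit_fn j)"
    and x: "\<And>i. i \<ge> 2*n \<Longrightarrow> x i = 0" and y: "\<And>i. i \<ge> 2*n \<Longrightarrow> y i = 0"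
  shows "sform n (mat_act A x) (mat_act A y) = sform n x y"
proof -
  have suml: "sform n (\<Sum>j\<in>J. g j) z = (\<Sum>j\<in>J. sform n (g j) z)" for J :: "nat set" and g and z :: "nat \<Rightarrow> 'a"
    by (rule additive.sum[of "\<lambda>x. sform n x z"]) (rule additive.intro, rule sform_add_left)
  have sumr: "sform n z (\<Sum>j\<in>J. g j) = (\<Sum>j\<in>J. sform n z (g j))" for J :: "nat set" and g and z :: "nat \<Rightarrow> 'a"
    by (rule additive.sum[of "sform n z"]) (rule additive.intro, rule sform_add_right)
  have act: "mat_act A z = (\<Sum>j<2*n. fscale (z j) (mat_act A (unit_fn j)))" if "\<And>i. i \<ge> 2*n \<Longrightarrow> z i = 0" for z
    by (subst unit_expansion[of "2*n" z, OF that])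
       (simp_all add: module_hom.sum[OF module_hom_mat_act] module_hom.scale[OF module_hom_mat_act])
  have expand: "sform n (\<Sum>i<2*n. fscale (x i) (f i)) (\<Sum>j<2*n. fscale (y j) (f j)) =
      (\<Sum>i<2*n. \<Sum>j<2*n. x i * (y j * sform n (f i) (f j)))" for f :: "nat \<Rightarrow> nat \<Rightarrow> 'a"
    unfolding suml sform_scale_left unfolding sumr sform_scale_right sum_distrib_left ..
  have "sform n (mat_act A x) (mat_act A y) =
      (\<Sum>i<2*n. \<Sum>j<2*n. x i * (y j * sform n (mat_act A (unit_fn i)) (mat_act A (unit_fn j))))"
    by (subst act[OF x], assumption, subst act[OF y], assumption, rule expand)
  also have "\<dots> = (\<Sum>i<2*n. \<Sum>j<2*n. x i * (y j * sform n (unit_fn i) (unit_fn j)))"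
    by (intro sum.cong refl) (simp add: A)
  also have "\<dots> = sform n (\<Sum>i<2*n. fscale (x i) (unit_fn i)) (\<Sum>j<2*n. fscale (y j) (unit_fn j))"
    by (rule expand[symmetric])
  also have "\<dots> = sform n x y"
    using unit_expansion[of "2*n" x, OF x] unit_expansion[of "2*n" y, OF y] by simp
  finally show ?thesis .
qed

context finite_subfield
begin

lemma vecs_subset_image: "vecs F N \<subseteq> (\<lambda>f i. if i < N then f i else 0) ` ({..<N} \<rightarrow>\<^sub>E F)"
proof
  fix x assume x: "x \<in> vecs F N"
  have "x = (\<lambda>i. if i < N then restrict x {..<N} i else 0)"
    using x by (auto simp: vecs_def fun_eq_iff not_less)
  moreover have "restrict x {..<N} \<in> {..<N} \<rightarrow>\<^sub>E F" using x by (auto simp: vecs_def)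
  ultimately show "x \<in> (\<lambda>f i. if i < N then f i else 0) ` ({..<N} \<rightarrow>\<^sub>E F)" by blast
qed

lemma finite_vecs: "finite (vecs F N)"
  by (rule finite_subset[OF vecs_subset_image finite_imageI[OF finite_PiE]]) (auto simp: finite_F)

lemma card_vecs_le: "card (vecs F N) \<le> q ^ N"
proof -
  have fin: "finite ({..<N} \<rightarrow>\<^sub>E F)" by (intro finite_PiE) (auto simp: finite_F)
  have "card (vecs F N) \<le> card ((\<lambda>f i. if i < N then f i else (0::'a)) ` ({..<N} \<rightarrow>\<^sub>E F))"
    by (rule card_mono[OF finite_imageI[OF fin] vecs_subset_image])
  also have "\<dots> \<le> card ({..<N} \<rightarrow>\<^sub>E F)" by (rule card_image_le[OF fin])
  finally show ?thesis by (simp add: card_PiE)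
qed

lemma unit_fn_vecs: "k < N \<Longrightarrow> unit_fn k \<in> vecs F N"
  by (auto simp: vecs_def unit_fn_def F_0 F_1)

lemma symplectic_space_vecs: "symplectic_space fscale F (vecs F (2*n)) (sform n)"
proof
  fix x assume x: "x \<in> vecs F (2*n)" and z: "\<And>y. y \<in> vecs F (2*n) \<Longrightarrow> sform n x y = 0"
  show "x = 0"
  proof
    fix i
    consider "i < n" | k where "i = n + k" "k < n" | "i \<ge> 2*n"
      by (metis add.commute le_add_diff_inverse2 less_diff_conv2 linorder_not_le mult_2)
    thus "x i = 0 i"
    proof cases
      case 1
      thus ?thesis using z[OF unit_fn_vecs[of "n + i"]] sform_unit_right(1)[OF 1, of x] by simp
    next
      case 2
      thus ?thesis using z[OF unit_fn_vecs[of k]] sform_unit_right(2)[OF 2(2), of x] by simp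
    qed (use x in \<open>simp add: vecs_def\<close>)
  qed
next
  show "sform n x x = 0" for x :: "nat \<Rightarrow> 'a" by (simp add: sform_def mult.commute)
  show "sform n x y \<in> F" if "x \<in> vecs F (2*n)" "y \<in> vecs F (2*n)" for x y
    using that by (auto simp: sform_def vecs_def intro!: F_sum F_diff F_mult)
  show "0 \<in> vecs F (2*n)" by (simp add: vecs_def F_0)
  show "x + y \<in> vecs F (2*n)" if "x \<in> vecs F (2*n)" "y \<in> vecs F (2*n)" for x y
    using that by (simp add: vecs_def F_add)
  show "fscale c x \<in> vecs F (2*n)" if "c \<in> F" "x \<in> vecs F (2*n)" for c x
    using that by (simp add: vecs_def F_mult)
qed (rule finite_vecs sform_add_left sform_add_right sform_scale_left sform_scale_right)+

lemma finite_Sp: "finite (Sp n F)"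
proof -
  have "Sp n F \<subseteq> (\<lambda>f. mat (2*n) (2*n) f) ` (({..<2*n} \<times> {..<2*n}) \<rightarrow>\<^sub>E F)"
  proof
    fix A assume A: "A \<in> Sp n F"
    have "A = mat (2*n) (2*n) (restrict (\<lambda>ij. A $$ ij) ({..<2*n} \<times> {..<2*n}))"
      using A by (intro eq_matI) (auto simp: Sp_iff)
    moreover have "restrict (\<lambda>ij. A $$ ij) ({..<2*n} \<times> {..<2*n}) \<in> ({..<2*n} \<times> {..<2*n}) \<rightarrow>\<^sub>E F"
      using A by (auto simp: Sp_iff)
    ultimately show "A \<in> (\<lambda>f. mat (2*n) (2*n) f) ` (({..<2*n} \<times> {..<2*n}) \<rightarrow>\<^sub>E F)" by blast
  qed
  thus ?thesis by (rule finite_subset) (intro finite_imageI finite_PiE, auto simp: finite_F)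
qed

lemma inj_on_mat_act_Sp: "inj_on mat_act (Sp n F)"
proof
  fix A B :: "'a mat" assume "A \<in> Sp n F" "B \<in> Sp n F" "mat_act A = mat_act B"
  thus "A = B" using mat_act_inj[of A "2*n" B] by (simp add: Sp_iff)
qed

lemma Sp_isometry:
  assumes A: "A \<in> Sp n F" and x: "\<And>i. i \<ge> 2*n \<Longrightarrow> x i = 0" and y: "\<And>i. i \<ge> 2*n \<Longrightarrow> y i = 0"
  shows "sform n (mat_act A x) (mat_act A y) = sform n x y"
  by (rule sform_mat_act[OF _ x y]) (use A in \<open>simp add: Sp_iff\<close>)

lemma mat_act_vecs:
  assumes "A \<in> Sp n F" "x \<in> vecs F (2*n)"
  shows "mat_act A x \<in> vecs F (2*n)"
proof -
  have "A \<in> carrier_mat (2*n) (2*n)" "\<And>i j. i < 2*n \<Longrightarrow> j < 2*n \<Longrightarrow> A $$ (i, j) \<in> F"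
    using assms(1) by (auto simp: Sp_iff)
  thus ?thesis using assms(2) by (auto simp: vecs_def mat_act_def intro!: F_sum F_mult)
qed

lemma Sp_mult:
  assumes A: "A \<in> Sp n F" and B: "B \<in> Sp n F"
  shows "A * B \<in> Sp n F"
proof -
  have c: "A \<in> carrier_mat (2*n) (2*n)" "B \<in> carrier_mat (2*n) (2*n)" using A B by (auto simp: Sp_iff)
  have AB: "A * B \<in> carrier_mat (2*n) (2*n)" using c by auto
  have act: "mat_act (A * B) x = mat_act A (mat_act B x)" for x using mat_act_mult[OF c] by simp
  have u: "mat_act B (unit_fn j) \<in> vecs F (2*n)" if "j < 2*n" for j
    using mat_act_vecs[OF B unit_fn_vecs[OF that]] .
  have "(A * B) $$ (i, j) \<in> F" if "i < 2*n" "j < 2*n" for i j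
  proof -
    have "mat_act (A * B) (unit_fn j) i \<in> F"
      using mat_act_vecs[OF A u[OF that(2)]] that(1) unfolding act by (simp add: vecs_def)
    thus ?thesis using that by (simp add: mat_act_unit[OF AB] del: index_mult_mat(1))
  qed
  moreover have "sform n (mat_act (A * B) (unit_fn i)) (mat_act (A * B) (unit_fn j)) = sform n (unit_fn i) (unit_fn j)"
    if "i < 2*n" "j < 2*n" for i j
  proof -
    have "sform n (mat_act (A * B) (unit_fn i)) (mat_act (A * B) (unit_fn j)) = sform n (mat_act B (unit_fn i)) (mat_act B (unit_fn j))"
      unfolding act by (rule Sp_isometry[OF A]) (use u[OF that(1)] u[OF that(2)] in \<open>auto simp: vecs_def\<close>)
    also have "\<dots> = sform n (unit_fn i) (unit_fn j)" using B that by (simp add: Sp_iff)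
    finally show ?thesis .
  qed
  ultimately show ?thesis using AB by (auto simp: Sp_iff simp del: index_mult_mat(1))
qed

lemma Sp_full:
  assumes V: "\<And>x. x \<in> vecs F (2*n) \<Longrightarrow> L x \<in> vecs F (2*n)"
    and add: "\<And>x y. x \<in> vecs F (2*n) \<Longrightarrow> y \<in> vecs F (2*n) \<Longrightarrow> L (x + y) = L x + L y"
    and sc: "\<And>c x. c \<in> F \<Longrightarrow> x \<in> vecs F (2*n) \<Longrightarrow> L (fscale c x) = fscale c (L x)"
    and iso: "\<And>x y. x \<in> vecs F (2*n) \<Longrightarrow> y \<in> vecs F (2*n) \<Longrightarrow> sform n (L x) (L y) = sform n x y"
  shows "\<exists>A\<in>Sp n F. \<forall>x\<in>vecs F (2*n). mat_act A x = L x"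
proof -
  interpret sp: symplectic_space fscale F "vecs F (2*n)" "sform n" by (rule symplectic_space_vecs)
  define A where "A = mat (2*n) (2*n) (\<lambda>(i, j). L (unit_fn j) i)"
  have A: "A \<in> carrier_mat (2*n) (2*n)" by (simp add: A_def)
  have Lu: "L (unit_fn j) \<in> vecs F (2*n)" if "j < 2*n" for j using V unit_fn_vecs that by blast
  have actu: "mat_act A (unit_fn j) = L (unit_fn j)" if "j < 2*n" for j
    unfolding mat_act_unit[OF A that] using that Lu[OF that] by (auto simp: A_def vecs_def fun_eq_iff)
  have "fscale 0 x = 0" for x :: "nat \<Rightarrow> 'a" by (rule fs.scale_zero_left)
  hence L0: "L 0 = 0" using sc[OF F_0 sp.V_0] by simp
  have Lsum: "L (\<Sum>j<k. g j) = (\<Sum>j<k. L (g j))" if g: "\<And>j. j < k \<Longrightarrow> g j \<in> vecs F (2*n)" for k :: nat and g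
    using g
  proof (induction k)
    case (Suc k)
    have "(\<Sum>j<k. g j) \<in> vecs F (2*n)" by (rule sp.V_sum) (use Suc.prems in auto)
    hence "L ((\<Sum>j<k. g j) + g k) = L (\<Sum>j<k. g j) + L (g k)" using Suc.prems by (intro add) auto
    moreover have "L (\<Sum>j<k. g j) = (\<Sum>j<k. L (g j))" by (rule Suc.IH) (use Suc.prems in auto)
    ultimately show ?case by (simp only: sum.lessThan_Suc)
  next
    case 0
    show ?case using L0 by (simp only: lessThan_0 sum.empty)
  qed
  have "mat_act A x = L x" if x: "x \<in> vecs F (2*n)" for x
  proof -
    have xj: "x j \<in> F" if "j < 2*n" for j using x that by (simp add: vecs_def)
    have e: "x = (\<Sum>j<2*n. fscale (x j) (unit_fn j))" by (rule unit_expansion) (use x in \<open>simp add: vecs_def\<close>)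
    have "L x = L (\<Sum>j<2*n. fscale (x j) (unit_fn j))" using e by simp
    also have "\<dots> = (\<Sum>j<2*n. L (fscale (x j) (unit_fn j)))"
      using xj unit_fn_vecs by (intro Lsum sp.V_scale) auto
    also have "\<dots> = (\<Sum>j<2*n. fscale (x j) (mat_act A (unit_fn j)))"
      by (intro sum.cong refl) (simp add: sc xj unit_fn_vecs actu)
    also have "\<dots> = mat_act A (\<Sum>j<2*n. fscale (x j) (unit_fn j))"
      by (simp add: module_hom.sum[OF module_hom_mat_act] module_hom.scale[OF module_hom_mat_act])
    also have "\<dots> = mat_act A x" using e by simp
    finally show ?thesis by simp
  qed
  moreover have "A \<in> Sp n F"
    unfolding Sp_iff using A Lu iso unit_fn_vecs by (auto simp: A_def actu[unfolded A_def] vecs_def)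
  ultimately show ?thesis by blast
qed

end

context finite_subfield_2
begin

lemma hyperbolic_group_Sp:
  "hyperbolic_group fscale F (vecs F (2*n)) (sform n) (mat_act ` Sp n F) n unit_fn (\<lambda>k. unit_fn (n + k))"
proof -
  interpret sp: symplectic_space fscale F "vecs F (2*n)" "sform n" by (rule symplectic_space_vecs)
  show ?thesis
  proof
    show "finite (mat_act ` Sp n F)" using finite_Sp by simp
    show "T (x + y) = T x + T y" "T (fscale c x) = fscale c (T x)" if "T \<in> mat_act ` Sp n F" for T x y c
      using that module_hom.add[OF module_hom_mat_act] module_hom.scale[OF module_hom_mat_act] by blast+
    show "T x \<in> vecs F (2*n)" if "T \<in> mat_act ` Sp n F" "x \<in> vecs F (2*n)" for T x using that mat_act_vecs by blast
    show "sform n (T x) (T y) = sform n x y" if "T \<in> mat_act ` Sp n F" "x \<in> vecs F (2*n)" "y \<in> vecs F (2*n)" for T x y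
      using that by (auto intro!: Sp_isometry simp: vecs_def)
    show "T \<circ> U \<in> mat_act ` Sp n F" if TU: "T \<in> mat_act ` Sp n F" "U \<in> mat_act ` Sp n F" for T U
    proof -
      obtain A B where AB: "A \<in> Sp n F" "B \<in> Sp n F" "T = mat_act A" "U = mat_act B" using TU by blast
      have "mat_act (A * B) = T \<circ> U" using AB by (simp add: mat_act_mult[of A "2*n" B] Sp_iff)
      thus ?thesis using Sp_mult[OF AB(1,2)] by (metis imageI)
    qed
    show "T = U" if TU: "T \<in> mat_act ` Sp n F" "U \<in> mat_act ` Sp n F" and eq: "\<And>x. x \<in> vecs F (2*n) \<Longrightarrow> T x = U x" for T U
    proof -
      obtain A B where AB: "A \<in> Sp n F" "B \<in> Sp n F" "T = mat_act A" "U = mat_act B" using TU by blast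
      have "A = B" using eq[OF unit_fn_vecs] AB by (intro mat_act_inj[of A "2*n" B]) (auto simp: Sp_iff)
      thus ?thesis using AB by simp
    qed
    show "\<exists>T\<in>mat_act ` Sp n F. \<forall>x\<in>vecs F (2*n). T x = L x" if "sp.linear_isometry L" for L
      using Sp_full[of n L] that unfolding sp.linear_isometry_def by blast
    show "unit_fn k \<in> vecs F (2*n)" "unit_fn (n + k) \<in> vecs F (2*n)" if "k < n" for k
      using that by (auto intro: unit_fn_vecs)
    show "sform n (unit_fn k) (unit_fn l) = 0" "sform n (unit_fn (n + k)) (unit_fn (n + l)) = 0"
      "sform n (unit_fn k) (unit_fn (n + l)) = (if k = l then 1 else 0)" if "k < n" "l < n" for k l
      using that by (auto simp: sform_unit_right) (auto simp: unit_fn_def)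
    have "1\<^sub>m (2*n) \<in> Sp n F"
      unfolding Sp_iff
    proof (intro conjI allI impI)
      have one: "mat_act (1\<^sub>m (2*n)) (unit_fn j) = unit_fn j" if "j < 2*n" for j
        unfolding mat_act_unit[OF one_carrier_mat that] using that by (auto simp: unit_fn_def fun_eq_iff)
      show "sform n (mat_act (1\<^sub>m (2*n)) (unit_fn i)) (mat_act (1\<^sub>m (2*n)) (unit_fn j)) = sform n (unit_fn i) (unit_fn j)"
        if "i < 2*n" "j < 2*n" for i j using that by (simp add: one)
    qed (auto simp: F_0 F_1)
    thus "mat_act ` Sp n F \<noteq> {}" by blast
  qed
qed

end

section \<open>Irreducible factors of the characteristic polynomial\<close>

lemma char_poly_root_iff:
  fixes A :: "'a::field mat"
  assumes A: "A \<in> carrier_mat N N"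
  shows "poly (char_poly A) l = 0 \<longleftrightarrow> (\<exists>x. x \<noteq> 0 \<and> (\<forall>i\<ge>N. x i = 0) \<and> mat_act A x = fscale l x)"
proof -
  have "poly (char_poly A) l = 0 \<longleftrightarrow> (\<exists>v. v \<in> carrier_vec N \<and> v \<noteq> 0\<^sub>v N \<and> A *\<^sub>v v = l \<cdot>\<^sub>v v)"
    using eigenvalue_root_char_poly[OF A, of l] carrier_matD(1)[OF A] by (simp add: eigenvalue_def eigenvector_def)
  also have "\<dots> \<longleftrightarrow> (\<exists>x. x \<noteq> 0 \<and> (\<forall>i\<ge>N. x i = 0) \<and> mat_act A x = fscale l x)"
  proof
    assume "\<exists>v. v \<in> carrier_vec N \<and> v \<noteq> 0\<^sub>v N \<and> A *\<^sub>v v = l \<cdot>\<^sub>v v"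
    then obtain v where v: "v \<in> carrier_vec N" "v \<noteq> 0\<^sub>v N" "A *\<^sub>v v = l \<cdot>\<^sub>v v" by blast
    define x where "x i = (if i < N then v $ i else 0)" for i
    have "x \<noteq> 0"
    proof
      assume x0: "x = 0"
      have "v = 0\<^sub>v N"
      proof (rule eq_vecI)
        fix i assume "i < dim_vec (0\<^sub>v N :: 'a vec)"
        thus "v $ i = 0\<^sub>v N $ i" using fun_cong[OF x0, of i] by (simp add: x_def)
      qed (use v in simp)
      thus False using v by simp
    qed
    moreover have "mat_act A x = fscale l x"
    proof
      fix i
      show "mat_act A x i = fscale l x i"
      proof (cases "i < N")
        case True
        have "mat_act A x i = (\<Sum>j<N. A $$ (i, j) * v $ j)"
          using A True by (simp add: mat_act_def x_def)
        also have "\<dots> = (A *\<^sub>v v) $ i"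
          using A v(1) True by (simp add: scalar_prod_def lessThan_atLeast0)
        finally show ?thesis using v(1,3) True by (simp add: x_def)
      qed (use A in \<open>simp add: mat_act_def x_def\<close>)
    qed
    ultimately show "\<exists>x. x \<noteq> 0 \<and> (\<forall>i\<ge>N. x i = 0) \<and> mat_act A x = fscale l x"
      by (intro exI[of _ x]) (simp add: x_def)
  next
    assume "\<exists>x. x \<noteq> 0 \<and> (\<forall>i\<ge>N. x i = 0) \<and> mat_act A x = fscale l x"
    then obtain x where x: "x \<noteq> 0" "\<forall>i\<ge>N. x i = 0" "mat_act A x = fscale l x" by blast
    have "vec N x \<noteq> 0\<^sub>v N"
    proof
      assume v0: "vec N x = 0\<^sub>v N"
      have "x i = 0" for i
      proof (cases "i < N")
        case True
        have "vec N x $ i = 0\<^sub>v N $ i" using v0 by simp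
        thus ?thesis using True by simp
      qed (use x in simp)
      hence "x = 0" by (intro ext) (simp only: zero_fun_apply)
      thus False using x(1) by contradiction
    qed
    moreover have "A *\<^sub>v vec N x = l \<cdot>\<^sub>v vec N x"
    proof (rule eq_vecI)
      fix i assume "i < dim_vec (l \<cdot>\<^sub>v vec N x)"
      hence i: "i < N" by simp
      have "(A *\<^sub>v vec N x) $ i = mat_act A x i"
        using A i by (simp add: scalar_prod_def lessThan_atLeast0 mat_act_def)
      thus "(A *\<^sub>v vec N x) $ i = (l \<cdot>\<^sub>v vec N x) $ i" using x(3) i by simp
    qed (use A in simp)
    ultimately show "\<exists>v. v \<in> carrier_vec N \<and> v \<noteq> 0\<^sub>v N \<and> A *\<^sub>v v = l \<cdot>\<^sub>v v"
      by (intro exI[of _ "vec N x"]) simp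
  qed
  finally show ?thesis .
qed

lemma (in finite_subfield) char_poly_in_P:
  assumes A: "A \<in> carrier_mat N N" and F: "\<And>i j. i < N \<Longrightarrow> j < N \<Longrightarrow> A $$ (i, j) \<in> F"
  shows "char_poly A \<in> P"
proof -
  have P_sum: "sum g J \<in> P" if "\<And>x. x \<in> J \<Longrightarrow> g x \<in> P" for J :: "(nat \<Rightarrow> nat) set" and g
    using that by (induction J rule: infinite_finite_induct) (auto simp: P_0 P_add)
  have P_prod: "prod g J \<in> P" if "\<And>x. x \<in> J \<Longrightarrow> g x \<in> P" for J :: "nat set" and g
    using that by (induction J rule: infinite_finite_induct) (auto simp: P_1 P_mult)
  have ent: "char_poly_matrix A $$ (i, j) \<in> P" if "i < N" "j < N" for i j
    using A F[OF that] that unfolding char_poly_matrix_def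
    by (auto intro!: P_pCons P_add F_uminus simp: F_0 F_1 P_0 P_1)
  have "signof p * (\<Prod>i = 0..<N. char_poly_matrix A $$ (i, p i)) \<in> P" if "p permutes {0..<N}" for p
  proof -
    have "(\<Prod>i = 0..<N. char_poly_matrix A $$ (i, p i)) \<in> P"
      using that permutes_in_image[OF that] by (intro P_prod ent) auto
    moreover have "signof p = (1 :: 'a poly) \<or> signof p = (- 1 :: 'a poly)" by (simp add: sign_def)
    ultimately show ?thesis using P_diff[OF P_0] by auto
  qed
  hence "(\<Sum>p\<in>{p. p permutes {0..<N}}. signof p * (\<Prod>i = 0..<N. char_poly_matrix A $$ (i, p i))) \<in> P"
    by (intro P_sum) auto
  thus ?thesis unfolding char_poly_def using A by (simp add: det_def'[of _ N])
qed

locale Sp_setting = finite_subfield_2 F for F :: "'a::alg_closed_field set" +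
  fixes n :: nat
begin

sublocale hg: hyperbolic_group fscale F "vecs F (2*n)" "sform n" "mat_act ` Sp n F" n unit_fn "\<lambda>k. unit_fn (n + k)"
  by (rule hyperbolic_group_Sp)

text \<open>If \<open>p(A)\<close> is injective on the finite space over \<open>F\<close>, it is
  onto there, so it has an inverse with entries in \<open>F\<close>, and this still inverts it over
  the ambient field.\<close>

lemma singular_on_subfield:
  assumes A: "A \<in> Sp n F" and p: "p \<in> P" and k: "hg.ker (mat_act A) p = {0}"
    and x: "\<And>i. i \<ge> 2*n \<Longrightarrow> x i = 0" and z: "fs.pact p (mat_act A) x = 0"
  shows "x = 0"
proof -
  let ?V = "vecs F (2*n)" and ?g = "fs.pact p (mat_act A)"
  have AS: "mat_act A \<in> mat_act ` Sp n F" using A by blast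
  note hom = fs.hom_pact[OF module_hom_mat_act[of A], of p]
  have gV: "?g v \<in> ?V" if "v \<in> ?V" for v
    using hg.pact_in_V[OF hg.S_V[OF AS] p that] .
  have inj: "inj_on ?g ?V"
  proof
    fix v w assume vw: "v \<in> ?V" "w \<in> ?V" "?g v = ?g w"
    have "v - w \<in> hg.ker (mat_act A) p"
      unfolding hg.ker_def using vw hg.V_diff by (auto simp: module_hom.diff[OF hom])
    hence "v - w = 0" using k by blast
    thus "v = w" by (simp only: right_minus_eq)
  qed
  have surj: "?g ` ?V = ?V" using endo_inj_surj[OF finite_vecs _ inj] gV by blast
  have "\<exists>u. u \<in> ?V \<and> ?g u = unit_fn k" if "k < 2*n" for k
  proof -
    have "unit_fn k \<in> ?g ` ?V" using unit_fn_vecs[OF that] surj by blast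
    thus ?thesis by (metis imageE)
  qed
  then obtain u where u: "\<And>k. k < 2*n \<Longrightarrow> u k \<in> ?V" "\<And>k. k < 2*n \<Longrightarrow> ?g (u k) = unit_fn k" by metis
  \<comment> \<open>The columns of this operator are the preimages \<open>u k\<close> of the unit
    vectors; it is extended linearly to the ambient field and shown to be a left inverse.\<close>
  define H where "H y = (\<Sum>k<2*n. fscale (y k) (u k))" for y
  have H0: "H 0 = 0" unfolding H_def by (rule sum.neutral, intro ballI) (simp only: zero_fun_apply fs.scale_zero_left)
  have Hadd: "H (x + y) = H x + H y" for x y
    by (simp only: H_def plus_fun_apply fs.scale_left_distrib sum.distrib)
  have Hsc: "H (fscale c y) = fscale c (H y)" for c y
    by (simp only: H_def fscale_apply fs.scale_sum_right fs.scale_scale)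
  have Hsum: "H (\<Sum>j<m. f j) = (\<Sum>j<m. H (f j))" for m :: nat and f
    by (rule additive.sum[of H]) (rule additive.intro, rule Hadd)
  have unit: "H (?g (unit_fn j)) = unit_fn j" if j: "j < 2*n" for j
  proof -
    let ?y = "?g (unit_fn j)"
    have y: "?y \<in> ?V" using gV unit_fn_vecs[OF j] by blast
    have "?g (H ?y) = (\<Sum>k<2*n. fscale (?y k) (unit_fn k))"
      unfolding H_def by (simp add: module_hom.sum[OF hom] module_hom.scale[OF hom] u(2))
    also have "\<dots> = ?y" by (rule unit_expansion[symmetric]) (use y in \<open>simp add: vecs_def\<close>)
    finally have eq: "?g (H ?y) = ?g (unit_fn j)" .
    have "H ?y \<in> ?V" unfolding H_def using y u(1) by (intro hg.V_sum hg.V_scale) (auto simp: vecs_def)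
    from inj_on_eq_iff[OF inj this unit_fn_vecs[OF j]] eq show ?thesis by blast
  qed
  have e: "x = (\<Sum>j<2*n. fscale (x j) (unit_fn j))" by (rule unit_expansion[OF x])
  have "?g x = ?g (\<Sum>j<2*n. fscale (x j) (unit_fn j))" by (rule arg_cong[OF e])
  also have "\<dots> = (\<Sum>j<2*n. fscale (x j) (?g (unit_fn j)))"
    by (simp only: module_hom.sum[OF hom] module_hom.scale[OF hom])
  finally have "H (?g x) = (\<Sum>j<2*n. fscale (x j) (H (?g (unit_fn j))))" by (simp only: Hsum Hsc)
  also have "\<dots> = (\<Sum>j<2*n. fscale (x j) (unit_fn j))" by (intro sum.cong refl) (simp only: unit lessThan_iff)
  also have "\<dots> = x" by (rule e[symmetric])
  finally show "x = 0" using z H0 by simp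
qed

lemma pact_eigenvector:
  assumes "mat_act A x = fscale l x"
  shows "fs.pact p (mat_act A) x = fscale (poly p l) x"
proof -
  have "(mat_act A ^^ k) x = fscale (l ^ k) x" for k
  proof (induction k)
    case (Suc k)
    thus ?case using assms by (simp add: module_hom.scale[OF module_hom_mat_act] fs.scale_scale mult.commute del: fscale_apply)
  qed (simp only: funpow_0 power_0 fs.scale_one)
  thus ?thesis by (simp add: fs.pact_def poly_altdef fs.scale_scale fs.scale_sum_left)
qed

text \<open>Applying the linear factors one after another to \<open>v\<close> reaches zero at some
  point; the last nonzero vector before that is an eigenvector.\<close>

lemma eigenvector_in_kernel:
  fixes T :: "(nat \<Rightarrow> 'a) \<Rightarrow> nat \<Rightarrow> 'a"
  assumes T: "module_hom fscale fscale T" and W: "\<And>x. x \<in> W \<Longrightarrow> T x \<in> W"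
    "\<And>x y. x \<in> W \<Longrightarrow> y \<in> W \<Longrightarrow> x + y \<in> W" "\<And>c x. x \<in> W \<Longrightarrow> fscale c x \<in> W"
    and v: "v \<in> W" "v \<noteq> 0" "fs.pact (\<Prod>x\<in>#M. [:- x, 1:]) T v = 0"
  shows "\<exists>l\<in>#M. \<exists>w\<in>W. w \<noteq> 0 \<and> T w = fscale l w"
  using v(3)
proof (induction M)
  case empty
  hence "fs.pact 1 T v = 0" by (simp only: image_mset_empty prod_mset_empty)
  thus ?case using v(2) by (simp only: fs.pact_1)
next
  case (add l M)
  define w where "w = fs.pact (\<Prod>x\<in>#M. [:- x, 1:]) T v"
  show ?case
  proof (cases "w = 0")
    case True
    hence "fs.pact (\<Prod>x\<in>#M. [:- x, 1:]) T v = 0" unfolding w_def .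
    from add.IH[OF this] show ?thesis unfolding set_mset_add_mset_insert by blast
  next
    case False
    have pW: "fs.pact r T x \<in> W" if "x \<in> W" for r x
    proof (induction r)
      case 0
      have "fscale 0 x \<in> W" by (rule W(3)[OF that])
      thus ?case by (simp only: fs.pact_0 fs.scale_zero_left)
    next
      case (pCons a r)
      show ?case unfolding fs.pact_pCons[OF T] by (intro W that pCons)
    qed
    have "0 = fs.pact ([:- l, 1:] * (\<Prod>x\<in>#M. [:- x, 1:])) T v"
      using add.prems by (simp only: image_mset_add_mset prod_mset.add_mset)
    also have "\<dots> = fs.pact [:- l, 1:] T w" unfolding w_def by (rule fs.pact_mult[OF T])
    also have "\<dots> = fscale (- l) w + T w"
      unfolding fs.pact_pCons[OF T] fs.pact_0
      by (simp only: module_hom.zero[OF T] add_0_right fs.scale_one)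
    finally have "T w = fscale l w"
      unfolding fs.scale_minus_left by (metis add.commute eq_neg_iff_add_eq_0 minus_minus)
    moreover have "w \<in> W" unfolding w_def by (rule pW[OF v(1)])
    ultimately show ?thesis using False unfolding set_mset_add_mset_insert by blast
  qed
qed

text \<open>Both directions pass through a root \<open>l\<close> of \<open>p\<close> in the
  algebraically closed ambient field. A root shared with the characteristic polynomial gives an
  eigenvector killed by \<open>p(A)\<close>, and \<open>singular_on_subfield\<close> brings this
  down to \<open>F\<close>. Conversely a kernel vector over \<open>F\<close> yields an eigenvalue
  that is a root of \<open>p\<close>.\<close>

lemma factor_over_char_poly_iff:
  assumes A: "A \<in> Sp n F" and p: "irreducible_over F p"
  shows "factor_over F p (char_poly A) \<longleftrightarrow> hg.ker (mat_act A) p \<noteq> {0}"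
proof -
  have Ac: "A \<in> carrier_mat (2*n) (2*n)" and AF: "\<And>i j. i < 2*n \<Longrightarrow> j < 2*n \<Longrightarrow> A $$ (i, j) \<in> F"
    using A by (auto simp: Sp_iff)
  have AS: "mat_act A \<in> mat_act ` Sp n F" using A by blast
  have cP: "char_poly A \<in> P" by (rule char_poly_in_P[OF Ac AF])
  note pD = irreducible_over_D[OF p]
  have zero: "0 \<in> hg.ker (mat_act A) p" unfolding hg.ker_def using hg.V_0 hg.pact_0_right[OF AS] by blast
  have "p dvd char_poly A \<longleftrightarrow> hg.ker (mat_act A) p \<noteq> {0}"
  proof
    assume dvd: "p dvd char_poly A"
    obtain l where l: "poly p l = 0" using alg_closed_imp_poly_has_root[OF pD(2)] by blast
    hence "poly (char_poly A) l = 0" using dvd by (meson dvd_trans poly_eq_0_iff_dvd)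
    then obtain x where x: "x \<noteq> 0" "\<forall>i\<ge>2*n. x i = 0" "mat_act A x = fscale l x"
      using char_poly_root_iff[OF Ac] by blast
    have "fs.pact p (mat_act A) x = 0"
      unfolding pact_eigenvector[OF x(3)] l by (rule fs.scale_zero_left)
    show "hg.ker (mat_act A) p \<noteq> {0}"
    proof
      assume k: "hg.ker (mat_act A) p = {0}"
      have "x = 0" by (rule singular_on_subfield[OF A pD(1) k _ \<open>fs.pact p (mat_act A) x = 0\<close>]) (use x(2) in blast)
      thus False using x(1) by contradiction
    qed
  next
    assume "hg.ker (mat_act A) p \<noteq> {0}"
    then obtain v where v: "v \<in> hg.ker (mat_act A) p" "v \<noteq> 0" using zero by blast
    obtain M where M: "p = Polynomial.smult (lead_coeff p) (\<Prod>x\<in>#M. [:- x, 1:])"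
      using alg_closed_imp_factorization[OF pD(3)] by blast
    have lc: "lead_coeff p \<noteq> 0" using pD(3) by simp
    let ?r = "\<Prod>x\<in>#M. [:- x, 1:]"
    let ?W = "{x :: nat \<Rightarrow> 'a. \<forall>i\<ge>2*n. x i = 0}"
    have "fs.pact p (mat_act A) v = 0" and vV: "v \<in> vecs F (2*n)" using v(1) by (auto simp: hg.ker_def)
    hence "fscale (lead_coeff p) (fs.pact ?r (mat_act A) v) = 0" by (metis M fs.pact_smult)
    hence "fs.pact ?r (mat_act A) v = 0" using lc by (simp only: fs.scale_eq_0_iff simp_thms)
    moreover have "v \<in> ?W" using vV by (simp add: vecs_def)
    ultimately obtain l w where lw: "l \<in># M" "w \<in> ?W" "w \<noteq> 0" "mat_act A w = fscale l w"
      using eigenvector_in_kernel[OF module_hom_mat_act[of A], of ?W v M] v(2) Ac by (auto simp: mat_act_def)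
    have "poly (char_poly A) l = 0" using char_poly_root_iff[OF Ac, of l] lw by blast
    moreover have "poly p l = 0"
    proof -
      have "[:- l, 1:] dvd ?r" using lw(1) by (intro dvd_prod_mset) auto
      hence "[:- l, 1:] dvd p" using M dvd_smult by metis
      thus ?thesis by (simp add: poly_eq_0_iff_dvd)
    qed
    ultimately show "p dvd char_poly A" using irreducible_over_dvd_of_root[OF p cP] by blast
  qed
  thus ?thesis using factor_over_iff_dvd[OF pD(1,3) cP] by blast
qed

end

section \<open>The limiting proportion\<close>

lemma (in finite_subfield) irreducible_over_normalize:
  assumes p: "irreducible_over F p"
  shows "irreducible_over F (Polynomial.smult (inverse (lead_coeff p)) p)"
    "lead_coeff (Polynomial.smult (inverse (lead_coeff p)) p) = 1"
proof -
  note pD = irreducible_over_D[OF p]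
  let ?c = "inverse (lead_coeff p)"
  have c: "lead_coeff p \<noteq> 0" "lead_coeff p \<in> F" using pD by (auto intro: P_coeff)
  show "lead_coeff (Polynomial.smult ?c p) = 1" using c by simp
  show "irreducible_over F (Polynomial.smult ?c p)"
    unfolding irreducible_over_def
  proof (intro conjI ballI impI)
    show "Polynomial.smult ?c p \<in> P" using pD c by (intro P_smult F_inverse)
    show "0 < Polynomial.degree (Polynomial.smult ?c p)" using pD c by simp
    fix g h assume gh: "g \<in> P" "h \<in> P" "Polynomial.smult ?c p = g * h"
    have "p = Polynomial.smult (lead_coeff p) (Polynomial.smult ?c p)" using c by simp
    hence eq: "p = Polynomial.smult (lead_coeff p) g * h" unfolding gh(3) by simp
    have all: "\<forall>g\<in>P. \<forall>h\<in>P. p = g * h \<longrightarrow> Polynomial.degree g = 0 \<or> Polynomial.degree h = 0"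
      using p by (simp add: irreducible_over_def)
    have "Polynomial.degree (Polynomial.smult (lead_coeff p) g) = 0 \<or> Polynomial.degree h = 0"
      by (rule mp[OF bspec[OF bspec[OF all P_smult[OF c(2) gh(1)]] gh(2)] eq])
    thus "Polynomial.degree g = 0 \<or> Polynomial.degree h = 0" using c(1) by simp
  qed
qed

locale factor_representatives = finite_subfield_2 F for F :: "'a::alg_closed_field set" +
  fixes t :: nat and \<Phi> :: "'a poly set"
  assumes finite_\<Phi>: "finite \<Phi>"
    and \<Phi>_mirr: "\<And>p. p \<in> \<Phi> \<Longrightarrow> mirr p" and \<Phi>_degree: "\<And>p. p \<in> \<Phi> \<Longrightarrow> Polynomial.degree p \<le> t"
    and \<Phi>_conj: "\<And>p r. p \<in> \<Phi> \<Longrightarrow> r \<in> \<Phi> \<Longrightarrow> p = conjugate_poly r \<Longrightarrow> p = r"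
    and \<Phi>_cover: "\<And>p. mirr p \<Longrightarrow> Polynomial.degree p \<le> t \<Longrightarrow> p \<in> \<Phi> \<or> conjugate_poly p \<in> \<Phi>"
begin

text \<open>An arbitrary irreducible factor is first made monic. The polynomial \<open>z\<close>
  never occurs because \<open>T\<close> is injective on \<open>V\<close>, and a polynomial outside
  \<open>\<Phi>\<close> is replaced by its conjugate through
  \<open>ker_conjugate_trivial\<close>.\<close>

lemma no_small_factor_iff:
  assumes A: "A \<in> Sp n F"
  shows "no_small_factor F t (char_poly A) \<longleftrightarrow>
    mat_act A \<in> hyperbolic_group.avoiding fscale (vecs F (2*n)) (mat_act ` Sp n F) \<Phi>"
proof -
  interpret Sp_setting F n by unfold_locales
  let ?T = "mat_act A"
  have T: "?T \<in> mat_act ` Sp n F" using A by blast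
  have zero: "0 \<in> hg.ker ?T p" for p unfolding hg.ker_def using hg.V_0 hg.pact_0_right[OF T] by blast
  have one: "card (hg.ker ?T p) = 1 \<longleftrightarrow> hg.ker ?T p = {0}" for p
    using zero[of p] card_1_singleton_iff[of "hg.ker ?T p"] by auto
  have "no_small_factor F t (char_poly A) \<longleftrightarrow> (\<forall>p. irreducible_over F p \<and> Polynomial.degree p \<le> t \<longrightarrow> hg.ker ?T p = {0})"
    unfolding no_small_factor_def using factor_over_char_poly_iff[OF A] by blast
  also have "\<dots> \<longleftrightarrow> (\<forall>p\<in>\<Phi>. hg.ker ?T p = {0})"
  proof
    assume "\<forall>p. irreducible_over F p \<and> Polynomial.degree p \<le> t \<longrightarrow> hg.ker ?T p = {0}"
    thus "\<forall>p\<in>\<Phi>. hg.ker ?T p = {0}" using mirr_D(1)[OF \<Phi>_mirr] \<Phi>_degree by blast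
  next
    assume all: "\<forall>p\<in>\<Phi>. hg.ker ?T p = {0}"
    show "\<forall>p. irreducible_over F p \<and> Polynomial.degree p \<le> t \<longrightarrow> hg.ker ?T p = {0}"
    proof (intro allI impI)
      fix p assume p: "irreducible_over F p \<and> Polynomial.degree p \<le> t"
      define c where "c = inverse (lead_coeff p)"
      define r where "r = Polynomial.smult c p"
      have c: "c \<noteq> 0" using irreducible_over_D(3)[of p] p by (simp add: c_def)
      have r: "irreducible_over F r" "lead_coeff r = 1"
        using irreducible_over_normalize[of p] p by (auto simp: r_def c_def)
      have deg: "Polynomial.degree r \<le> t" using c p by (simp add: r_def)
      have "fscale c x = 0 \<longleftrightarrow> x = 0" for x :: "nat \<Rightarrow> 'a" using c fs.scale_eq_0_iff[of c x] by blast
      hence ker: "hg.ker ?T r = hg.ker ?T p" unfolding hg.ker_def r_def fs.pact_smult by blast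
      show "hg.ker ?T p = {0}"
      proof (cases "r = [:0, 1:]")
        case True
        have "x = 0" if x: "x \<in> hg.ker ?T r" for x
        proof -
          have "fs.pact [:0, 1:] ?T x = ?T x"
            unfolding fs.pact_pCons[OF module_hom_mat_act] fs.pact_0
            by (simp only: module_hom.zero[OF module_hom_mat_act] add_0_right add_0_left fs.scale_one fs.scale_zero_left)
          hence "?T x = ?T 0" "x \<in> vecs F (2*n)"
            using x True by (auto simp: hg.ker_def module_hom.zero[OF module_hom_mat_act])
          thus ?thesis using inj_onD[OF hg.S_inj[OF T]] hg.V_0 by blast
        qed
        thus ?thesis using zero ker by blast
      next
        case False
        hence m: "mirr r" using r by (simp add: mirr_def)
        from \<Phi>_cover[OF m deg] show ?thesis
        proof
          assume "r \<in> \<Phi>"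
          thus ?thesis using all ker by blast
        next
          assume "conjugate_poly r \<in> \<Phi>"
          hence "hg.ker ?T (conjugate_poly r) = {0}" using all by blast
          from hg.ker_conjugate_trivial[OF T m this] show ?thesis using ker by blast
        qed
      qed
    qed
  qed
  also have "\<dots> \<longleftrightarrow> ?T \<in> hg.avoiding \<Phi>"
    unfolding hg.avoiding_def by (simp only: mem_Collect_eq one T simp_thms)
  finally show ?thesis .
qed

definition proportion :: "nat \<Rightarrow> real" where
  "proportion n = real (card {A \<in> Sp n F. no_small_factor F t (char_poly A)}) / real (card (Sp n F))"

lemma proportion_approx:
  assumes L: "L * (1 + (\<Sum>p\<in>\<Phi>. Polynomial.degree p)) \<le> n"
  shows "\<bar>proportion n - (\<Prod>p\<in>\<Phi>. \<Sum>k\<le>L. local_term p k)\<bar>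
    \<le> (\<Prod>p\<in>\<Phi>. \<Sum>k\<le>2*n. \<bar>local_term p k\<bar>) - (\<Prod>p\<in>\<Phi>. \<Sum>k\<le>L. \<bar>local_term p k\<bar>)"
proof -
  interpret Sp_setting F n by unfold_locales
  have "hg.avoiding \<Phi> = mat_act ` {A \<in> Sp n F. no_small_factor F t (char_poly A)}"
    using no_small_factor_iff[of _ n] unfolding hg.avoiding_def by blast
  moreover have inj: "inj_on mat_act {A \<in> Sp n F. no_small_factor F t (char_poly A)}"
    by (rule inj_on_subset[OF inj_on_mat_act_Sp]) auto
  ultimately have peq: "proportion n = real (card (hg.avoiding \<Phi>)) / real (card (mat_act ` Sp n F))"
    unfolding proportion_def by (simp add: card_image card_image[OF inj_on_mat_act_Sp])
  \<comment> \<open>The cutoff \<open>K = 2*n\<close> comes from \<open>card_vecs_le\<close>; the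
    summand 1 in the hypothesis secures \<open>L \<le> K\<close>.\<close>
  have L': "L \<le> 2*n" "L * (\<Sum>p\<in>\<Phi>. Polynomial.degree p) \<le> n" using L by auto
  show ?thesis unfolding peq
    by (rule hg.avoiding_approx[OF finite_\<Phi> \<Phi>_mirr \<Phi>_conj card_vecs_le L'])
qed

text \<open>The cutoff \<open>L n = n div D\<close> tends to infinity slowly enough for
  \<open>proportion_approx\<close>, whose error bound is a difference of two partial products with
  the same limit.\<close>

lemma proportion_tendsto:
  assumes sum: "\<And>p. p \<in> \<Phi> \<Longrightarrow> summable (\<lambda>k. \<bar>local_term p k\<bar>)"
  shows "proportion \<longlonglongrightarrow> (\<Prod>p\<in>\<Phi>. suminf (local_term p))"
proof -
  define D where "D = 1 + (\<Sum>p\<in>\<Phi>. Polynomial.degree p)"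
  define L where "L n = n div D" for n
  have D: "D > 0" by (simp add: D_def)
  have Linf: "filterlim L at_top at_top"
    unfolding filterlim_at_top eventually_at_top_linorder
  proof (intro allI exI impI)
    fix z n assume "n \<ge> z * D"
    thus "L n \<ge> z" using D by (simp add: L_def less_eq_div_iff_mult_less_eq)
  qed
  have two: "filterlim (\<lambda>n::nat. 2 * n) at_top at_top"
    by (rule filterlim_subseq) (auto simp: strict_mono_def)
  have part: "(\<lambda>n. \<Prod>p\<in>\<Phi>. \<Sum>k\<le>n. f p k) \<longlonglongrightarrow> (\<Prod>p\<in>\<Phi>. suminf (f p))"
    if "\<And>p. p \<in> \<Phi> \<Longrightarrow> summable (f p)" for f :: "'a poly \<Rightarrow> nat \<Rightarrow> real"
    by (intro tendsto_prod summable_LIMSEQ' that)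
  let ?a = "\<lambda>p k. \<bar>local_term p k\<bar>"
  have main: "(\<lambda>n. \<Prod>p\<in>\<Phi>. \<Sum>k\<le>L n. local_term p k) \<longlonglongrightarrow> (\<Prod>p\<in>\<Phi>. suminf (local_term p))"
    by (rule filterlim_compose[OF part Linf]) (rule summable_rabs_cancel[OF sum])
  have "(\<lambda>n. (\<Prod>p\<in>\<Phi>. \<Sum>k\<le>2*n. ?a p k) - (\<Prod>p\<in>\<Phi>. \<Sum>k\<le>L n. ?a p k)) \<longlonglongrightarrow>
      (\<Prod>p\<in>\<Phi>. suminf (?a p)) - (\<Prod>p\<in>\<Phi>. suminf (?a p))"
    by (intro tendsto_diff filterlim_compose[OF part two] filterlim_compose[OF part Linf] sum)
  hence err: "(\<lambda>n. (\<Prod>p\<in>\<Phi>. \<Sum>k\<le>2*n. ?a p k) - (\<Prod>p\<in>\<Phi>. \<Sum>k\<le>L n. ?a p k)) \<longlonglongrightarrow> 0" by simp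
  have "(\<lambda>n. proportion n - (\<Prod>p\<in>\<Phi>. \<Sum>k\<le>L n. local_term p k)) \<longlonglongrightarrow> 0"
  proof (rule Lim_null_comparison[OF _ err], intro always_eventually allI)
    fix n
    have "L n * D \<le> n" by (simp add: L_def)
    from proportion_approx[OF this[unfolded D_def]]
    show "norm (proportion n - (\<Prod>p\<in>\<Phi>. \<Sum>k\<le>L n. local_term p k))
      \<le> (\<Prod>p\<in>\<Phi>. \<Sum>k\<le>2*n. ?a p k) - (\<Prod>p\<in>\<Phi>. \<Sum>k\<le>L n. ?a p k)" by simp
  qed
  from tendsto_add[OF this main] show ?thesis by simp
qed

end

section \<open>The local terms in the variable 1/q\<close>

context finite_subfield_2
begin

text \<open>Here and in the next two lemmas numerator and denominator are divided by the power
  \<open>Suc s\<close> of \<open>q^(deg p)\<close>, which gives the series of the matching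
  \<open>local_factor\<close> lemma.\<close>

lemma local_term_unipotent: "local_term [:1, 1:] k = (\<Prod>s<k. - (1 / real q) / (1 - (1 / real q) ^ Suc s))"
proof -
  have q: "real q > 0" using q_ge_2 by simp
  have sc: "[:1, 1:] = conjugate_poly ([:1, 1:] :: 'a poly)"
    by (simp add: conjugate_poly_def reflect_poly_pCons)
  show ?thesis unfolding local_term_def
  proof (rule prod.cong[OF refl])
    fix s
    have "real q ^ Suc s \<noteq> 0" using q by simp
    thus "- real (form_weight [:1, 1:] s) / (real (q ^ Polynomial.degree ([:1, 1:] :: 'a poly)) ^ Suc s - 1) =
      - (1 / real q) / (1 - (1 / real q) ^ Suc s)"
      using q sc[symmetric] by (simp add: form_weight_def power_one_over divide_simps)
  qed
qed

lemma local_term_self_conjugate: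
  assumes p: "mirr p" "p = conjugate_poly p" "p \<noteq> [:1, 1:]" "Polynomial.degree p = 2 * j"
  shows "local_term p k = (\<Prod>s<k. - (1 / real q ^ j) / (1 - ((1 / real q ^ j)\<^sup>2) ^ Suc s))"
  unfolding local_term_def
proof (rule prod.cong[OF refl])
  fix s
  define r where "r = real q ^ j"
  have r: "r > 0" using q_ge_2 by (simp add: r_def)
  have w: "real (form_weight p s) = r * (r\<^sup>2) ^ s"
    using p(2-4) by (simp add: form_weight_def r_def power_mult[symmetric] mult_ac)
  have Q: "real (q ^ Polynomial.degree p) = r\<^sup>2" by (simp add: p(4) r_def power_mult[symmetric] mult.commute)
  have "- (r * (r\<^sup>2) ^ s) / ((r\<^sup>2) ^ Suc s - 1) = - (1 / r) / (1 - ((1 / r)\<^sup>2) ^ Suc s)"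
    using r by (simp add: power_one_over divide_simps power2_eq_square)
  thus "- real (form_weight p s) / (real (q ^ Polynomial.degree p) ^ Suc s - 1) =
      - (1 / real q ^ j) / (1 - ((1 / real q ^ j)\<^sup>2) ^ Suc s)"
    unfolding w Q r_def .
qed

lemma local_term_pair:
  assumes p: "p \<noteq> conjugate_poly p"
  shows "local_term p k = (\<Prod>s<k. - ((1 / real q ^ Polynomial.degree p) ^ Suc s) / (1 - (1 / real q ^ Polynomial.degree p) ^ Suc s))"
  unfolding local_term_def
proof (rule prod.cong[OF refl])
  fix s
  define r where "r = real q ^ Polynomial.degree p"
  have r: "r > 0" using q_ge_2 by (simp add: r_def)
  have "- 1 / (r ^ Suc s - 1) = - ((1 / r) ^ Suc s) / (1 - (1 / r) ^ Suc s)"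
    using r by (simp add: power_one_over divide_simps)
  thus "- real (form_weight p s) / (real (q ^ Polynomial.degree p) ^ Suc s - 1) =
      - ((1 / real q ^ Polynomial.degree p) ^ Suc s) / (1 - (1 / real q ^ Polynomial.degree p) ^ Suc s)"
    using p by (simp add: form_weight_def r_def del: power_Suc)
qed

end

section \<open>Bounds for the infinite products\<close>

text \<open>The bound \<open>exp (- 4 * y)\<close> also serves to keep the limit away from 0, which
  is required to identify it with \<open>prodinf\<close>. The upper bound \<open>1 - y\<close> is
  the factor at \<open>i = 0\<close>.\<close>

lemma prod_limits:
  fixes y :: real
  assumes y: "0 < y" "y \<le> 1/2"
  shows "(\<lambda>N. \<Prod>i<N. 1 - y ^ (2 * i + 1)) \<longlonglongrightarrow> (\<Prod>i. 1 - y ^ (2 * i + 1))"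
      "exp (- 4 * y) \<le> (\<Prod>i. 1 - y ^ (2 * i + 1))" "(\<Prod>i. 1 - y ^ (2 * i + 1)) \<le> 1 - y"
    and "(\<lambda>N. \<Prod>i<N. 1 + (-1) ^ Suc i * y ^ Suc i) \<longlonglongrightarrow> (\<Prod>i. 1 + (-1) ^ Suc i * y ^ Suc i)"
      "exp (- 4 * y) \<le> (\<Prod>i. 1 + (-1) ^ Suc i * y ^ Suc i)" "(\<Prod>i. 1 + (-1) ^ Suc i * y ^ Suc i) \<le> 1"
    and "(\<lambda>N. \<Prod>i<N. 1 - y ^ Suc i) \<longlonglongrightarrow> (\<Prod>i. 1 - y ^ Suc i)"
      "exp (- 4 * y) \<le> (\<Prod>i. 1 - y ^ Suc i)" "(\<Prod>i. 1 - y ^ Suc i) \<le> 1 - y"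
proof -
  have y1: "0 < y" "y < 1" using y by auto
  have *: "(\<lambda>N. prod f {..<N}) \<longlonglongrightarrow> prodinf f \<and> exp (- 4 * y) \<le> prodinf f \<and> prodinf f \<le> B"
    if lim: "(\<lambda>N. prod f {..<N}) \<longlonglongrightarrow> a" and lo: "\<And>N. exp (- 4 * y) \<le> prod f {..<N}"
      and up: "\<And>N. N \<ge> 1 \<Longrightarrow> prod f {..<N} \<le> B" for f :: "nat \<Rightarrow> real" and a B
  proof -
    have ge: "exp (- 4 * y) \<le> a" by (rule LIMSEQ_le_const[OF lim]) (use lo in blast)
    have "a \<le> B" by (rule LIMSEQ_le_const2[OF lim]) (use up in blast)
    moreover have "prodinf f = a"
      by (rule prodinf_eq_prod_lim'[OF lim]) (use ge exp_gt_zero[of "- 4 * y"] in linarith)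
    ultimately show ?thesis using lim ge by simp
  qed
  have up: "prod f {..<N} \<le> 1 - y" if f: "f 0 = 1 - y" "\<And>i. 0 \<le> f i" "\<And>i. f i \<le> 1" and N: "N \<ge> 1"
    for f :: "nat \<Rightarrow> real" and N
  proof -
    obtain M where M: "N = Suc M" using N by (cases N) auto
    have "prod f {..<N} = f 0 * (\<Prod>i<M. f (Suc i))" unfolding M by (rule prod.lessThan_Suc_shift)
    also have "\<dots> \<le> f 0 * 1" by (rule mult_left_mono[OF prod_le_1 f(2)]) (simp add: f(2,3))
    finally show ?thesis using f by simp
  qed
  have p1: "0 \<le> y ^ k" "y ^ k \<le> 1" for k using y1 by (auto intro: power_le_one)
  have dec: "y ^ (2 * i + 1) \<le> y ^ Suc i" for i using y1 by (intro power_decreasing) auto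
  note A = *[OF local_factor_unipotent(2)[OF y1] prod_one_minus_lower_bound[OF _ dec y] up]
  note B = *[OF local_factor_unitary(2)[OF y1] unitary_prod_bounds(1)[OF y] unitary_prod_bounds(2)[OF y]]
  note C = *[OF local_factor_linear(2)[OF y1] prod_one_minus_lower_bound[OF _ order.refl y] up]
  show "(\<lambda>N. \<Prod>i<N. 1 - y ^ (2 * i + 1)) \<longlonglongrightarrow> (\<Prod>i. 1 - y ^ (2 * i + 1))"
      "exp (- 4 * y) \<le> (\<Prod>i. 1 - y ^ (2 * i + 1))" "(\<Prod>i. 1 - y ^ (2 * i + 1)) \<le> 1 - y"
    using A p1 by (simp_all del: power_Suc)
  show "(\<lambda>N. \<Prod>i<N. 1 + (-1) ^ Suc i * y ^ Suc i) \<longlonglongrightarrow> (\<Prod>i. 1 + (-1) ^ Suc i * y ^ Suc i)"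
      "exp (- 4 * y) \<le> (\<Prod>i. 1 + (-1) ^ Suc i * y ^ Suc i)" "(\<Prod>i. 1 + (-1) ^ Suc i * y ^ Suc i) \<le> 1"
    using B by blast+
  show "(\<lambda>N. \<Prod>i<N. 1 - y ^ Suc i) \<longlonglongrightarrow> (\<Prod>i. 1 - y ^ Suc i)"
      "exp (- 4 * y) \<le> (\<Prod>i. 1 - y ^ Suc i)" "(\<Prod>i. 1 - y ^ Suc i) \<le> 1 - y"
    using C p1 by (simp_all del: power_Suc)
qed

lemma reciprocal_power_bounds:
  assumes "(q::nat) \<ge> 2" "j \<ge> 1"
  shows "0 < 1 / real q ^ j" "1 / real q ^ j \<le> 1/2"
proof -
  have "real 2 \<le> real q" unfolding of_nat_le_iff by (rule assms)
  moreover have "real q ^ 1 \<le> real q ^ j" using calculation assms by (intro power_increasing) simp_all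
  ultimately have 2: "2 \<le> real q ^ j" unfolding power_one_right by linarith
  hence 0: "0 < real q ^ j" by linarith
  show "0 < 1 / real q ^ j" using 0 by (simp only: zero_less_divide_1_iff)
  show "1 / real q ^ j \<le> 1/2" using frac_le[of 1 1 2 "real q ^ j"] 2 by simp
qed

lemma prodinf_power_of_limit:
  fixes f :: "nat \<Rightarrow> real"
  assumes "(\<lambda>N. prod f {..<N}) \<longlonglongrightarrow> a" "exp c \<le> a"
  shows "(\<Prod>i. f i ^ m) = a ^ m"
proof (rule prodinf_eq_prod_lim')
  show "(\<lambda>N. \<Prod>i<N. f i ^ m) \<longlonglongrightarrow> a ^ m"
    unfolding prod_power_distrib[symmetric] by (rule tendsto_power[OF assms(1)])
  have "a > 0" using assms(2) exp_gt_zero[of c] by linarith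
  thus "a ^ m \<noteq> 0" by simp
qed

text \<open>The factors of \<open>Q_Sp\<close> with the exponents \<open>Nstar\<close> and
  \<open>Mstar\<close> taken outside: for \<open>z + 1\<close>, for a self-conjugate polynomial of
  degree \<open>2 * j\<close>, and for a conjugate pair of degree \<open>j\<close>. The last two
  names recall the unitary and general linear groups that occur in centralisers of semisimple
  elements.\<close>

definition "unipotent_product q = (\<Prod>i. 1 - (1 / real q) ^ (2 * i + 1))"
definition "unitary_product q j = (\<Prod>i. 1 + (-1) ^ Suc i * (1 / real q ^ j) ^ Suc i)"
definition "linear_product q j = (\<Prod>i. 1 - (1 / real q ^ j) ^ Suc i)"

lemma Q_Sp_eq:
  assumes q: "q \<ge> 2"
  shows "Q_Sp q t = unipotent_product q * (\<Prod>j\<in>{1..t div 2}. unitary_product q j ^ Nstar q (2 * j)) *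
    (\<Prod>j\<in>{1..t}. linear_product q j ^ Mstar q j)"
proof -
  have pw: "1 / real q ^ (Suc i * j) = (1 / real q ^ j) ^ Suc i" for i j
    by (simp add: power_one_over power_mult[symmetric] mult.commute del: power_Suc)
  have 1: "(\<Prod>i. 1 - 1 / real q ^ (2 * Suc i - 1)) = unipotent_product q"
    by (simp add: unipotent_product_def power_one_over)
  have pw': "(-1) ^ Suc i / real q ^ (Suc i * j) = (-1) ^ Suc i * (1 / real q ^ j) ^ Suc i" for i j
    by (simp only: pw[symmetric] times_divide_eq_right mult_1_right)
  have 2: "(\<Prod>j\<in>{1..t div 2}. \<Prod>i. (1 + (-1) ^ Suc i / real q ^ (Suc i * j)) ^ Nstar q (2 * j)) =
    (\<Prod>j\<in>{1..t div 2}. unitary_product q j ^ Nstar q (2 * j))"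
  proof (intro prod.cong refl)
    fix j assume "j \<in> {1..t div 2}"
    hence y: "0 < 1 / real q ^ j" "1 / real q ^ j \<le> 1/2" using reciprocal_power_bounds[OF q] by auto
    show "(\<Prod>i. (1 + (-1) ^ Suc i / real q ^ (Suc i * j)) ^ Nstar q (2 * j)) = unitary_product q j ^ Nstar q (2 * j)"
      unfolding pw' unitary_product_def by (rule prodinf_power_of_limit[OF prod_limits(4,5)[OF y]])
  qed
  have 3: "(\<Prod>j\<in>{1..t}. \<Prod>i. (1 - 1 / real q ^ (Suc i * j)) ^ Mstar q j) = (\<Prod>j\<in>{1..t}. linear_product q j ^ Mstar q j)"
  proof (intro prod.cong refl)
    fix j assume "j \<in> {1..t}"
    hence y: "0 < 1 / real q ^ j" "1 / real q ^ j \<le> 1/2" using reciprocal_power_bounds[OF q] by auto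
    show "(\<Prod>i. (1 - 1 / real q ^ (Suc i * j)) ^ Mstar q j) = linear_product q j ^ Mstar q j"
      unfolding pw linear_product_def by (rule prodinf_power_of_limit[OF prod_limits(7,8)[OF y]])
  qed
  show ?thesis unfolding Q_Sp_def by (simp only: 1 2 3)
qed

lemma unipotent_product_bounds:
  assumes "q \<ge> 2"
  shows "exp (- 4 * (1 / real q)) \<le> unipotent_product q" "unipotent_product q \<le> 1 - 1 / real q"
  using prod_limits(2,3)[OF reciprocal_power_bounds[OF assms order.refl[of 1]]] by (simp_all add: unipotent_product_def)

lemma unitary_product_bounds:
  assumes "q \<ge> 2" "j \<ge> 1"
  shows "exp (- 4 * (1 / real q ^ j)) \<le> unitary_product q j" "unitary_product q j \<le> 1"
  using prod_limits(5,6)[OF reciprocal_power_bounds[OF assms]] by (simp_all only: unitary_product_def)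

lemma linear_product_bounds:
  assumes "q \<ge> 2" "j \<ge> 1"
  shows "exp (- 4 * (1 / real q ^ j)) \<le> linear_product q j" "linear_product q j \<le> 1 - 1 / real q ^ j"
  using prod_limits(8,9)[OF reciprocal_power_bounds[OF assms]] by (simp_all only: linear_product_def)

text \<open>A factor of at least \<open>exp (- 4 / q^j)\<close> is raised to an exponent of at most
  \<open>q^j\<close>, so each \<open>j\<close> costs at most \<open>exp (- 4)\<close>; the unipotent
  factor costs \<open>exp (- 4 / q) \<ge> exp (- 2)\<close>.\<close>

lemma Q_Sp_lower_bound:
  assumes q: "q \<ge> 2" and N: "\<And>j. j \<ge> 1 \<Longrightarrow> Nstar q (2 * j) \<le> q ^ j" and M: "\<And>j. j \<ge> 1 \<Longrightarrow> Mstar q j \<le> q ^ j"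
  shows "exp (- 2) * exp (- 4) ^ (t div 2) * exp (- 4) ^ t \<le> Q_Sp q t"
proof -
  have pow: "exp (- 4) \<le> x ^ m" if x: "exp (- 4 * (1 / real q ^ j)) \<le> x" and m: "m \<le> q ^ j" for x m j
  proof -
    have "real m \<le> real q ^ j" using m by (metis of_nat_le_iff of_nat_power)
    hence "real m * (1 / real q ^ j) \<le> 1" using q by (simp add: divide_simps)
    hence "- 4 \<le> real m * (- 4 * (1 / real q ^ j))" by (simp only: mult.left_commute[of "real m"])
    hence "exp (- 4) \<le> exp (real m * (- 4 * (1 / real q ^ j)))" by (simp only: exp_le_cancel_iff)
    also have "\<dots> = exp (- 4 * (1 / real q ^ j)) ^ m" by (rule exp_of_nat_mult)
    also have "\<dots> \<le> x ^ m" using x by (rule power_mono) simp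
    finally show ?thesis .
  qed
  have "1 / real q \<le> 1/2" using q by (simp add: divide_simps)
  hence "exp (- 2) \<le> exp (- 4 * (1 / real q))" by (simp only: exp_le_cancel_iff)
  hence 1: "exp (- 2) \<le> unipotent_product q" using unipotent_product_bounds(1)[OF q] by linarith
  have "(\<Prod>j\<in>{1..t div 2}. exp (- 4)) \<le> (\<Prod>j\<in>{1..t div 2}. unitary_product q j ^ Nstar q (2 * j))"
    by (intro prod_mono conjI pow[OF unitary_product_bounds(1)[OF q] N]) auto
  hence 2: "exp (- 4) ^ (t div 2) \<le> (\<Prod>j\<in>{1..t div 2}. unitary_product q j ^ Nstar q (2 * j))"
    by simp
  have "(\<Prod>j\<in>{1..t}. exp (- 4)) \<le> (\<Prod>j\<in>{1..t}. linear_product q j ^ Mstar q j)"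
    by (intro prod_mono conjI pow[OF linear_product_bounds(1)[OF q] M]) auto
  hence 3: "exp (- 4) ^ t \<le> (\<Prod>j\<in>{1..t}. linear_product q j ^ Mstar q j)" by simp
  have "0 \<le> unipotent_product q" by (rule order_trans[OF _ 1]) simp
  moreover have "0 \<le> (\<Prod>j\<in>{1..t div 2}. unitary_product q j ^ Nstar q (2 * j))" by (rule order_trans[OF _ 2]) simp
  ultimately show ?thesis unfolding Q_Sp_eq[OF q]
    by (intro mult_mono 1 2 3 mult_nonneg_nonneg) simp_all
qed

text \<open>For \<open>q \<ge> 4\<close> the exponent \<open>m\<close> at degree 1 is at least
  \<open>(q - 2) / 2 \<ge> q / 4\<close>, so
  \<open>(1 - 1/q)^m \<le> exp (- m / q) \<le> exp (- 1 / 4)\<close>. For \<open>q = 2\<close> the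
  unipotent factor is at most \<open>1/2\<close>, which is below
  \<open>3/4 \<le> exp (- 1 / 4)\<close>.\<close>

lemma Q_Sp_upper_bound:
  assumes q: "q = 2 \<or> q \<ge> 4" and t: "t \<ge> 1" and M: "q \<le> 2 * Mstar q 1 + 2"
  shows "Q_Sp q t \<le> exp (- 1 / 4)"
proof -
  have q2: "q \<ge> 2" using q by auto
  have iq: "0 < 1 / real q" using q2 by simp
  have U: "0 \<le> unipotent_product q" "unipotent_product q \<le> 1 - 1 / real q" "unipotent_product q \<le> 1"
    using unipotent_product_bounds[OF q2] exp_gt_zero[of "- 4 * (1 / real q)"] iq by linarith+
  have W: "0 \<le> unitary_product q j" "unitary_product q j \<le> 1" if "j \<ge> 1" for j
    using unitary_product_bounds[OF q2 that] exp_gt_zero[of "- 4 * (1 / real q ^ j)"] by linarith+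
  have L: "0 \<le> linear_product q j" "linear_product q j \<le> 1" if "j \<ge> 1" for j
    using linear_product_bounds[OF q2 that] exp_gt_zero[of "- 4 * (1 / real q ^ j)"]
      reciprocal_power_bounds(1)[OF q2 that] by linarith+
  have L1: "linear_product q 1 \<le> 1 - 1 / real q" using linear_product_bounds(2)[OF q2, of 1] by simp
  define m where "m = Mstar q 1"
  define v where "v = linear_product q 1"
  define w where "w = (\<Prod>j\<in>{1..t div 2}. unitary_product q j ^ Nstar q (2 * j))"
  have w: "w \<le> 1" "0 \<le> w" unfolding w_def
    using W by (auto intro!: prod_le_1 prod_nonneg power_le_one)
  have v: "0 \<le> v" "v \<le> 1" "v \<le> 1 - 1 / real q" using L[of 1] L1 by (simp_all add: v_def)
  define l where "l = (\<Prod>j\<in>{1..t}. linear_product q j ^ Mstar q j)"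
  have "l = v ^ m * (\<Prod>j\<in>{1..t} - {1}. linear_product q j ^ Mstar q j)"
    unfolding l_def v_def m_def using t by (intro prod.remove) auto
  also have "\<dots> \<le> v ^ m * 1"
  proof (rule mult_left_mono)
    show "(\<Prod>j\<in>{1..t} - {1}. linear_product q j ^ Mstar q j) \<le> 1"
      using L by (intro prod_le_1) (auto intro!: power_le_one)
  qed (use v in simp)
  finally have l: "l \<le> v ^ m" by simp
  have l0: "0 \<le> l" unfolding l_def using L by (auto intro!: prod_nonneg)
  have "Q_Sp q t = unipotent_product q * w * l"
    unfolding Q_Sp_eq[OF q2] w_def l_def ..
  also have "\<dots> \<le> unipotent_product q * 1 * v ^ m"
    using U w l l0 by (intro mult_mono) simp_all
  finally have Q: "Q_Sp q t \<le> unipotent_product q * v ^ m" by simp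
  show ?thesis
  proof (cases "q = 2")
    case True
    have "unipotent_product q * v ^ m \<le> (1/2) * 1" using U v True by (intro mult_mono power_le_one) simp_all
    also have "\<dots> \<le> 1 + (- 1 / 4 :: real)" by simp
    also have "\<dots> \<le> exp (- 1 / 4)" by (rule exp_ge_add_one_self)
    finally show ?thesis using Q by linarith
  next
    case False
    hence q4: "q \<ge> 4" using q by auto
    have "q \<le> 4 * m" using M q4 unfolding m_def by linarith
    hence "real q \<le> 4 * real m" by linarith
    hence "real m * - (1 / real q) \<le> - 1 / 4" using q4 by (simp add: divide_simps)
    hence e: "exp (real m * - (1 / real q)) \<le> exp (- 1 / 4)" by (simp only: exp_le_cancel_iff)
    have "1 - 1 / real q \<le> exp (- (1 / real q))" using exp_ge_add_one_self[of "- (1 / real q)"] by simp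
    hence "v \<le> exp (- (1 / real q))" using v by simp
    hence "v ^ m \<le> exp (- (1 / real q)) ^ m" using v by (intro power_mono)
    also have "\<dots> \<le> exp (- 1 / 4)" using e by (simp only: exp_of_nat_mult)
    finally have "unipotent_product q * v ^ m \<le> 1 * exp (- 1 / 4)" using U v by (intro mult_mono) simp_all
    thus ?thesis using Q by simp
  qed
qed

section \<open>Conjugacy classes of irreducible polynomials\<close>

lemma (in finite_subfield) monic_irreds_iff: "p \<in> monic_irreds F j \<longleftrightarrow> mirr p \<and> Polynomial.degree p = j"
  by (auto simp: monic_irreds_def mirr_def)

lemma (in finite_subfield) card_monic_irreds:
  assumes "j \<ge> 1"
  shows "finite (monic_irreds F j)" "card (monic_irreds F j) \<le> q ^ j"
proof -
  have sub: "(\<lambda>p. p - Polynomial.monom 1 j) ` monic_irreds F j \<subseteq> small_polys j"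
  proof (rule image_subsetI)
    fix p assume "p \<in> monic_irreds F j"
    hence p: "mirr p" "Polynomial.degree p = j" by (simp_all add: monic_irreds_iff)
    let ?r = "p - Polynomial.monom 1 j"
    have c: "Polynomial.coeff ?r i = (if i = j then 0 else Polynomial.coeff p i)" for i
      using mirr_D(3)[OF p(1)] p(2) by simp
    have "?r \<in> P" unfolding polys_over_def
      using P_coeff[OF mirr_D(2)[OF p(1)]] F_0 by (simp only: c mem_Collect_eq) simp
    moreover have "Polynomial.degree ?r < j" if "?r \<noteq> 0"
    proof -
      have "Polynomial.coeff ?r i = 0" if "i > j - 1" for i
        using that p(2) coeff_eq_0[of p i] by (simp only: c) simp
      hence "Polynomial.degree ?r \<le> j - 1" by (intro degree_le) blast
      thus ?thesis using assms by simp
    qed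
    ultimately show "?r \<in> small_polys j" by (auto simp: small_polys_def)
  qed
  have inj: "inj_on (\<lambda>p. p - Polynomial.monom 1 j) (monic_irreds F j)" by (simp add: inj_on_def)
  show "finite (monic_irreds F j)"
    by (rule inj_on_finite[OF inj sub finite_small_polys])
  show "card (monic_irreds F j) \<le> q ^ j"
    using card_inj_on_le[OF inj sub finite_small_polys] by (simp only: card_small_polys)
qed

lemma (in finite_subfield) mirr_linear:
  assumes "c \<in> F" "c \<noteq> 0"
  shows "mirr [:c, 1:]"
proof -
  have "Polynomial.degree g = 0 \<or> Polynomial.degree h = 0" if "[:c, 1:] = g * h" for g h :: "'a poly"
  proof -
    have "g \<noteq> 0" "h \<noteq> 0" using that by auto
    hence "Polynomial.degree g + Polynomial.degree h = 1" using degree_mult_eq[of g h] that[symmetric] by simp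
    thus ?thesis by linarith
  qed
  moreover have "[:c, 1:] \<in> P" using assms by (intro P_pCons F_1 P_0)
  ultimately show ?thesis using assms by (simp add: mirr_def irreducible_over_def)
qed

context finite_subfield_2
begin

lemma conjugate_linear: "c \<noteq> 0 \<Longrightarrow> conjugate_poly [:c, 1:] = [:inverse c, 1::'a:]"
  by (simp add: conjugate_poly_def reflect_poly_pCons' monom_Suc monom_0 one_pCons)

definition self_conjugates :: "nat \<Rightarrow> 'a poly set" where
  "self_conjugates j = {p \<in> monic_irreds F j. p = conjugate_poly p}"

definition conjugate_pairs :: "nat \<Rightarrow> 'a poly set set" where
  "conjugate_pairs j = {{p, conjugate_poly p} | p.
     {p, conjugate_poly p} \<subseteq> monic_irreds F j \<and> p \<noteq> conjugate_poly p}"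

lemma self_conjugates_iff: "p \<in> self_conjugates j \<longleftrightarrow> mirr p \<and> Polynomial.degree p = j \<and> p = conjugate_poly p"
  by (auto simp: self_conjugates_def monic_irreds_iff)

lemma finite_self_conjugates: "j \<ge> 1 \<Longrightarrow> finite (self_conjugates j)"
  using card_monic_irreds(1) by (simp add: self_conjugates_def)

text \<open>Constant term 1 and palindromic symmetry leave only the coefficients at
  \<open>1..j\<close> free.\<close>

lemma card_self_conjugates:
  assumes j: "j \<ge> 1"
  shows "card (self_conjugates (2 * j)) \<le> q ^ j"
proof -
  let ?f = "\<lambda>p. \<lambda>a\<in>{..<j}. Polynomial.coeff p (Suc a)"
  have D: "Polynomial.coeff p 0 = 1" "\<And>k. Polynomial.coeff p (2 * j - k) = Polynomial.coeff p k \<or> k > 2 * j" "Polynomial.degree p = 2 * j"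
    if "p \<in> self_conjugates (2 * j)" for p
  proof -
    have p: "mirr p" "p = conjugate_poly p" "Polynomial.degree p = 2 * j" using that unfolding self_conjugates_iff by blast+
    note r = self_conjugate_reflect[OF p(1,2)]
    show "Polynomial.coeff p 0 = 1" using r(1) by (simp only: poly_0_coeff_0)
    show "Polynomial.coeff p (2 * j - k) = Polynomial.coeff p k \<or> k > 2 * j" for k
      using arg_cong[OF r(2), of "\<lambda>p. Polynomial.coeff p k"] p(3) by (auto simp: coeff_reflect_poly split: if_splits)
    show "Polynomial.degree p = 2 * j" by (rule p)
  qed
  have "inj_on ?f (self_conjugates (2 * j))"
  proof (rule inj_onI, rule poly_eqI)
    fix p r k assume p: "p \<in> self_conjugates (2 * j)" and r: "r \<in> self_conjugates (2 * j)" and e: "?f p = ?f r"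
    have low: "Polynomial.coeff p i = Polynomial.coeff r i" if "i \<le> j" for i
    proof (cases i)
      case 0
      thus ?thesis using D(1)[OF p] D(1)[OF r] by simp
    next
      case (Suc a)
      thus ?thesis using fun_cong[OF e, of a] that by simp
    qed
    show "Polynomial.coeff p k = Polynomial.coeff r k"
    proof (cases "k \<le> j \<or> k > 2 * j")
      case True
      thus ?thesis using low[of k] D(3)[OF p] D(3)[OF r] by (auto simp: coeff_eq_0)
    next
      case False
      thus ?thesis using low[of "2 * j - k"] D(2)[OF p, of k] D(2)[OF r, of k] by auto
    qed
  qed
  moreover have "?f ` self_conjugates (2 * j) \<subseteq> ({..<j} \<rightarrow>\<^sub>E F)"
    using P_coeff mirr_D(2) by (auto simp: self_conjugates_iff split: if_splits)
  moreover have "finite ({..<j} \<rightarrow>\<^sub>E F)" by (intro finite_PiE) (auto simp: finite_F)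
  ultimately have "card (self_conjugates (2 * j)) \<le> card ({..<j} \<rightarrow>\<^sub>E F)" by (rule card_inj_on_le)
  thus ?thesis by (simp add: card_PiE)
qed

lemma conjugate_pairs_subset: "conjugate_pairs j \<subseteq> (\<lambda>p. {p, conjugate_poly p}) ` monic_irreds F j"
  by (auto simp: conjugate_pairs_def)

lemma card_conjugate_pairs:
  assumes "j \<ge> 1"
  shows "finite (conjugate_pairs j)" "card (conjugate_pairs j) \<le> q ^ j"
proof -
  note M = card_monic_irreds[OF assms]
  show "finite (conjugate_pairs j)"
    by (rule finite_subset[OF conjugate_pairs_subset finite_imageI[OF M(1)]])
  have "card (conjugate_pairs j) \<le> card ((\<lambda>p. {p, conjugate_poly p}) ` monic_irreds F j)"
    by (rule card_mono[OF finite_imageI[OF M(1)] conjugate_pairs_subset])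
  also have "\<dots> \<le> card (monic_irreds F j)" by (rule card_image_le[OF M(1)])
  finally show "card (conjugate_pairs j) \<le> q ^ j" using M(2) by linarith
qed

text \<open>For \<open>c\<close> other than 0 and 1 the conjugate of \<open>z + c\<close> is
  \<open>z + 1/c\<close>, and \<open>c = 1/c\<close> would give \<open>(c + 1)^2 = 0\<close> in
  characteristic two. Each pair accounts for at most two such \<open>c\<close>.\<close>

lemma card_conjugate_pairs_1: "q \<le> 2 * card (conjugate_pairs 1) + 2"
proof -
  have "(\<lambda>c. [:c, 1:]) ` (F - {0, 1}) \<subseteq> \<Union>(conjugate_pairs 1)"
  proof (rule image_subsetI)
    fix c assume c: "c \<in> F - {0, 1}"
    hence c': "c \<in> F" "c \<noteq> 0" by auto
    have "c \<noteq> inverse c"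
    proof
      assume "c = inverse c"
      hence "c * c = 1" using c'(2) by (metis right_inverse)
      hence "(c + 1) * (c + 1) = 0" by (simp add: algebra_simps)
      hence "c + 1 = 0" by simp
      hence "c = - 1" by (rule eq_neg_iff_add_eq_0[THEN iffD2])
      thus False using c by simp
    qed
    moreover have "[:c, 1:] \<in> monic_irreds F 1" "[:inverse c, 1:] \<in> monic_irreds F 1"
      using mirr_linear[of c] mirr_linear[of "inverse c"] c' F_inverse by (simp_all add: monic_irreds_iff)
    ultimately have "{[:c, 1:], [:inverse c, 1:]} \<in> conjugate_pairs 1"
      unfolding conjugate_pairs_def using conjugate_linear[OF c'(2)] by (intro CollectI exI[of _ "[:c, 1:]"]) simp
    thus "[:c, 1:] \<in> \<Union>(conjugate_pairs 1)" by blast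
  qed
  moreover have fin: "finite (\<Union>(conjugate_pairs 1))"
    using card_conjugate_pairs(1)[of 1] by (auto simp: conjugate_pairs_def)
  moreover have "inj_on (\<lambda>c. [:c, 1:]) (F - {0, 1})" by (simp add: inj_on_def)
  ultimately have "card (F - {0, 1}) \<le> card (\<Union>(conjugate_pairs 1))"
    by (metis card_inj_on_le)
  also have "\<dots> \<le> (\<Sum>s\<in>conjugate_pairs 1. card s)" by (rule card_Union_le_sum_card)
  also have "\<dots> \<le> (\<Sum>s\<in>conjugate_pairs 1. 2)"
    by (rule sum_mono) (auto simp: conjugate_pairs_def card_insert_if)
  finally have "card (F - {0, 1}) \<le> 2 * card (conjugate_pairs 1)" by simp
  moreover have "card (F - {0, 1}) = q - 2" using F_0 F_1 by (simp add: card_Diff_subset)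
  ultimately show ?thesis by linarith
qed

definition representative :: "'a poly set \<Rightarrow> 'a poly" where
  "representative s = (SOME p. p \<in> s)"

lemma representative:
  assumes "s \<in> conjugate_pairs j"
  shows "mirr (representative s)" "Polynomial.degree (representative s) = j"
    "representative s \<noteq> conjugate_poly (representative s)" "s = {representative s, conjugate_poly (representative s)}"
proof -
  obtain p where p: "s = {p, conjugate_poly p}" "mirr p" "Polynomial.degree p = j" "p \<noteq> conjugate_poly p"
    using assms by (auto simp: conjugate_pairs_def monic_irreds_iff)
  have "representative s \<in> s" unfolding representative_def by (rule someI[of _ p]) (simp add: p)
  hence r: "representative s = p \<or> representative s = conjugate_poly p" using p by blast
  note C = conjugate_props[OF p(2)]
  show "mirr (representative s)" "Polynomial.degree (representative s) = j"
    "representative s \<noteq> conjugate_poly (representative s)" "s = {representative s, conjugate_poly (representative s)}"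
    using r p C mirr_conjugate[OF p(2)] by auto
qed

text \<open>\<open>z + 1\<close> stands apart because every other self-conjugate irreducible
  polynomial has even degree.\<close>

definition class_representatives :: "nat \<Rightarrow> 'a poly set" where
  "class_representatives t = {[:1, 1:]} \<union> (\<Union>j\<in>{1..t div 2}. self_conjugates (2 * j)) \<union>
     (\<Union>j\<in>{1..t}. representative ` conjugate_pairs j)"

lemma conjugate_unipotent: "conjugate_poly [:1, 1:] = [:1, 1::'a:]"
  using conjugate_linear[of 1] by simp

lemma class_representatives_cases:
  assumes "p \<in> class_representatives t"
  obtains "p = [:1, 1:]"
  | j where "j \<in> {1..t div 2}" "mirr p" "Polynomial.degree p = 2 * j" "p = conjugate_poly p" "p \<noteq> [:1, 1:]"
  | j s where "j \<in> {1..t}" "s \<in> conjugate_pairs j" "p = representative s"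
proof -
  have ne: "p \<noteq> [:1, 1:]" if "Polynomial.degree p = 2 * j" for j using that by auto
  consider "p = [:1, 1:]" | j where "j \<in> {1..t div 2}" "p \<in> self_conjugates (2 * j)"
    | j s where "j \<in> {1..t}" "s \<in> conjugate_pairs j" "p = representative s"
    using assms unfolding class_representatives_def by auto
  thus ?thesis using that ne unfolding self_conjugates_iff by (cases) metis+
qed

lemma factor_representatives_class:
  assumes "t \<ge> 1"
  shows "finite (class_representatives t)"
    "\<And>p. p \<in> class_representatives t \<Longrightarrow> mirr p" "\<And>p. p \<in> class_representatives t \<Longrightarrow> Polynomial.degree p \<le> t"
    "\<And>p r. p \<in> class_representatives t \<Longrightarrow> r \<in> class_representatives t \<Longrightarrow> p = conjugate_poly r \<Longrightarrow> p = r"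
    "\<And>p. mirr p \<Longrightarrow> Polynomial.degree p \<le> t \<Longrightarrow> p \<in> class_representatives t \<or> conjugate_poly p \<in> class_representatives t"
proof -
  have u: "mirr [:1, 1:]" by (rule mirr_linear) (auto simp: F_1)
  show "finite (class_representatives t)"
    unfolding class_representatives_def using finite_self_conjugates card_conjugate_pairs(1) by auto
  show m: "mirr p" if "p \<in> class_representatives t" for p
    using that by (cases rule: class_representatives_cases) (use u representative(1) in auto)
  show "Polynomial.degree p \<le> t" if "p \<in> class_representatives t" for p
    using that by (cases rule: class_representatives_cases) (use assms representative(2) in auto)
  show "p = r" if p: "p \<in> class_representatives t" and r: "r \<in> class_representatives t" and e: "p = conjugate_poly r" for p r
  proof (cases "r = conjugate_poly r")
    case False
    \<comment> \<open>Neither polynomial is self-conjugate, so both were chosen from pairs; the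
      pairs coincide, hence so do the choices.\<close>
    have r': "conjugate_poly p = r" unfolding e by (rule conjugate_props(5)[OF m[OF r]])
    obtain i s where s: "s \<in> conjugate_pairs i" "r = representative s"
      using class_representatives_cases[OF r] False conjugate_unipotent by metis
    have np: "p \<noteq> conjugate_poly p" using False e r' by metis
    obtain j v where v: "v \<in> conjugate_pairs j" "p = representative v"
      using class_representatives_cases[OF p] np conjugate_unipotent by metis
    have "s = {r, p}" using representative(4)[OF s(1)] unfolding s(2)[symmetric] e[symmetric] .
    moreover have "v = {p, r}" using representative(4)[OF v(1)] unfolding v(2)[symmetric] r' .
    ultimately have "s = v" by blast
    thus ?thesis using s v by simp
  qed (use e in simp)
  show "p \<in> class_representatives t \<or> conjugate_poly p \<in> class_representatives t" if p: "mirr p" "Polynomial.degree p \<le> t" for p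
  proof (cases "p = conjugate_poly p")
    case True
    show ?thesis
    proof (cases "p = [:1, 1:]")
      case False
      obtain j where j: "Polynomial.degree p = 2 * j" using self_conjugate_even_degree[OF p(1) True False] by (elim evenE)
      have "p \<in> self_conjugates (2 * j)" unfolding self_conjugates_iff using p(1) j True by blast
      moreover have "j \<in> {1..t div 2}" using mirr_D(4)[OF p(1)] p(2) j by auto
      ultimately show ?thesis unfolding class_representatives_def by blast
    qed (simp add: class_representatives_def)
  next
    case False
    let ?j = "Polynomial.degree p" and ?s = "{p, conjugate_poly p}"
    have s: "?s \<in> conjugate_pairs ?j"
      unfolding conjugate_pairs_def using False p(1) mirr_conjugate[OF p(1)] conjugate_props(2)[OF p(1)]
      by (intro CollectI exI[of _ p]) (simp add: monic_irreds_iff)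
    have "representative ?s \<in> class_representatives t"
      unfolding class_representatives_def using s p mirr_D(4)[OF p(1)] by force
    moreover have "representative ?s = p \<or> representative ?s = conjugate_poly p"
      using representative(4)[OF s] by blast
    ultimately show ?thesis by metis
  qed
qed

lemma prod_class_representatives:
  fixes f :: "'a poly \<Rightarrow> real"
  assumes u: "f [:1, 1:] = a"
    and n: "\<And>p j. mirr p \<Longrightarrow> p = conjugate_poly p \<Longrightarrow> p \<noteq> [:1, 1:] \<Longrightarrow> Polynomial.degree p = 2 * j \<Longrightarrow> f p = b j"
    and m: "\<And>p. mirr p \<Longrightarrow> p \<noteq> conjugate_poly p \<Longrightarrow> f p = c (Polynomial.degree p)"
  shows "prod f (class_representatives t) = a * (\<Prod>j\<in>{1..t div 2}. b j ^ card (self_conjugates (2 * j))) *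
    (\<Prod>j\<in>{1..t}. c j ^ card (conjugate_pairs j))"
proof -
  let ?B = "\<Union>j\<in>{1..t div 2}. self_conjugates (2 * j)" and ?C = "\<Union>j\<in>{1..t}. representative ` conjugate_pairs j"
  have fin: "finite ?B" "finite ?C" using finite_self_conjugates card_conjugate_pairs(1) by auto
  have ne: "p \<noteq> [:1, 1:]" if "Polynomial.degree p = 2 * j" for p :: "'a poly" and j using that by auto
  have "prod f ?B = (\<Prod>j\<in>{1..t div 2}. prod f (self_conjugates (2 * j)))"
    using finite_self_conjugates by (intro prod.UNION_disjoint) (auto simp: self_conjugates_iff)
  also have "\<dots> = (\<Prod>j\<in>{1..t div 2}. b j ^ card (self_conjugates (2 * j)))"
  proof (rule prod.cong[OF refl])
    fix j
    have "prod f (self_conjugates (2 * j)) = (\<Prod>p\<in>self_conjugates (2 * j). b j)"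
      by (rule prod.cong[OF refl], rule n) (auto simp: self_conjugates_iff)
    thus "prod f (self_conjugates (2 * j)) = b j ^ card (self_conjugates (2 * j))" by simp
  qed
  finally have B: "prod f ?B = \<dots>" .
  have inj: "inj_on representative (conjugate_pairs j)" for j
  proof (rule inj_onI)
    fix s v assume s: "s \<in> conjugate_pairs j" and v: "v \<in> conjugate_pairs j" and e: "representative s = representative v"
    show "s = v" using representative(4)[OF s] unfolding e representative(4)[OF v, symmetric] .
  qed
  have "prod f ?C = (\<Prod>j\<in>{1..t}. prod f (representative ` conjugate_pairs j))"
  proof (rule prod.UNION_disjoint)
    have "Polynomial.degree p = j" if "p \<in> representative ` conjugate_pairs j" for p j
      using that representative(2) by blast
    thus "\<forall>i\<in>{1..t}. \<forall>j\<in>{1..t}. i \<noteq> j \<longrightarrow> representative ` conjugate_pairs i \<inter> representative ` conjugate_pairs j = {}"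
      by blast
  qed (use card_conjugate_pairs(1) in auto)
  also have "\<dots> = (\<Prod>j\<in>{1..t}. c j ^ card (conjugate_pairs j))"
  proof (rule prod.cong[OF refl])
    fix j
    have "prod f (representative ` conjugate_pairs j) = (\<Prod>s\<in>conjugate_pairs j. f (representative s))"
      using prod.reindex[OF inj, of f] by (simp add: o_def)
    also have "\<dots> = (\<Prod>s\<in>conjugate_pairs j. c j)"
    proof (rule prod.cong[OF refl])
      fix s assume s: "s \<in> conjugate_pairs j"
      show "f (representative s) = c j" using m[OF representative(1)[OF s] representative(3)[OF s]]
        by (simp only: representative(2)[OF s])
    qed
    finally show "prod f (representative ` conjugate_pairs j) = c j ^ card (conjugate_pairs j)" by simp
  qed
  finally have C: "prod f ?C = \<dots>" .
  have sc: "p = conjugate_poly p" if p: "p \<in> {[:1, 1:]} \<union> ?B" for p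
  proof -
    consider "p = [:1, 1:]" | j where "p \<in> self_conjugates (2 * j)" using p by blast
    thus ?thesis
    proof cases
      case 1
      show ?thesis unfolding 1 by (rule conjugate_unipotent[symmetric])
    qed (simp only: self_conjugates_iff)
  qed
  have nsc: "p \<noteq> conjugate_poly p" if "p \<in> ?C" for p
    using that by (elim UN_E imageE) (simp only: representative(3) not_False_eq_True)
  have "prod f (class_representatives t) = prod f ({[:1, 1:]} \<union> ?B) * prod f ?C"
    unfolding class_representatives_def
  proof (rule prod.union_disjoint)
    show "({[:1, 1:]} \<union> ?B) \<inter> ?C = {}"
      by (rule equals0I, elim IntE, drule sc, drule nsc, erule notE, assumption)
  qed (use fin in auto)
  also have "prod f ({[:1, 1:]} \<union> ?B) = prod f {[:1, 1:]} * prod f ?B"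
    using fin ne by (intro prod.union_disjoint) (auto simp: self_conjugates_iff)
  finally show ?thesis by (simp only: B C) (simp add: u)
qed

end

section \<open>Values of the local series\<close>

context finite_subfield_2
begin

lemma local_sum_unipotent:
  "summable (\<lambda>k. \<bar>local_term [:1, 1:] k\<bar>)" "suminf (local_term [:1, 1:]) = unipotent_product q"
proof -
  have y: "0 < 1 / real q" "1 / real q \<le> 1/2" using reciprocal_power_bounds[OF q_ge_2 order.refl] by simp_all
  hence y1: "1 / real q < 1" by linarith
  note E = ext[where f = "local_term [:1, 1:]", OF local_term_unipotent]
  show "summable (\<lambda>k. \<bar>local_term [:1, 1:] k\<bar>)"
    unfolding E by (rule local_factor_unipotent(1)[OF y(1) y1])
  show "suminf (local_term [:1, 1:]) = unipotent_product q"
    unfolding E unipotent_product_def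
    by (rule LIMSEQ_unique[OF local_factor_unipotent(2)[OF y(1) y1] prod_limits(1)[OF y]])
qed

lemma local_sum_self_conjugate:
  assumes p: "mirr p" "p = conjugate_poly p" "p \<noteq> [:1, 1:]" "Polynomial.degree p = 2 * j"
  shows "summable (\<lambda>k. \<bar>local_term p k\<bar>)" "suminf (local_term p) = unitary_product q j"
proof -
  have "j \<ge> 1" using mirr_D(4)[OF p(1)] p(4) by simp
  hence y: "0 < 1 / real q ^ j" "1 / real q ^ j \<le> 1/2" using reciprocal_power_bounds[OF q_ge_2] by blast+
  hence y1: "1 / real q ^ j < 1" by linarith
  note E = ext[where f = "local_term p", OF local_term_self_conjugate[OF p]]
  show "summable (\<lambda>k. \<bar>local_term p k\<bar>)"
    unfolding E by (rule local_factor_unitary(1)[OF y(1) y1])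
  show "suminf (local_term p) = unitary_product q j"
    unfolding E unitary_product_def
    by (rule LIMSEQ_unique[OF local_factor_unitary(2)[OF y(1) y1] prod_limits(4)[OF y]])
qed

lemma local_sum_pair:
  assumes p: "mirr p" "p \<noteq> conjugate_poly p"
  shows "summable (\<lambda>k. \<bar>local_term p k\<bar>)" "suminf (local_term p) = linear_product q (Polynomial.degree p)"
proof -
  have "Polynomial.degree p \<ge> 1" using mirr_D(4)[OF p(1)] by simp
  hence y: "0 < 1 / real q ^ Polynomial.degree p" "1 / real q ^ Polynomial.degree p \<le> 1/2"
    using reciprocal_power_bounds[OF q_ge_2] by blast+
  hence y1: "1 / real q ^ Polynomial.degree p < 1" by linarith
  note E = ext[where f = "local_term p", OF local_term_pair[OF p(2)]]
  show "summable (\<lambda>k. \<bar>local_term p k\<bar>)"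
    unfolding E by (rule local_factor_linear(1)[OF y(1) y1])
  show "suminf (local_term p) = linear_product q (Polynomial.degree p)"
    unfolding E linear_product_def
    by (rule LIMSEQ_unique[OF local_factor_linear(2)[OF y(1) y1] prod_limits(7)[OF y]])
qed

end

section \<open>The limit for a given field and the uniform bounds\<close>

lemma class_proportion_tendsto:
  fixes F :: "'a::alg_closed_field set"
  assumes F: "finite_subfield_2 F" and t: "t \<ge> 1"
  shows "(\<lambda>n. real (card {A \<in> Sp n F. no_small_factor F t (char_poly A)}) / real (card (Sp n F))) \<longlonglongrightarrow>
    unipotent_product (card F) *
    (\<Prod>j\<in>{1..t div 2}. unitary_product (card F) j ^ card (finite_subfield_2.self_conjugates F (2 * j))) *
    (\<Prod>j\<in>{1..t}. linear_product (card F) j ^ card (finite_subfield_2.conjugate_pairs F j))"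
proof -
  interpret finite_subfield_2 F by (rule F)
  interpret R: factor_representatives F t "class_representatives t"
    by unfold_locales (fact factor_representatives_class[OF t])+
  have "summable (\<lambda>k. \<bar>local_term p k\<bar>)" if p: "p \<in> class_representatives t" for p
  proof (cases rule: class_representatives_cases[OF p])
    case 1
    thus ?thesis using local_sum_unipotent(1) by simp
  next
    case (2 j)
    thus ?thesis using local_sum_self_conjugate(1) by blast
  next
    case (3 j s)
    show ?thesis unfolding 3(3) using representative(1,3)[OF 3(2)] by (rule local_sum_pair)
  qed
  hence "R.proportion \<longlonglongrightarrow> (\<Prod>p\<in>class_representatives t. suminf (local_term p))" by (rule R.proportion_tendsto)
  also have "(\<Prod>p\<in>class_representatives t. suminf (local_term p)) = unipotent_product q *
    (\<Prod>j\<in>{1..t div 2}. unitary_product q j ^ card (self_conjugates (2 * j))) *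
    (\<Prod>j\<in>{1..t}. linear_product q j ^ card (conjugate_pairs j))"
    by (rule prod_class_representatives[where f = "\<lambda>p. suminf (local_term p)" and b = "unitary_product q" and c = "linear_product q",
        OF local_sum_unipotent(2) local_sum_self_conjugate(2) local_sum_pair(2)])
  finally show ?thesis unfolding R.proportion_def .
qed

lemma finite_subfield_2_GF:
  assumes "k \<ge> 1"
  shows "finite_subfield_2 (GF (2 ^ k))"
proof
  have "of_nat CHAR(bit alg_closure) = (0 :: bit alg_closure)" by (rule of_nat_CHAR)
  thus "(1 :: bit alg_closure) + 1 = 0" unfolding CHAR_bit_alg_closure by simp
qed (use GF_closed[OF assms] card_GF(1)[OF assms] in auto)

lemma Nstar_Mstar_eq:
  assumes "k \<ge> 1"
  shows "Nstar (2 ^ k) j = card (finite_subfield_2.self_conjugates (GF (2 ^ k)) j)"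
    "Mstar (2 ^ k) j = card (finite_subfield_2.conjugate_pairs (GF (2 ^ k)) j)"
  unfolding Nstar_def Mstar_def finite_subfield_2.self_conjugates_def[OF finite_subfield_2_GF[OF assms]]
    finite_subfield_2.conjugate_pairs_def[OF finite_subfield_2_GF[OF assms]] by (rule refl)+

theorem theorem2p10:
  fixes t :: nat
  assumes "t \<ge> 1"
  shows "(\<forall>q. even_prime_power q \<longrightarrow> (\<lambda>n. Sp_proportion q t n) \<longlonglongrightarrow> Q_Sp q t) \<and>
         (\<exists>\<epsilon>>0. \<forall>q. even_prime_power q \<longrightarrow> Q_Sp q t \<le> 1 - \<epsilon>) \<and>
         (\<exists>\<epsilon>>0. \<forall>q. even_prime_power q \<longrightarrow> Q_Sp q t \<ge> \<epsilon>)"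
proof -
  have main: "(\<lambda>n. Sp_proportion q t n) \<longlonglongrightarrow> Q_Sp q t \<and> Q_Sp q t \<le> exp (- 1 / 4) \<and>
    exp (- 2) * exp (- 4) ^ (t div 2) * exp (- 4) ^ t \<le> Q_Sp q t" if pp: "even_prime_power q" for q
  proof -
    obtain k where k: "k \<ge> 1" "q = 2 ^ k" using pp by (auto simp: even_prime_power_def)
    interpret G: finite_subfield_2 "GF q" unfolding k(2) by (rule finite_subfield_2_GF[OF k(1)])
    have c: "card (GF q) = q" unfolding k(2) by (rule card_GF(2)[OF k(1)])
    note e = Nstar_Mstar_eq[OF k(1), folded k(2)]
    have q2: "q \<ge> 2" using G.q_ge_2 unfolding c .
    \<comment> \<open>The gap at 3 matters: the estimate \<open>q / 4 \<le> (q - 2) / 2\<close>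
      behind the upper bound starts at \<open>q = 4\<close>.\<close>
    have q: "q = 2 \<or> q \<ge> 4"
    proof (cases "k = 1")
      case False
      hence "(2::nat) ^ 2 \<le> 2 ^ k" using k(1) by (intro power_increasing) auto
      thus ?thesis by (simp add: k(2))
    qed (simp add: k(2))
    show ?thesis
    proof (intro conjI)
      show "(\<lambda>n. Sp_proportion q t n) \<longlonglongrightarrow> Q_Sp q t"
        using class_proportion_tendsto[OF G.finite_subfield_2_axioms assms]
        unfolding Sp_proportion_def Q_Sp_eq[OF q2] e c .
      show "Q_Sp q t \<le> exp (- 1 / 4)"
        using G.card_conjugate_pairs_1 unfolding c e[symmetric] by (rule Q_Sp_upper_bound[OF q assms])
      show "exp (- 2) * exp (- 4) ^ (t div 2) * exp (- 4) ^ t \<le> Q_Sp q t"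
        by (rule Q_Sp_lower_bound[OF q2]) (unfold e, use G.card_self_conjugates G.card_conjugate_pairs(2) c in simp_all)
    qed
  qed
  show ?thesis
  proof (intro conjI)
    show "\<exists>\<epsilon>>0. \<forall>q. even_prime_power q \<longrightarrow> Q_Sp q t \<le> 1 - \<epsilon>"
      using main by (intro exI[of _ "1 - exp (- 1 / 4)"]) auto
    show "\<exists>\<epsilon>>0. \<forall>q. even_prime_power q \<longrightarrow> Q_Sp q t \<ge> \<epsilon>"
      using main by (intro exI[of _ "exp (- 2) * exp (- 4) ^ (t div 2) * exp (- 4) ^ t"]) auto
  qed (use main in blast)
qed

end
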